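(* Let $n\ge1$ and $h\ge0$ be integers. The set of Capelli immanants $$\bigcup_{k=0}^h\big\{Cimm_\lambda[i_1i_2\cdots i_k;j_1j_2\cdots j_k]\;:\;\lambda\vdash k,\ \lambda_1\le n,\ (i_1,\dots,i_k),(j_1,\dots,j_k)\in\{1,\dots,n\}^k\big\}$$ is a spanning set of the $h$-th filtration element $\mathbf U(gl(n))^{(h)}$ of $\mathbf U(gl(n))$.
   Context: $\mathbf U(gl(n))^{(h)}$ is the span in $\mathbf U(gl(n))$ of all products of at most $h$ elements of $gl(n)$ (standard filtration). **Virtual variables.** Let $A_0=\{\alpha_1,\dots,\alpha_{m_0}\}$, $A_1=\{\beta_1,\dots,\beta_{m_1}\}$, $L=\{1,\dots,n\}$ be disjoint sets of symbols ($m_0,m_1$ sufficiently large), with parities $|\alpha_s|=0$, $|\beta_t|=|i|=1$ in $\mathbb Z_2$. $gl(m_0|m_1+n)$ is the complex Lie superalgebra with basis $e_{a,b}$, $a,b\in A_0\cup A_1\cup L$, $|e_{a,b}|=|a|+|b|$, and superbracket $[e_{a,b},e_{c,d}]=\delta_{bc}e_{a,d}-(-1)^{(|a|+|b|)(|c|+|d|)}\delta_{ad}e_{c,b}$; $gl(n)$ is its Lie subalgebra spanned by $e_{ij}=e_{i,j}$, $i,j\in L$. A product $e_{a_m,b_m}\cdots e_{a_1,b_1}$ in $\mathbf U(gl(m_0|m_1+n))$ is irregular if there are $i\le m$ and $\gamma\in A_0\cup A_1$ with $\#\{j\le i: b_j=\gamma\}>\#\{j<i: a_j=\gamma\}$.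 $\mathbf{Irr}$ is the left ideal generated by irregular products. It is known that $\mathbf U(gl(n))\cap\mathbf{Irr}=0$ and that $Virt(m_0+m_1,n)=\mathbf U(gl(n))\oplus\mathbf{Irr}$ is a subalgebra in which $\mathbf{Irr}$ is a two-sided ideal; $\mathfrak p:Virt(m_0+m_1,n)\to\mathbf U(gl(n))$ is the projection with kernel $\mathbf{Irr}$. **Column Capelli bitableaux.** For $i_1,\dots,i_k,j_1,\dots,j_k\in\{1,\dots,n\}$ and distinct $\alpha_1,\dots,\alpha_k\in A_0$, $$\left[\begin{array}{c}i_1\\ \vdots\\ i_k\end{array}\right|\left.\begin{array}{c}j_1\\ \vdots\\ j_k\end{array}\right]=\mathfrak p\big(e_{i_1,\alpha_1}\cdots e_{i_k,\alpha_k}\,e_{\alpha_1,j_1}\cdots e_{\alpha_k,j_k}\big)\in\mathbf U(gl(n))$$ (the argument of $\mathfrak p$ lies in $Virt(m_0+m_1,n)$, and the result does not depend on the choice of the $\alpha$'s). **Capelli immanants.** For $\lambda\vdash k$, $\chi^\lambda$ denotes the irreducible character of the symmetric group $\mathbf S_k$ labelled so that $\lambda=(1^k)$ gives the trivial and $\lambda=(k)$ the sign character (i.e. $\chi^\lambda$ is the character usually attached to the conjugate partition). Put $$Cimm_\lambda[i_1\cdots i_k;j_1\cdots j_k]=\sum_{\sigma\in\mathbf S_k}\chi^\lambda(\sigma)\left[\begin{array}{c}i_{\sigma(1)}\\ \vdots\\ i_{\sigma(k)}\end{array}\right|\left.\begin{array}{c}j_1\\ \vdots\\ j_k\end{array}\right];$$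 for $k=0$ the (empty) Capelli immanant is $1$. *)

theory Defs
  imports Complex_Main "HOL-Library.Cardinality" "HOL-Library.Poly_Mapping" "HOL-Combinatorics.Permutations"
begin

section \<open>Monoid algebras over the complex numbers\<close>

text \<open>
  For a monoid \<open>'m\<close>, written additively, \<open>'m \<Rightarrow>\<^sub>0 complex\<close> with its library ring structure is the
  monoid algebra. Below, free associative algebras are obtained from monoids of words and group
  algebras of symmetric groups from monoids of self-maps.
\<close>

definition malg_scale :: "complex \<Rightarrow> ('m::monoid_add \<Rightarrow>\<^sub>0 complex) \<Rightarrow> ('m \<Rightarrow>\<^sub>0 complex)" where
  "malg_scale c x = Poly_Mapping.single 0 c * x"

lemma single_zero_commute:
  "Poly_Mapping.single 0 c * x = x * Poly_Mapping.single (0::'m::monoid_add) (c::complex)"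
proof -
  have "Poly_Mapping.lookup (Poly_Mapping.single 0 c * x) k =
        Poly_Mapping.lookup (x * Poly_Mapping.single 0 c) k" for k
  proof -
    have "finite {l. Poly_Mapping.lookup x l \<noteq> 0}" by simp
    then have f: "finite {l. (Poly_Mapping.lookup x l * c when k = l) \<noteq> 0}"
      by (rule rev_finite_subset) (auto simp: when_def)
    have "Poly_Mapping.lookup (Poly_Mapping.single 0 c * x) k =
          (\<Sum>l. (c * (\<Sum>q. Poly_Mapping.lookup x q when k = l + q)) when 0 = l)"
      by (simp add: lookup_mult lookup_single when_mult)
    also have "\<dots> = c * Poly_Mapping.lookup x k" by simp
    also have "\<dots> = (\<Sum>l. Poly_Mapping.lookup x l * c when k = l)"
      by (simp add: mult.commute)
    also have "\<dots> = (\<Sum>l. Poly_Mapping.lookup x l * (\<Sum>q. (c when k = l + q) when 0 = q))"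
      by (simp add: mult_when)
    also have "\<dots> = Poly_Mapping.lookup (x * Poly_Mapping.single 0 c) k"
      by (simp add: lookup_mult lookup_single when_def conj_commute if_distrib cong: if_cong)
         (intro Sum_any.cong arg_cong2[where f="(*)"] refl, auto)
    finally show ?thesis .
  qed
  then show ?thesis by (intro poly_mapping_eqI)
qed

interpretation malg: vector_space malg_scale
  by unfold_locales
    (simp_all add: malg_scale_def algebra_simps single_add mult_single flip: mult.assoc)

definition malg_map :: "('m \<Rightarrow> 'k) \<Rightarrow> ('m::monoid_add \<Rightarrow>\<^sub>0 complex) \<Rightarrow> ('k::monoid_add \<Rightarrow>\<^sub>0 complex)" where
  "malg_map f x = (\<Sum>w\<in>Poly_Mapping.keys x. Poly_Mapping.single (f w) (Poly_Mapping.lookup x w))"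

lemma malg_map_superset:
  assumes "finite A" "Poly_Mapping.keys x \<subseteq> A"
  shows "malg_map f x = (\<Sum>w\<in>A. Poly_Mapping.single (f w) (Poly_Mapping.lookup x w))"
  unfolding malg_map_def using assms
  by (intro sum.mono_neutral_left) (auto simp: in_keys_iff)

lemma malg_map_add: "malg_map f (x + y) = malg_map f x + malg_map f y"
proof -
  let ?A = "Poly_Mapping.keys x \<union> Poly_Mapping.keys y"
  have "Poly_Mapping.keys (x + y) \<subseteq> ?A" by (rule keys_add)
  then have "malg_map f z = (\<Sum>w\<in>?A. Poly_Mapping.single (f w) (Poly_Mapping.lookup z w))"
    if "z \<in> {x, y, x + y}" for z
    using that by (intro malg_map_superset) auto
  then show ?thesis by (simp add: lookup_add single_add sum.distrib)
qed

lemma malg_map_zero [simp]: "malg_map f 0 = 0"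
  by (simp add: malg_map_def)

lemma malg_map_single [simp]:
  "malg_map f (Poly_Mapping.single w c) = Poly_Mapping.single (f w) c"
  by (simp add: malg_map_def)

lemma malg_map_uminus: "malg_map f (- x) = - malg_map f x"
  using malg_map_add[of f x "- x"] by (simp add: add_eq_0_iff)

lemma malg_map_diff: "malg_map f (x - y) = malg_map f x - malg_map f y"
  using malg_map_add[of f x "- y"] by (simp add: malg_map_uminus)

lemma malg_map_sum: "malg_map f (sum g A) = (\<Sum>a\<in>A. malg_map f (g a))"
  by (induction A rule: infinite_finite_induct) (simp_all add: malg_map_add)

lemma malg_sum_singles:
  fixes x :: "'m::monoid_add \<Rightarrow>\<^sub>0 complex"
  shows "x = (\<Sum>w\<in>Poly_Mapping.keys x. Poly_Mapping.single w (Poly_Mapping.lookup x w))"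
  by (rule poly_mapping_eqI) (auto simp: lookup_sum lookup_single when_def in_keys_iff)

lemma malg_map_mult:
  assumes "\<And>v w. f (v + w) = f v + f w"
  shows "malg_map f (x * y) = malg_map f x * malg_map f y"
proof -
  let ?s = "\<lambda>z w. Poly_Mapping.single w (Poly_Mapping.lookup z w)"
  have "x * y = (\<Sum>v\<in>Poly_Mapping.keys x. \<Sum>w\<in>Poly_Mapping.keys y. ?s x v * ?s y w)"
    by (subst malg_sum_singles[of x], subst malg_sum_singles[of y]) (simp add: sum_product)
  then have "malg_map f (x * y) =
      (\<Sum>v\<in>Poly_Mapping.keys x. \<Sum>w\<in>Poly_Mapping.keys y. malg_map f (?s x v * ?s y w))"
    by (simp add: malg_map_sum)
  also have "\<dots> = malg_map f x * malg_map f y"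
    unfolding malg_map_def[of f x] malg_map_def[of f y]
    by (simp add: sum_product mult_single assms)
  finally show ?thesis .
qed

definition left_ideal :: "'r::ring_1 set \<Rightarrow> bool" where
  "left_ideal I \<longleftrightarrow> 0 \<in> I \<and> (\<forall>x\<in>I. \<forall>y\<in>I. x + y \<in> I) \<and> (\<forall>r. \<forall>x\<in>I. r * x \<in> I)"

definition two_sided_ideal :: "'r::ring_1 set \<Rightarrow> bool" where
  "two_sided_ideal I \<longleftrightarrow> left_ideal I \<and> (\<forall>r. \<forall>x\<in>I. x * r \<in> I)"

lemma two_sided_ideal_hull: "two_sided_ideal (two_sided_ideal hull S)"
  by (rule hull_in) (auto simp: two_sided_ideal_def left_ideal_def)

lemma left_ideal_hull: "left_ideal (left_ideal hull S)"
  by (rule hull_in) (auto simp: left_ideal_def)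

section \<open>Enveloping algebras of general linear Lie superalgebras\<close>

text \<open>
  The alphabet of symbols indexing the basis \<open>e\<^bsub>a,b\<^esub>\<close> is a type with a parity, the elements of
  \<open>\<int>\<^sub>2\<close> being represented by \<open>0\<close> and \<open>1\<close>; parities only occur as exponents of \<open>-1\<close>.
\<close>

class super_alphabet =
  fixes parity :: "'a \<Rightarrow> nat"
  assumes parity_less_2: "parity a < 2"

datatype 'a word = Word "'a list"

instantiation word :: (type) monoid_add
begin
definition "0 = Word []"
fun plus_word :: "'a word \<Rightarrow> 'a word \<Rightarrow> 'a word" where
  "Word xs + Word ys = Word (xs @ ys)"
instance
proof
  fix a b c :: "'a word"
  show "a + b + c = a + (b + c)" by (cases a; cases b; cases c) simp
  show "0 + a = a" by (cases a) (simp add: zero_word_def)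
  show "a + 0 = a" by (cases a) (simp add: zero_word_def)
qed
end

type_synonym 'a free_alg = "('a \<times> 'a) word \<Rightarrow>\<^sub>0 complex"

definition free_gen :: "'a \<Rightarrow> 'a \<Rightarrow> 'a free_alg" where
  "free_gen a b = Poly_Mapping.single (Word [(a, b)]) 1"

definition super_sign :: "'a::super_alphabet \<Rightarrow> 'a \<Rightarrow> 'a \<Rightarrow> 'a \<Rightarrow> 'r::ring_1" where
  "super_sign a b c d = (-1) ^ ((parity a + parity b) * (parity c + parity d))"

definition superbracket :: "'a::super_alphabet \<Rightarrow> 'a \<Rightarrow> 'a \<Rightarrow> 'a \<Rightarrow> 'a free_alg" where
  "superbracket a b c d =
     (if b = c then free_gen a d else 0) - super_sign a b c d * (if a = d then free_gen c b else 0)"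

definition uea_relator :: "'a::super_alphabet \<Rightarrow> 'a \<Rightarrow> 'a \<Rightarrow> 'a \<Rightarrow> 'a free_alg" where
  "uea_relator a b c d =
     free_gen a b * free_gen c d - super_sign a b c d * (free_gen c d * free_gen a b)
       - superbracket a b c d"

definition uea_ideal :: "'a::super_alphabet free_alg set" where
  "uea_ideal = two_sided_ideal hull {uea_relator a b c d | a b c d. True}"

definition uea_eq :: "'a::super_alphabet free_alg \<Rightarrow> 'a free_alg \<Rightarrow> bool" where
  "uea_eq x y \<longleftrightarrow> x - y \<in> uea_ideal"

lemma uea_ideal: "two_sided_ideal uea_ideal"
  unfolding uea_ideal_def by (rule two_sided_ideal_hull)

lemma uea_ideal_zero: "0 \<in> uea_ideal"
  and uea_ideal_add: "x \<in> uea_ideal \<Longrightarrow> y \<in> uea_ideal \<Longrightarrow> x + y \<in> uea_ideal"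
  and uea_ideal_mult_left: "x \<in> uea_ideal \<Longrightarrow> r * x \<in> uea_ideal"
  and uea_ideal_mult_right: "x \<in> uea_ideal \<Longrightarrow> x * r \<in> uea_ideal"
  using uea_ideal unfolding two_sided_ideal_def left_ideal_def by blast+

lemma uea_ideal_uminus: "x \<in> uea_ideal \<Longrightarrow> - x \<in> uea_ideal"
  using uea_ideal_mult_left[of x "- 1"] by simp

text \<open>The quotient is the universal enveloping algebra of the general linear Lie superalgebra whose
  basis is indexed by pairs of symbols of the alphabet.\<close>

quotient_type (overloaded) 'a uea = "'a::super_alphabet free_alg" / uea_eq
proof (rule equivpI)
  show "reflp (uea_eq :: 'a free_alg \<Rightarrow> _)"
    by (auto intro!: reflpI simp: uea_eq_def uea_ideal_zero)
  show "symp (uea_eq :: 'a free_alg \<Rightarrow> _)"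
    by (rule sympI) (metis uea_eq_def minus_diff_eq uea_ideal_uminus)
  show "transp (uea_eq :: 'a free_alg \<Rightarrow> _)"
  proof (rule transpI)
    fix x y z :: "'a free_alg"
    assume "uea_eq x y" "uea_eq y z"
    then show "uea_eq x z" using uea_ideal_add[of "x - y" "y - z"] by (simp add: uea_eq_def)
  qed
qed

lemma lookup_mult_empty_word:
  fixes x y :: "'b word \<Rightarrow>\<^sub>0 complex"
  shows "Poly_Mapping.lookup (x * y) 0 = Poly_Mapping.lookup x 0 * Poly_Mapping.lookup y 0"
proof -
  have e: "0 = l + q \<longleftrightarrow> 0 = l \<and> 0 = q" for l q :: "'b word"
    by (cases l; cases q) (auto simp: zero_word_def)
  have "Poly_Mapping.lookup (x * y) 0 =
        (\<Sum>l. (Poly_Mapping.lookup x l * Poly_Mapping.lookup y 0) when 0 = l)"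
    unfolding lookup_mult e
    by (intro Sum_any.cong) (auto simp: when_def)
  then show ?thesis by simp
qed

lemma lookup_free_gen_empty_word: "Poly_Mapping.lookup (free_gen a b) 0 = 0"
  by (simp add: free_gen_def lookup_single when_def zero_word_def)

lemma one_notin_uea_ideal: "1 \<notin> (uea_ideal :: 'a::super_alphabet free_alg set)"
proof
  assume "1 \<in> (uea_ideal :: 'a free_alg set)"
  moreover have "uea_ideal \<subseteq> {x :: 'a free_alg. Poly_Mapping.lookup x 0 = 0}"
    unfolding uea_ideal_def
  proof (rule hull_minimal)
    show "two_sided_ideal {x :: 'a free_alg. Poly_Mapping.lookup x 0 = 0}"
      by (auto simp: two_sided_ideal_def left_ideal_def lookup_add lookup_mult_empty_word)
    show "{uea_relator a b c d | a b c d. True} \<subseteq> {x :: 'a free_alg. Poly_Mapping.lookup x 0 = 0}"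
      by (auto simp: uea_relator_def superbracket_def lookup_minus lookup_add
          lookup_mult_empty_word lookup_free_gen_empty_word)
  qed
  ultimately show False by (auto simp: lookup_one)
qed

instantiation uea :: (super_alphabet) ring_1
begin
lift_definition zero_uea :: "'a uea" is 0 .
lift_definition one_uea :: "'a uea" is 1 .
lift_definition plus_uea :: "'a uea \<Rightarrow> 'a uea \<Rightarrow> 'a uea" is "(+)"
  unfolding uea_eq_def by (metis add_diff_add uea_ideal_add)
lift_definition uminus_uea :: "'a uea \<Rightarrow> 'a uea" is uminus
  unfolding uea_eq_def by (metis minus_diff_minus uea_ideal_uminus)
lift_definition minus_uea :: "'a uea \<Rightarrow> 'a uea \<Rightarrow> 'a uea" is "(-)"
proof -
  fix x x' y y' :: "'a free_alg"
  assume "uea_eq x x'" "uea_eq y y'"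
  then have "(x - x') + - (y - y') \<in> uea_ideal"
    unfolding uea_eq_def by (intro uea_ideal_add uea_ideal_uminus)
  then show "uea_eq (x - y) (x' - y')" by (simp add: uea_eq_def algebra_simps)
qed
lift_definition times_uea :: "'a uea \<Rightarrow> 'a uea \<Rightarrow> 'a uea" is "(*)"
proof -
  fix x x' y y' :: "'a free_alg"
  assume "uea_eq x x'" "uea_eq y y'"
  then have "(x - x') * y + x' * (y - y') \<in> uea_ideal"
    unfolding uea_eq_def by (intro uea_ideal_add uea_ideal_mult_left uea_ideal_mult_right)
  then show "uea_eq (x * y) (x' * y')" by (simp add: uea_eq_def algebra_simps)
qed
instance
proof
  show "(0 :: 'a uea) \<noteq> 1"
    by transfer (use one_notin_uea_ideal uea_ideal_uminus in \<open>force simp: uea_eq_def\<close>)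
qed (transfer; simp add: algebra_simps uea_eq_def uea_ideal_zero)+
end

lift_definition uea_scale :: "complex \<Rightarrow> 'a::super_alphabet uea \<Rightarrow> 'a uea" is malg_scale
  unfolding uea_eq_def malg_scale_def
  by (metis right_diff_distrib uea_ideal_mult_left)

interpretation uea: vector_space uea_scale
  by unfold_locales
    (transfer; simp add: malg.scale_right_distrib malg.scale_left_distrib uea_eq_def uea_ideal_zero)+

lift_definition uea_gen :: "'a \<Rightarrow> 'a \<Rightarrow> 'a::super_alphabet uea" is free_gen .

lemma uea_gen_supercommutator:
  "uea_gen a b * uea_gen c d - super_sign a b c d * (uea_gen c d * uea_gen a b) =
     (if b = c then uea_gen a d else 0) - super_sign a b c d * (if a = d then uea_gen c b else 0)"
proof -
  have eq: "uea_eq (free_gen a b * free_gen c d - super_sign a b c d * (free_gen c d * free_gen a b))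
     ((if b = c then free_gen a d else 0) - super_sign a b c d * (if a = d then free_gen c b else 0))"
    unfolding uea_eq_def uea_ideal_def superbracket_def[symmetric] uea_relator_def[symmetric]
    by (rule hull_inc) blast
  have sgn: "abs_uea (super_sign a b c d) = super_sign a b c d"
    by (cases "even ((parity a + parity b) * (parity c + parity d))")
      (simp_all only: super_sign_def neg_one_even_power neg_one_odd_power
        simp_thms one_uea.abs_eq[symmetric] uminus_uea.abs_eq[symmetric])
  from eq have "abs_uea (free_gen a b * free_gen c d - super_sign a b c d * (free_gen c d * free_gen a b)) =
     abs_uea ((if b = c then free_gen a d else 0) - super_sign a b c d * (if a = d then free_gen c b else 0))"
    by (simp only: uea.abs_eq_iff)
  then show ?thesis
    by (simp only: minus_uea.abs_eq[symmetric] times_uea.abs_eq[symmetric] sgn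
        if_distrib[of abs_uea] uea_gen.abs_eq[symmetric] zero_uea.abs_eq[symmetric])
qed

section \<open>Proper and virtual symbols\<close>

datatype 'n proper = Proper 'n

datatype ('m0, 'm1, 'n) symbol = Alpha 'm0 | Beta 'm1 | Letter "'n proper"

text \<open>\<open>'n proper uea\<close> is \<open>U(gl(n))\<close> for \<open>n = CARD('n)\<close>: all symbols have the same parity, so all
  signs are \<open>1\<close>. \<open>('m0, 'm1, 'n) symbol uea\<close> is \<open>U(gl(m0|m1+n))\<close>.\<close>

instantiation proper :: (type) super_alphabet
begin
definition parity_proper :: "'a proper \<Rightarrow> nat" where "parity_proper i = 1"
instance by standard (simp add: parity_proper_def)
end

instantiation symbol :: (type, type, type) super_alphabet
begin
definition parity_symbol :: "('a, 'b, 'c) symbol \<Rightarrow> nat" where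
  "parity_symbol a = (case a of Alpha _ \<Rightarrow> 0 | Beta _ \<Rightarrow> 1 | Letter _ \<Rightarrow> 1)"
instance by standard (simp add: parity_symbol_def split: symbol.split)
end

fun letter_word :: "('n proper \<times> 'n proper) word
    \<Rightarrow> (('m0, 'm1, 'n) symbol \<times> ('m0, 'm1, 'n) symbol) word" where
  "letter_word (Word w) = Word (map (map_prod Letter Letter) w)"

lemma letter_word_add: "letter_word (v + w) = letter_word v + letter_word w"
  by (cases v; cases w) simp

lemma malg_map_letter_word_relator:
  "malg_map letter_word (uea_relator a b c d) =
     uea_relator (Letter a) (Letter b) (Letter c) (Letter d)"
  by (simp add: uea_relator_def superbracket_def super_sign_def parity_proper_def parity_symbol_def
      malg_map_diff malg_map_mult letter_word_add free_gen_def)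

text \<open>The homomorphism \<open>U(gl(n)) \<rightarrow> U(gl(m0|m1+n))\<close> induced by the inclusion of Lie superalgebras.\<close>

lift_definition uea_embed :: "'n proper uea \<Rightarrow> ('m0, 'm1, 'n) symbol uea" is
  "malg_map letter_word"
proof -
  fix x y :: "'n proper free_alg"
  let ?\<phi> = "malg_map letter_word :: 'n proper free_alg \<Rightarrow> ('m0, 'm1, 'n) symbol free_alg"
  have "uea_ideal \<subseteq> {x. ?\<phi> x \<in> uea_ideal}"
    unfolding uea_ideal_def[where 'a="'n proper"]
  proof (rule hull_minimal)
    show "two_sided_ideal {x. ?\<phi> x \<in> uea_ideal}"
      by (auto simp: two_sided_ideal_def left_ideal_def uea_ideal_zero malg_map_add
          malg_map_mult letter_word_add
          intro: uea_ideal_add uea_ideal_mult_left uea_ideal_mult_right)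
    show "{uea_relator a b c d | a b c d. True} \<subseteq> {x. ?\<phi> x \<in> uea_ideal}"
      unfolding uea_ideal_def by (auto simp: malg_map_letter_word_relator intro!: hull_inc; blast)
  qed
  moreover assume "uea_eq x y"
  ultimately show "uea_eq (?\<phi> x) (?\<phi> y)" by (auto simp: uea_eq_def malg_map_diff)
qed

lemma uea_embed_gen: "uea_embed (uea_gen i j) = uea_gen (Letter i) (Letter j)"
  by transfer (simp add: free_gen_def uea_eq_def uea_ideal_zero)

lemma uea_embed_one: "uea_embed 1 = 1"
  by transfer (simp add: uea_eq_def uea_ideal_zero zero_word_def flip: single_one)

lemma uea_embed_add: "uea_embed (x + y) = uea_embed x + uea_embed y"
  by transfer (simp add: malg_map_add uea_eq_def uea_ideal_zero)

lemma uea_embed_mult: "uea_embed (x * y) = uea_embed x * uea_embed y"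
  by transfer (simp add: malg_map_mult letter_word_add uea_eq_def uea_ideal_zero)

definition gl_subspace :: "'n proper uea set" where
  "gl_subspace = uea.span {uea_gen i j | i j. True}"

definition uea_filtration :: "nat \<Rightarrow> 'n proper uea set" where
  "uea_filtration h = uea.span {prod_list xs | xs. length xs \<le> h \<and> set xs \<subseteq> gl_subspace}"

section \<open>The Capelli devirtualization epimorphism and column Capelli bitableaux\<close>

text \<open>The product \<open>e\<^bsub>a(m),b(m)\<^esub> \<cdots> e\<^bsub>a(1),b(1)\<^esub>\<close>; only the values of \<open>a\<close>, \<open>b\<close> on \<open>{1..m}\<close> matter.\<close>

definition gen_product ::
    "nat \<Rightarrow> (nat \<Rightarrow> 'a) \<Rightarrow> (nat \<Rightarrow> 'a) \<Rightarrow> 'a::super_alphabet uea" where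
  "gen_product m a b = prod_list (map (\<lambda>j. uea_gen (a j) (b j)) (rev [1..<Suc m]))"

definition irregular ::
    "nat \<Rightarrow> (nat \<Rightarrow> ('m0, 'm1, 'n) symbol) \<Rightarrow> (nat \<Rightarrow> ('m0, 'm1, 'n) symbol) \<Rightarrow> bool" where
  "irregular m a b \<longleftrightarrow> (\<exists>i\<in>{1..m}. \<exists>\<gamma>\<in>range Alpha \<union> range Beta.
     card {j. 1 \<le> j \<and> j \<le> i \<and> b j = \<gamma>} > card {j. 1 \<le> j \<and> j < i \<and> a j = \<gamma>})"

definition Irr :: "('m0, 'm1, 'n) symbol uea set" where
  "Irr = left_ideal hull {gen_product m a b | m a b. irregular m a b}"

text \<open>On \<open>Virt = U(gl(n)) \<oplus> Irr\<close> this is the projection with kernel \<open>Irr\<close>; it is unspecified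
  elsewhere.\<close>

definition capelli_proj :: "('m0, 'm1, 'n) symbol uea \<Rightarrow> 'n proper uea" where
  "capelli_proj x = (THE u. x - uea_embed u \<in> Irr)"

text \<open>Here and below, tuples \<open>(i\<^sub>1, \<dots>, i\<^sub>k)\<close> are given by functions of which only the values on
  \<open>{1..k}\<close> matter; \<open>\<alpha>\<close> supplies the distinct symbols \<open>\<alpha>\<^sub>1, \<dots>, \<alpha>\<^sub>k\<close>.\<close>

definition column_bitableau ::
    "(nat \<Rightarrow> ('m0, 'm1, 'n) symbol) \<Rightarrow> nat \<Rightarrow> (nat \<Rightarrow> 'n) \<Rightarrow> (nat \<Rightarrow> 'n) \<Rightarrow> 'n proper uea" where
  "column_bitableau \<alpha> k i j = capelli_proj
     (prod_list (map (\<lambda>t. uea_gen (Letter (Proper (i t))) (\<alpha> t)) [1..<Suc k]) *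
      prod_list (map (\<lambda>t. uea_gen (\<alpha> t) (Letter (Proper (j t)))) [1..<Suc k]))"

section \<open>Irreducible characters of the symmetric groups\<close>

definition partition_of :: "nat \<Rightarrow> nat list \<Rightarrow> bool" where
  "partition_of k \<mu> \<longleftrightarrow> sorted_wrt (\<ge>) \<mu> \<and> (\<forall>p\<in>set \<mu>. p > 0) \<and> sum_list \<mu> = k"

definition first_part :: "nat list \<Rightarrow> nat" where
  "first_part \<mu> = (case \<mu> of [] \<Rightarrow> 0 | p # _ \<Rightarrow> p)"

definition conjugate :: "nat list \<Rightarrow> nat list" where
  "conjugate \<mu> = map (\<lambda>c. length (filter (\<lambda>p. c < p) \<mu>)) [0..<first_part \<mu>]"

datatype 'a self_map = Self_Map "'a \<Rightarrow> 'a"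

instantiation self_map :: (type) monoid_add
begin
definition "0 = Self_Map id"
fun plus_self_map :: "'a self_map \<Rightarrow> 'a self_map \<Rightarrow> 'a self_map" where
  "Self_Map f + Self_Map g = Self_Map (f \<circ> g)"
instance
proof
  fix a b c :: "'a self_map"
  show "a + b + c = a + (b + c)" by (cases a; cases b; cases c) (simp add: comp_assoc)
  show "0 + a = a" by (cases a) (simp add: zero_self_map_def)
  show "a + 0 = a" by (cases a) (simp add: zero_self_map_def)
qed
end

definition perm_elt :: "(nat \<Rightarrow> nat) \<Rightarrow> (nat self_map \<Rightarrow>\<^sub>0 complex)" where
  "perm_elt \<sigma> = Poly_Mapping.single (Self_Map \<sigma>) 1"

definition sym_group_alg :: "nat \<Rightarrow> (nat self_map \<Rightarrow>\<^sub>0 complex) set" where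
  "sym_group_alg k = malg.span {perm_elt \<sigma> | \<sigma>. \<sigma> permutes {1..k}}"

text \<open>The cells (row, column) of the Young diagram in reading order. The canonical Young tableau has
  entry \<open>t \<in> {1..k}\<close> in the \<open>t\<close>-th of these cells.\<close>

definition cells :: "nat list \<Rightarrow> (nat \<times> nat) list" where
  "cells \<mu> = concat (map (\<lambda>r. map (\<lambda>c. (r, c)) [0..<\<mu> ! r]) [0..<length \<mu>])"

definition row_stabilizer :: "nat list \<Rightarrow> (nat \<Rightarrow> nat) set" where
  "row_stabilizer \<mu> = {\<sigma>. \<sigma> permutes {1..sum_list \<mu>} \<and>
     (\<forall>t\<in>{1..sum_list \<mu>}. fst (cells \<mu> ! (\<sigma> t - 1)) = fst (cells \<mu> ! (t - 1)))}"

definition column_stabilizer :: "nat list \<Rightarrow> (nat \<Rightarrow> nat) set" where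
  "column_stabilizer \<mu> = {\<sigma>. \<sigma> permutes {1..sum_list \<mu>} \<and>
     (\<forall>t\<in>{1..sum_list \<mu>}. snd (cells \<mu> ! (\<sigma> t - 1)) = snd (cells \<mu> ! (t - 1)))}"

definition young_symmetrizer :: "nat list \<Rightarrow> (nat self_map \<Rightarrow>\<^sub>0 complex)" where
  "young_symmetrizer \<mu> = (\<Sum>\<sigma>\<in>row_stabilizer \<mu>. perm_elt \<sigma>) *
     (\<Sum>\<tau>\<in>column_stabilizer \<mu>. malg_scale (of_int (sign \<tau>)) (perm_elt \<tau>))"

text \<open>The left ideal of the group algebra of \<open>S\<^sub>k\<close>, \<open>k = sum_list \<mu>\<close>, generated by the Young
  symmetrizer: the irreducible module usually attached to \<open>\<mu>\<close>.\<close>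

definition irr_module :: "nat list \<Rightarrow> (nat self_map \<Rightarrow>\<^sub>0 complex) set" where
  "irr_module \<mu> = {x * young_symmetrizer \<mu> | x. x \<in> sym_group_alg (sum_list \<mu>)}"

text \<open>The trace of a linear endomorphism \<open>T\<close> of a finite-dimensional subspace \<open>W\<close>, read off from
  the coordinates in an arbitrary basis.\<close>

definition trace_on :: "('m::monoid_add \<Rightarrow>\<^sub>0 complex) set
    \<Rightarrow> (('m \<Rightarrow>\<^sub>0 complex) \<Rightarrow> ('m \<Rightarrow>\<^sub>0 complex)) \<Rightarrow> complex" where
  "trace_on W T = (let B = (SOME B. malg.independent B \<and> malg.span B = W)
     in \<Sum>v\<in>B. malg.representation B (T v) v)"

definition usual_character :: "nat list \<Rightarrow> (nat \<Rightarrow> nat) \<Rightarrow> complex" where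
  "usual_character \<mu> \<sigma> = trace_on (irr_module \<mu>) (\<lambda>x. perm_elt \<sigma> * x)"

text \<open>With \<open>usual_character\<close>, \<open>(k)\<close> labels the trivial and \<open>(1\<^sup>k)\<close> the sign character; the
  convention for Capelli immanants is the transposed one.\<close>

definition irr_character :: "nat list \<Rightarrow> (nat \<Rightarrow> nat) \<Rightarrow> complex" where
  "irr_character \<mu> = usual_character (conjugate \<mu>)"

section \<open>Capelli immanants\<close>

text \<open>For \<open>k = 0\<close> the only summand is \<open>capelli_proj 1\<close>, i.e. the empty Capelli immanant is \<open>1\<close>.\<close>

definition Cimm :: "(nat \<Rightarrow> ('m0, 'm1, 'n) symbol)
    \<Rightarrow> nat \<Rightarrow> nat list \<Rightarrow> (nat \<Rightarrow> 'n) \<Rightarrow> (nat \<Rightarrow> 'n) \<Rightarrow> 'n proper uea" where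
  "Cimm \<alpha> k \<mu> i j = (\<Sum>\<sigma> | \<sigma> permutes {1..k}.
     uea_scale (irr_character \<mu> \<sigma>) (column_bitableau \<alpha> k (i \<circ> \<sigma>) j))"

end

theory Submission
  imports Defs "HOL-Combinatorics.Orbits"
begin

text \<open>
  Moving the last \<open>e\<^bsub>i,\<alpha>\<^esub>\<close> of a column Capelli bitableau to the right yields, modulo \<open>Irr\<close>, a recursion
  that expresses a bitableau of height \<open>k + 1\<close> as \<open>\<plusminus>\<close> a bitableau of height \<open>k\<close> times a generator plus
  bitableaux of height \<open>k\<close>; hence the column bitableaux of height at most \<open>h\<close> span the filtration
  element. That the projection is well defined, i.e. \<open>U(gl(n)) \<inter> Irr = 0\<close>, follows by letting
  everything act on tensor powers of the natural module: irregular products annihilate tensors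
  without virtual symbols, whereas a Poincare-Birkhoff-Witt argument shows that \<open>U(gl(n))\<close> acts
  faithfully on these. Finally, the indicator function of the identity of the symmetric group is a
  linear combination of the irreducible characters, so every column bitableau is a combination of Capelli immanants,
  and those with \<open>\<lambda>\<^sub>1 > n\<close> vanish because they antisymmetrize more than \<open>n\<close> places.
\<close>

section \<open>The tensor module\<close>

text \<open>Since \<open>capelli_proj\<close> is a definite description, no bitableau has a
  computable value until uniqueness is known; this is why faithfulness comes before any computation
  with virtual symbols. It is proved without an ordered basis: functionals of degree
  \<open>D\<close> see a word of length \<open>D\<close> only through its multiset of generators,
  and two words with the same multiset differ by a combination of shorter words. The module is used
  through its transpose on functions of words: a left factor then acts on the function first, so the
  condition "for all \<open>f\<close>" makes an annihilator a left ideal at once. On the symmetric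
  group side everything about characters is reduced to coefficients of Young symmetrizers, through a
  formula for the trace on a left ideal generated by an idempotent. Completeness of the characters
  comes from counting: there are as many independent conjugation sums as partitions, and at most as
  many conjugacy classes. The labels are transposed, so the bound on \<open>first_part \<mu>\<close>
  limits the number of rows of the diagram that carries the Young symmetrizer.\<close>

definition lin_ext :: "('m \<Rightarrow> complex) \<Rightarrow> ('m::monoid_add \<Rightarrow>\<^sub>0 complex) \<Rightarrow> complex" where
  "lin_ext \<phi> x = (\<Sum>w\<in>Poly_Mapping.keys x. Poly_Mapping.lookup x w * \<phi> w)"

lemma lin_ext_superset:
  assumes "finite A" "Poly_Mapping.keys x \<subseteq> A"
  shows "lin_ext \<phi> x = (\<Sum>w\<in>A. Poly_Mapping.lookup x w * \<phi> w)"
  unfolding lin_ext_def using assms by (intro sum.mono_neutral_left) (auto simp: in_keys_iff)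

lemma lin_ext_add: "lin_ext \<phi> (x + y) = lin_ext \<phi> x + lin_ext \<phi> y"
proof -
  let ?A = "Poly_Mapping.keys x \<union> Poly_Mapping.keys y"
  have "lin_ext \<phi> z = (\<Sum>w\<in>?A. Poly_Mapping.lookup z w * \<phi> w)" if "z \<in> {x, y, x + y}" for z
    using that keys_add[of x y] by (intro lin_ext_superset) auto
  then show ?thesis by (simp add: lookup_add sum.distrib distrib_right)
qed

lemma lin_ext_zero [simp]: "lin_ext \<phi> 0 = 0"
  by (simp add: lin_ext_def)

lemma lin_ext_single [simp]: "lin_ext \<phi> (Poly_Mapping.single w c) = c * \<phi> w"
  by (simp add: lin_ext_def)

lemma lin_ext_uminus: "lin_ext \<phi> (- x) = - lin_ext \<phi> x"
  using lin_ext_add[of \<phi> x "- x"] by (simp add: add_eq_0_iff)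

lemma lin_ext_diff: "lin_ext \<phi> (x - y) = lin_ext \<phi> x - lin_ext \<phi> y"
  using lin_ext_add[of \<phi> x "- y"] by (simp add: lin_ext_uminus)

lemma lin_ext_sum: "lin_ext \<phi> (sum g A) = (\<Sum>a\<in>A. lin_ext \<phi> (g a))"
  by (induction A rule: infinite_finite_induct) (simp_all add: lin_ext_add)

lemma lin_ext_mult:
  "lin_ext \<phi> (x * y) = lin_ext (\<lambda>w. lin_ext (\<lambda>v. \<phi> (v + w)) x) y"
proof -
  let ?s = "\<lambda>z w. Poly_Mapping.single w (Poly_Mapping.lookup z w)"
  have "x * y = (\<Sum>v\<in>Poly_Mapping.keys x. \<Sum>w\<in>Poly_Mapping.keys y. ?s x v * ?s y w)"
    by (subst malg_sum_singles[of x], subst malg_sum_singles[of y]) (simp add: sum_product)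
  then have "lin_ext \<phi> (x * y) = (\<Sum>v\<in>Poly_Mapping.keys x. \<Sum>w\<in>Poly_Mapping.keys y.
       Poly_Mapping.lookup x v * Poly_Mapping.lookup y w * \<phi> (v + w))"
    by (simp add: lin_ext_sum mult_single)
  also have "\<dots> = (\<Sum>w\<in>Poly_Mapping.keys y. \<Sum>v\<in>Poly_Mapping.keys x.
       Poly_Mapping.lookup x v * Poly_Mapping.lookup y w * \<phi> (v + w))"
    by (rule sum.swap)
  also have "\<dots> = lin_ext (\<lambda>w. lin_ext (\<lambda>v. \<phi> (v + w)) x) y"
    unfolding lin_ext_def by (simp add: sum_distrib_left mult_ac)
  finally show ?thesis .
qed

lemma lin_ext_fun_scale: "lin_ext (\<lambda>w. c * \<phi> w) x = c * lin_ext \<phi> x"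
  by (simp add: lin_ext_def sum_distrib_left mult_ac)

text \<open>The transpose of the action of \<open>e\<^bsub>a,b\<^esub>\<close> on the tensor algebra, on functions of basis words.
  Transposition reverses products, so words of generators act from left to right.\<close>

fun tensor_act :: "'a::super_alphabet \<Rightarrow> 'a \<Rightarrow> ('a list \<Rightarrow> complex) \<Rightarrow> 'a list \<Rightarrow> complex" where
  "tensor_act a b f [] = 0"
| "tensor_act a b f (x # xs) = (if x = b then f (a # xs) else 0) +
     (-1) ^ ((parity a + parity b) * parity x) * tensor_act a b (\<lambda>ys. f (x # ys)) xs"

lemma tensor_act_add: "tensor_act a b (\<lambda>l. f l + g l) = (\<lambda>l. tensor_act a b f l + tensor_act a b g l)"
proof
  show "tensor_act a b (\<lambda>l. f l + g l) l = tensor_act a b f l + tensor_act a b g l" for l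
    by (induction l arbitrary: f g) (simp_all add: distrib_left)
qed

lemma tensor_act_scale: "tensor_act a b (\<lambda>l. c * f l) = (\<lambda>l. c * tensor_act a b f l)"
proof
  show "tensor_act a b (\<lambda>l. c * f l) l = c * tensor_act a b f l" for l
    by (induction l arbitrary: f) (simp_all add: distrib_left mult_ac)
qed

lemma tensor_act_zero: "tensor_act a b (\<lambda>l. 0) = (\<lambda>l. 0)"
  using tensor_act_scale[of a b 0 "\<lambda>l. 0"] by simp

text \<open>Words act from left to right, so \<open>tensor_act c d (tensor_act a b f)\<close> is the
  action of e_{a,b} e_{c,d}; hence the crossed order of the arguments. Induction on the word: terms
  with both operators at the head give the head part of the bracket, those with both in the tail are
  the induction hypothesis, and the mixed terms cancel by their signs.\<close>

lemma tensor_act_supercommutator: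
  fixes a b c d :: "'a::super_alphabet"
  shows "tensor_act c d (tensor_act a b f) l - (super_sign a b c d) * tensor_act a b (tensor_act c d f) l
    = (if b = c then tensor_act a d f l else 0) - super_sign a b c d * (if a = d then tensor_act c b f l else 0)"
proof (induction l arbitrary: f)
  case (Cons x xs)
  define S where "S = (super_sign a b c d :: complex)"
  define sab where "sab = (\<lambda>y::'a. (-1::complex) ^ ((parity a + parity b) * parity y))"
  define scd where "scd = (\<lambda>y::'a. (-1::complex) ^ ((parity c + parity d) * parity y))"
  have step: "tensor_act e g (\<lambda>ys. (if q then h ys else 0) + s * k ys) xs =
     (if q then tensor_act e g h xs else 0) + s * tensor_act e g k xs" for e g q h s k
    by (simp add: tensor_act_add tensor_act_scale tensor_act_zero)
  define ff where "ff = (\<lambda>ys. f (x # ys))"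
  have IH: "tensor_act c d (tensor_act a b ff) xs = S * tensor_act a b (tensor_act c d ff) xs +
    (if b = c then tensor_act a d ff xs else 0) - S * (if a = d then tensor_act c b ff xs else 0)"
    using Cons.IH[of ff] unfolding S_def by (simp add: algebra_simps)
  \<comment> \<open>\<open>S\<close> is the sign of exchanging e_{a,b} and e_{c,d}. Facts 1 and 2
    align the mixed terms, in which one operator meets the head and the other the tail; 4 and 5 say
    that a generator occurring in the bracket carries the product of both signs.\<close>
  have 1: "sab c = S * sab d"
    by (auto simp: sab_def scd_def S_def super_sign_def uminus_power_if)
  have 2: "S * scd a = scd b"
    by (auto simp: sab_def scd_def S_def super_sign_def uminus_power_if)
  have 4: "b = c \<Longrightarrow> (-1::complex) ^ ((parity a + parity d) * parity y) = sab y * scd y" for y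
    by (auto simp: sab_def scd_def S_def super_sign_def uminus_power_if)
  have 5: "a = d \<Longrightarrow> (-1::complex) ^ ((parity c + parity b) * parity y) = sab y * scd y" for y
    by (auto simp: sab_def scd_def S_def super_sign_def uminus_power_if)
  have sab_eq: "(-1) ^ ((parity a + parity b) * parity y) = sab y"
    and scd_eq: "(-1) ^ ((parity c + parity d) * parity y) = scd y" for y
    by (simp_all add: sab_def scd_def)
  define U where "U = tensor_act a b (\<lambda>ys. f (c # ys)) xs"
  define W where "W = tensor_act c d (\<lambda>ys. f (a # ys)) xs"
  define Y where "Y = tensor_act a b (tensor_act c d ff) xs"
  have 6: "S * sab x * (if x = d then U else 0) = (if x = d then sab c * U else 0)"
    by (simp add: 1)
  have L: "tensor_act c d (tensor_act a b f) (x # xs) =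
     (if x = d \<and> b = c then f (a # xs) else 0) + S * sab x * (if x = d then U else 0)
     + scd x * (if x = b then W else 0) + sab x * scd x * (S * Y +
        (if b = c then tensor_act a d ff xs else 0) - S * (if a = d then tensor_act c b ff xs else 0))"
    unfolding IH[folded Y_def, symmetric] 6
    by (simp add: sab_eq scd_eq step U_def W_def ff_def) (auto simp: distrib_left)
  have "S * scd a * (if x = b then W else 0) = scd x * (if x = b then W else 0)"
    by (simp add: 2)
  moreover have "tensor_act a b (tensor_act c d f) (x # xs) =
     (if x = b \<and> a = d then f (c # xs) else 0) + scd a * (if x = b then W else 0)
     + sab x * (if x = d then U else 0) + sab x * scd x * Y"
    by (simp add: sab_eq scd_eq step U_def W_def Y_def ff_def) (auto simp: distrib_left)
  ultimately have R: "S * tensor_act a b (tensor_act c d f) (x # xs) =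
     S * (if x = b \<and> a = d then f (c # xs) else 0) + scd x * (if x = b then W else 0)
     + S * sab x * (if x = d then U else 0) + sab x * scd x * (S * Y)"
    by (simp add: distrib_left mult_ac)
  have A: "tensor_act a d f (x # xs) = (if x = d then f (a # xs) else 0) + sab x * scd x * tensor_act a d ff xs"
    if "b = c" using 4[OF that] by (simp add: ff_def)
  have B: "tensor_act c b f (x # xs) = (if x = b then f (c # xs) else 0) + sab x * scd x * tensor_act c b ff xs"
    if "a = d" using 5[OF that] by (simp add: ff_def)
  have A': "(if b = c then tensor_act a d f (x # xs) else 0) = (if x = d \<and> b = c then f (a # xs) else 0) +
      sab x * scd x * (if b = c then tensor_act a d ff xs else 0)"
    using A by (cases "b = c") (simp_all del: tensor_act.simps)
  have B': "(if a = d then tensor_act c b f (x # xs) else 0) = (if x = b \<and> a = d then f (c # xs) else 0) +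
      sab x * scd x * (if a = d then tensor_act c b ff xs else 0)"
    using B by (cases "a = d") (simp_all del: tensor_act.simps)
  show ?case
    unfolding S_def[symmetric] L R A' B' by (simp only: algebra_simps)
qed simp

fun unword :: "'a word \<Rightarrow> 'a list" where "unword (Word w) = w"

lemma unword_add [simp]: "unword (v + w) = unword v @ unword w"
  by (cases v; cases w) simp

definition word_act :: "('a::super_alphabet \<times> 'a) list \<Rightarrow> ('a list \<Rightarrow> complex) \<Rightarrow> 'a list \<Rightarrow> complex" where
  "word_act w f = fold (\<lambda>(a, b). tensor_act a b) w f"

lemma word_act_simps [simp]:
  "word_act [] f = f"
  "word_act ((a, b) # w) f = word_act w (tensor_act a b f)"
  "word_act (v @ w) f = word_act w (word_act v f)"
  by (simp_all add: word_act_def)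

lemma word_act_zero: "word_act w (\<lambda>l. 0) = (\<lambda>l. 0)"
  by (induction w) (auto simp: tensor_act_zero)

lemma word_act_add: "word_act w (\<lambda>l. f l + g l) = (\<lambda>l. word_act w f l + word_act w g l)"
  by (induction w arbitrary: f g) (auto simp: tensor_act_add)

lemma word_act_scale: "word_act w (\<lambda>l. c * f l) = (\<lambda>l. c * word_act w f l)"
  by (induction w arbitrary: f) (auto simp: tensor_act_scale)

lemma word_act_sum: "word_act w (\<lambda>l. \<Sum>i\<in>I. f i l) l = (\<Sum>i\<in>I. word_act w (f i) l)"
  by (induction I rule: infinite_finite_induct) (simp_all add: word_act_zero word_act_add)

definition alg_act :: "'a::super_alphabet free_alg \<Rightarrow> ('a list \<Rightarrow> complex) \<Rightarrow> 'a list \<Rightarrow> complex" where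
  "alg_act x f l = lin_ext (\<lambda>w. word_act (unword w) f l) x"

lemma alg_act_mult: "alg_act (x * y) f = alg_act y (alg_act x f)"
proof
  fix l
  have "alg_act (x * y) f l = lin_ext (\<lambda>w. lin_ext (\<lambda>v. word_act (unword w) (word_act (unword v) f) l) x) y"
    by (simp add: alg_act_def lin_ext_mult)
  also have "(\<lambda>w. lin_ext (\<lambda>v. word_act (unword w) (word_act (unword v) f) l) x) =
     (\<lambda>w. word_act (unword w) (alg_act x f) l)"
    unfolding alg_act_def lin_ext_def by (simp add: word_act_sum word_act_scale)
  finally show "alg_act (x * y) f l = alg_act y (alg_act x f) l" by (simp add: alg_act_def)
qed

lemma alg_act_zero_fun: "alg_act x (\<lambda>l. 0) = (\<lambda>l. 0)"
  by (rule ext) (simp add: alg_act_def word_act_zero lin_ext_def)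

lemma alg_act_gen: "alg_act (free_gen a b) f = tensor_act a b f"
  by (rule ext) (simp add: alg_act_def free_gen_def)

lemma alg_act_relator: "alg_act (uea_relator a b c d) f l = 0"
proof -
  have lin: "alg_act (x - y) f l = alg_act x f l - alg_act y f l"
            "alg_act (-x) f l = - alg_act x f l" "alg_act 0 f l = 0" for x y and f :: "'a list \<Rightarrow> complex" and l
    by (simp_all add: alg_act_def lin_ext_diff lin_ext_uminus)
  have sgn: "alg_act (super_sign a b c d * x) f l = super_sign a b c d * alg_act x f l" for x l
    and f :: "'a list \<Rightarrow> complex"
    by (cases "even ((parity a + parity b) * (parity c + parity d))")
      (simp_all only: super_sign_def neg_one_even_power neg_one_odd_power
        simp_thms lin mult_minus1 mult_1_left)
  show ?thesis
    unfolding uea_relator_def superbracket_def lin sgn unfolding alg_act_mult alg_act_gen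
    using tensor_act_supercommutator[of c d a b f l]
    by (simp add: alg_act_gen lin if_distrib[of "\<lambda>x. alg_act x f l"])
qed

lemma alg_act_uea_ideal:
  assumes "x \<in> uea_ideal" shows "alg_act x f l = 0"
proof -
  \<comment> \<open>Quantifying over all \<open>f\<close> makes the annihilator two-sided: a left
    factor only changes \<open>f\<close>, a right factor acts on the zero function.\<close>
  have "uea_ideal \<subseteq> {x :: 'a free_alg. \<forall>f. alg_act x f = (\<lambda>l. 0)}"
    unfolding uea_ideal_def
  proof (rule hull_minimal)
    show "two_sided_ideal {x :: 'a free_alg. \<forall>f. alg_act x f = (\<lambda>l. 0)}"
      by (auto simp: two_sided_ideal_def left_ideal_def alg_act_mult alg_act_zero_fun)
        (auto simp: alg_act_def lin_ext_add fun_eq_iff)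
  qed (auto simp: alg_act_relator fun_eq_iff)
  then show ?thesis using assms by (auto simp: fun_eq_iff)
qed

lemma unword_zero [simp]: "unword 0 = []"
  by (simp add: zero_word_def)

lift_definition uea_act :: "'a::super_alphabet uea \<Rightarrow> ('a list \<Rightarrow> complex) \<Rightarrow> 'a list \<Rightarrow> complex"
  is alg_act
proof (intro ext)
  fix x y :: "'a free_alg" and f l
  assume "uea_eq x y"
  then have "alg_act (x - y) f l = 0" by (simp add: uea_eq_def alg_act_uea_ideal)
  then show "alg_act x f l = alg_act y f l" by (simp add: alg_act_def lin_ext_diff)
qed

lemma uea_act_mult: "uea_act (x * y) f = uea_act y (uea_act x f)"
  by transfer (rule alg_act_mult)

lemma uea_act_zero: "uea_act 0 f l = 0"
  by transfer (simp add: alg_act_def)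

lemma uea_act_one: "uea_act 1 f l = f l"
  by transfer (simp add: alg_act_def zero_word_def flip: single_one)

lemma uea_act_add: "uea_act (x + y) f l = uea_act x f l + uea_act y f l"
  by transfer (simp add: alg_act_def lin_ext_add)

lemma uea_act_scale: "uea_act (uea_scale c x) f l = c * uea_act x f l"
proof (transfer, unfold alg_act_def)
  fix c f l and x :: "'a free_alg"
  show "lin_ext (\<lambda>w. word_act (unword w) f l) (malg_scale c x) = c * lin_ext (\<lambda>w. word_act (unword w) f l) x"
    by (simp add: malg_scale_def lin_ext_mult lin_ext_fun_scale)
qed

lemma uea_act_sum: "uea_act (sum g A) f l = (\<Sum>a\<in>A. uea_act (g a) f l)"
  by (induction A rule: infinite_finite_induct) (simp_all add: uea_act_zero uea_act_add)

lemma uea_act_gen: "uea_act (uea_gen a b) f = tensor_act a b f"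
  by transfer (rule alg_act_gen)

definition gen_word :: "('a::super_alphabet \<times> 'a) list \<Rightarrow> 'a uea" where
  "gen_word w = prod_list (map (case_prod uea_gen) w)"

lemma gen_word_simps [simp]:
  "gen_word [] = 1" "gen_word (g # w) = uea_gen (fst g) (snd g) * gen_word w"
  "gen_word (v @ w) = gen_word v * gen_word w"
  by (simp_all add: gen_word_def split: prod.split)

lemma uea_act_gen_word: "uea_act (gen_word w) f = word_act w f"
  by (induction w arbitrary: f) (auto simp: uea_act_one uea_act_mult uea_act_gen)

section \<open>Irregular products annihilate tensors of proper symbols\<close>

lemma tensor_act_eq_0:
  assumes "\<And>ys zs. l = ys @ b # zs \<Longrightarrow> f (ys @ a # zs) = 0"
  shows "tensor_act a b f l = 0"
  using assms
proof (induction l arbitrary: f)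
  case (Cons x xs)
  have "tensor_act a b (\<lambda>ys. f (x # ys)) xs = 0"
  proof (rule Cons.IH)
    fix ys zs assume "xs = ys @ b # zs"
    then show "f (x # ys @ a # zs) = 0" using Cons.prems[of "x # ys" zs] by simp
  qed
  then show ?case using Cons.prems[of "[]"] by simp
qed simp

text \<open>On the tensor \<open>l\<close> the pairs act in the order of \<open>p\<close>, each
  e_{c,d} consuming one letter \<open>d\<close> and producing one \<open>c\<close>. If \<gamma> is
  to be consumed more often than it is available, some step has nothing to act on. The symbol
  \<open>a\<close> produced by the last pair comes too late to count.\<close>

lemma word_act_eq_0:
  assumes "count_list (map snd (p @ [(a, b)])) \<gamma> > count_list (map fst p) \<gamma> + count_list l \<gamma>"
  shows "word_act (rev (p @ [(a, b)])) f l = 0"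
  using assms
proof (induction p arbitrary: l)
  case Nil
  then have "b = \<gamma>" "count_list l b = 0" by (auto split: if_splits)
  then have "b \<notin> set l" by (simp add: count_list_0_iff)
  then show ?case by (auto intro!: tensor_act_eq_0)
next
  case (Cons g p)
  obtain c d where g: "g = (c, d)" by (cases g)
  have "tensor_act c d (word_act (rev (p @ [(a, b)])) f) l = 0"
  proof (rule tensor_act_eq_0)
    fix ys zs assume l: "l = ys @ d # zs"
    show "word_act (rev (p @ [(a, b)])) f (ys @ c # zs) = 0"
      by (rule Cons.IH) (use Cons.prems in \<open>auto simp: l g split: if_splits\<close>)
  qed
  then show ?case by (simp add: g)
qed

lemma count_list_map_upt: "count_list (map f [m..<n]) y = card {j. m \<le> j \<and> j < n \<and> f j = y}"
proof -
  have "count_list (map f [m..<n]) y = length (filter (\<lambda>j. f j = y) [m..<n])"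
    by (simp add: count_list_eq_length_filter filter_map o_def eq_commute)
  also have "\<dots> = card (set (filter (\<lambda>j. f j = y) [m..<n]))"
    by (metis distinct_card distinct_filter distinct_upt)
  also have "set (filter (\<lambda>j. f j = y) [m..<n]) = {j. m \<le> j \<and> j < n \<and> f j = y}" by auto
  finally show ?thesis .
qed

lemma gen_product_eq: "gen_product m a b = gen_word (rev (map (\<lambda>j. (a j, b j)) [1..<Suc m]))"
  by (simp add: gen_product_def gen_word_def rev_map o_def)

text \<open>Only the \<open>i\<close> rightmost factors reach the tensor up to the violation; the
  factors further left merely change \<open>f\<close>. A word in \<open>range Letter\<close>
  supplies no virtual symbol of its own.\<close>

lemma irregular_act:
  assumes "irregular m a b" "set l \<subseteq> range Letter"
  shows "uea_act (gen_product m a b) f l = 0"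
proof -
  from assms(1) obtain i \<gamma> where i: "i \<in> {1..m}" "\<gamma> \<in> range Alpha \<union> range Beta"
    "card {j. 1 \<le> j \<and> j \<le> i \<and> b j = \<gamma>} > card {j. 1 \<le> j \<and> j < i \<and> a j = \<gamma>}"
    unfolding irregular_def by blast
  define p where "p = map (\<lambda>j. (a j, b j)) [1..<i]"
  define q where "q = map (\<lambda>j. (a j, b j)) [Suc i..<Suc m]"
  have "[1..<Suc m] = [1..<i] @ i # [Suc i..<Suc m]"
    using i(1) upt_add_eq_append[of 1 i "Suc m - i"] upt_conv_Cons[of i "Suc m"] by simp
  then have eq: "map (\<lambda>j. (a j, b j)) [1..<Suc m] = (p @ [(a i, b i)]) @ q"
    by (simp add: p_def q_def)
  have "\<gamma> \<notin> set l" using i(2) assms(2) by auto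
  then have l: "count_list l \<gamma> = 0" by simp
  have "map snd (p @ [(a i, b i)]) = map b [1..<Suc i]" "map fst p = map a [1..<i]"
    using i(1) by (simp_all add: p_def o_def)
  then have "count_list (map snd (p @ [(a i, b i)])) \<gamma> > count_list (map fst p) \<gamma> + count_list l \<gamma>"
    using i(3) by (simp only: count_list_map_upt l less_Suc_eq_le)
  from word_act_eq_0[OF this] show ?thesis
    by (simp only: gen_product_eq eq rev_append[of "p @ _" q] uea_act_gen_word word_act_simps)
qed

lemma Irr_act:
  assumes "x \<in> Irr" "set l \<subseteq> range Letter"
  shows "uea_act x f l = 0"
proof -
  have "Irr \<subseteq> {x :: ('a, 'b, 'c) symbol uea. \<forall>f l. set l \<subseteq> range Letter \<longrightarrow> uea_act x f l = 0}"
    unfolding Irr_def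
    by (rule hull_minimal) (auto simp: irregular_act left_ideal_def uea_act_zero uea_act_add uea_act_mult)
  then show ?thesis using assms by blast
qed

lemma lin_ext_malg_map: "lin_ext \<phi> (malg_map g x) = lin_ext (\<lambda>w. \<phi> (g w)) x"
  by (simp add: malg_map_def lin_ext_sum lin_ext_def[of "\<lambda>w. \<phi> (g w)"])

lemma tensor_act_Letter:
  "tensor_act (Letter a) (Letter b) f (map Letter l) = tensor_act a b (\<lambda>l. f (map Letter l)) l"
  by (induction l arbitrary: f) (simp_all add: parity_proper_def parity_symbol_def)

lemma word_act_Letter:
  "word_act (map (map_prod Letter Letter) w) f (map Letter l) = word_act w (\<lambda>l. f (map Letter l)) l"
  by (induction w arbitrary: f) (auto simp: tensor_act_Letter)

lemma uea_act_embed: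
  "uea_act (uea_embed u) f (map Letter l) = uea_act u (\<lambda>l. f (map Letter l)) l"
proof transfer
  fix x :: "'n proper free_alg" and f :: "('m0, 'm1, 'n) symbol list \<Rightarrow> complex" and l
  have "word_act (unword (letter_word w)) f (map Letter l) =
      word_act (unword w) (\<lambda>l. f (map Letter l)) l" for w
    by (cases w) (simp add: word_act_Letter)
  then show "alg_act (malg_map letter_word x) f (map Letter l) = alg_act x (\<lambda>l. f (map Letter l)) l"
    by (simp add: alg_act_def lin_ext_malg_map)
qed

text \<open>Every function on proper words extends to all words through \<open>inv Letter\<close>,
  so the vanishing of \<open>Irr\<close> on words of letters is felt by all functions on proper
  words. With faithfulness this becomes U(gl(n)) \<inter> Irr = 0.\<close>

lemma uea_embed_in_Irr_act:
  assumes "uea_embed u \<in> (Irr :: ('m0, 'm1, 'n) symbol uea set)"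
  shows "uea_act u f l = 0"
proof -
  define f' where "f' = (\<lambda>l :: ('m0, 'm1, 'n) symbol list. f (map (inv Letter) l))"
  have "inv Letter (Letter x :: ('m0, 'm1, 'n) symbol) = x" for x
    by (simp add: inv_f_f inj_def)
  then have f: "f = (\<lambda>l. f' (map Letter l))" by (simp add: f'_def o_def)
  show ?thesis
    by (subst f, subst uea_act_embed[symmetric], rule Irr_act[OF assms]) auto
qed

section \<open>Coproduct and functionals that detect leading terms\<close>

fun splits :: "'x list \<Rightarrow> ('x list \<times> 'x list) list" where
  "splits [] = [([], [])]"
| "splits (g # w) = map (\<lambda>(u, v). (g # u, v)) (splits w) @ map (\<lambda>(u, v). (u, g # v)) (splits w)"

lemma length_splits: "(u, v) \<in> set (splits w) \<Longrightarrow> length u + length v = length w"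
  by (induction w arbitrary: u v) auto

lemma sum_list_splits_Nil:
  "(\<Sum>(u, v)\<leftarrow>splits w. if u = [] then h v else 0) = (h w :: complex)"
proof (induction w arbitrary: h)
  case (Cons x w)
  show ?case using Cons.IH[of "\<lambda>v. h (x # v)"] by (simp add: o_def split_def cong: if_cong)
qed simp

text \<open>A single generator \<open>g\<close> can be split off once for each of its occurrences in
  \<open>w\<close>, and the remaining word has the same multiset every time.\<close>

lemma sum_list_splits_single:
  assumes "\<And>v. h v = (if mset v = M then c else 0)"
  shows "(\<Sum>(u, v)\<leftarrow>splits w. if u = [g] then h v else 0) =
    (if mset w = add_mset g M then c * of_nat (count (mset w) g) else (0 :: complex))"
  using assms
proof (induction w arbitrary: h M c)
  case (Cons x w)
  have "(\<Sum>(u, v)\<leftarrow>splits w. if x # u = [g] then h v else 0) = (if x = g then h w else 0)"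
    using sum_list_splits_Nil[of h w] by (auto simp: split_def)
  moreover have "(\<Sum>(u, v)\<leftarrow>splits w. if u = [g] then h (x # v) else 0) =
    (if mset (x # w) = add_mset g M \<and> x \<in># M then c * of_nat (count (mset w) g) else 0)"
  proof (cases "x \<in># M")
    case True
    then obtain M' where M: "M = add_mset x M'" by (meson mset_add)
    have "h (x # v) = (if mset v = M' then c else 0)" for v
      by (simp add: Cons.prems M)
    from Cons.IH[OF this] show ?thesis by (simp add: M add_mset_commute)
  next
    case False
    then have "h (x # v) = 0" for v using Cons.prems[of "x # v"] by auto
    then show ?thesis using False by (simp add: split_def cong: if_cong)
  qed
  ultimately have *: "(\<Sum>(u, v)\<leftarrow>splits (x # w). if u = [g] then h v else 0) = (if x = g then h w else 0) +
     (if mset (x # w) = add_mset g M \<and> x \<in># M then c * of_nat (count (mset w) g) else 0)"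
    by (simp add: o_def split_def cong: if_cong)
  show ?case
  proof (cases "mset (x # w) = add_mset g M")
    case eq: True
    show ?thesis
    proof (cases "x = g")
      case True
      with eq have "mset w = M" by simp
      then show ?thesis unfolding * using True eq
        by (cases "g \<in># M") (simp_all add: Cons.prems distrib_left count_eq_zero_iff)
    next
      case False
      then have "x \<in># M" using eq by (metis add_mset_remove_trivial_eq insert_noteq_member insert_DiffM2 set_mset_add_mset_insert insertE union_single_eq_member mset.simps(2) count_mset_gt_0 list.set_intros(1) set_mset_mset)
      moreover have "count (mset (x # w)) g = count (mset w) g" using False by simp
      ultimately show ?thesis unfolding * using False eq by (simp only: if_True simp_thms if_False) simp
    qed
  next
    case False
    then show ?thesis unfolding * by (auto simp: Cons.prems)
  qed
qed simp

text \<open>The matrix coefficient of the natural module: the coefficient of \<open>i\<close> in the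
  word \<open>w\<close> applied to \<open>j\<close>.\<close>

definition site :: "('a::super_alphabet \<times> 'a) list \<Rightarrow> 'a \<Rightarrow> 'a \<Rightarrow> complex" where
  "site w i j = word_act w (\<lambda>l. if l = [i] then 1 else 0) [j]"

text \<open>The functional reading off the coefficient of the product of the generators in \<open>v\<close>: the
  iterated coproduct distributes a word over the places of \<open>v\<close>, no place being left empty.\<close>

fun word_coeff :: "('a::super_alphabet \<times> 'a) list \<Rightarrow> ('a \<times> 'a) list \<Rightarrow> complex" where
  "word_coeff [] w = (if w = [] then 1 else 0)"
| "word_coeff ((i, j) # v) w =
     (\<Sum>(s, t)\<leftarrow>splits w. if s = [] then 0 else site s i j * word_coeff v t)"

text \<open>The span of the matrix coefficients of all tensor powers, as functions on words. An
  element acting by zero is killed by each of them, so faithfulness follows once suitable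
  functionals are shown to lie in this set.\<close>

inductive_set act_coeffs :: "(('a::super_alphabet \<times> 'a) list \<Rightarrow> complex) set" where
  act: "(\<lambda>w. word_act w f l) \<in> act_coeffs"
| add: "\<phi> \<in> act_coeffs \<Longrightarrow> \<psi> \<in> act_coeffs \<Longrightarrow> (\<lambda>w. \<phi> w + \<psi> w) \<in> act_coeffs"
| scale: "\<phi> \<in> act_coeffs \<Longrightarrow> (\<lambda>w. c * \<phi> w) \<in> act_coeffs"

fun tens :: "('a list \<Rightarrow> complex) \<Rightarrow> ('a list \<Rightarrow> complex) \<Rightarrow> 'a list \<Rightarrow> complex" where
  "tens f g [] = 0"
| "tens f g (x # xs) = f [x] * g xs"

text \<open>Proper symbols all have parity 1, so e_{a,b} is even and the Leibniz rule has no sign.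
  In \<open>tens\<close> the first factor sees exactly one place.\<close>

lemma tensor_act_tens:
  fixes a b :: "'n proper"
  shows "tensor_act a b (tens f g) = (\<lambda>l. tens (tensor_act a b f) g l + tens f (tensor_act a b g) l)"
proof
  show "tensor_act a b (tens f g) l = tens (tensor_act a b f) g l + tens f (tensor_act a b g) l" for l
    by (cases l) (simp_all add: parity_proper_def tensor_act_scale)
qed

text \<open>Generators are primitive, so the sum over \<open>splits w\<close> is the coproduct of
  the product of the generators in \<open>w\<close>; \<open>splits\<close> is a list in order to
  keep multiplicities.\<close>

lemma word_act_tens:
  fixes w :: "('n proper \<times> 'n proper) list"
  shows "word_act w (tens f g) (x # xs) = (\<Sum>(s, t)\<leftarrow>splits w. word_act s f [x] * word_act t g xs)"
  by (induction w arbitrary: f g) (auto simp: tensor_act_tens word_act_add o_def split_def)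

text \<open>The sum over all splits is a matrix coefficient with one more tensor place. The unwanted
  term with empty \<open>s\<close> is a multiple of the given functional, since
  \<open>site [] i j\<close> is a constant, and is subtracted.\<close>

lemma act_coeffs_site:
  fixes \<phi> :: "('n proper \<times> 'n proper) list \<Rightarrow> complex"
  assumes "\<phi> \<in> act_coeffs"
  shows "(\<lambda>w. \<Sum>(s, t)\<leftarrow>splits w. if s = [] then 0 else site s i j * \<phi> t) \<in> act_coeffs"
  using assms
proof induction
  case (act f l)
  let ?d = "\<lambda>l. if l = [i] then 1 else 0 :: complex"
  have "(\<Sum>(s, t)\<leftarrow>splits w. if s = [] then 0 else site s i j * word_act t f l) =
    word_act w (tens ?d f) (j # l) + (if i = j then -1 else 0) * word_act w f l" for w
  proof -
    have "(\<Sum>(s, t)\<leftarrow>splits w. if s = [] then 0 else site s i j * word_act t f l) +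
       (\<Sum>(s, t)\<leftarrow>splits w. if s = [] then (if i = j then 1 else 0) * word_act t f l else 0) =
       (\<Sum>(s, t)\<leftarrow>splits w. site s i j * word_act t f l)"
      unfolding sum_list_addf[symmetric]
      by (intro arg_cong[where f=sum_list] map_cong) (auto simp: site_def)
    then show ?thesis
      unfolding word_act_tens sum_list_splits_Nil site_def[symmetric]
      by (simp only: eq_diff_eq[symmetric]) simp
  qed
  then show ?case by (simp only:) (intro act_coeffs.intros)
next
  case (add \<phi> \<psi>)
  have "(\<Sum>(s, t)\<leftarrow>splits w. if s = [] then 0 else site s i j * (\<phi> t + \<psi> t)) =
    (\<Sum>(s, t)\<leftarrow>splits w. if s = [] then 0 else site s i j * \<phi> t) +
    (\<Sum>(s, t)\<leftarrow>splits w. if s = [] then 0 else site s i j * \<psi> t)" for w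
    unfolding sum_list_addf[symmetric]
    by (intro arg_cong[where f=sum_list] map_cong) (auto simp: distrib_left)
  then show ?case using add.IH by (simp only:) (rule act_coeffs.intros)
next
  case (scale \<phi> c)
  have "(\<Sum>(s, t)\<leftarrow>splits w. if s = [] then 0 else site s i j * (c * \<phi> t)) =
    c * (\<Sum>(s, t)\<leftarrow>splits w. if s = [] then 0 else site s i j * \<phi> t)" for w
    unfolding sum_list_const_mult[symmetric]
    by (intro arg_cong[where f=sum_list] map_cong) (auto simp: mult_ac)
  then show ?case using scale.IH by (simp only:) (rule act_coeffs.intros)
qed

lemma word_coeff_act_coeffs: "word_coeff v \<in> (act_coeffs :: (('n proper \<times> 'n proper) list \<Rightarrow> complex) set)"
proof (induction v)
  case Nil
  \<comment> \<open>In tensor degree 0 every nonempty word acts by zero.\<close>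
  have "word_act w (\<lambda>l. if l = [] then 1 else 0) [] = word_coeff [] w" for w :: "('n proper \<times> 'n proper) list"
  proof (cases w)
    case (Cons g w')
    have z: "word_act u (\<lambda>l. f l) [] = 0" if "f [] = 0" for u and f :: "'n proper list \<Rightarrow> complex"
      using that by (induction u arbitrary: f) auto
    show ?thesis using z by (cases g) (auto simp: Cons)
  qed simp
  then have "word_coeff [] = (\<lambda>w :: ('n proper \<times> 'n proper) list. word_act w (\<lambda>l. if l = [] then 1 else 0) [])"
    by (simp only:)
  then show ?case by (simp only: act_coeffs.act)
next
  case (Cons g v)
  obtain i j where "g = (i, j)" by (cases g)
  then show ?case using act_coeffs_site[OF Cons.IH, of i j] by simp
qed

lemma sum_act_coeffs_eq_0:
  assumes "\<phi> \<in> act_coeffs" "\<And>f l. uea_act (\<Sum>w\<in>S. uea_scale (c w) (gen_word w)) f l = 0"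
  shows "(\<Sum>w\<in>S. c w * \<phi> w) = 0"
  using assms(1)
proof induction
  case (act f l)
  show ?case using assms(2)[of f l] by (simp add: uea_act_sum uea_act_scale uea_act_gen_word)
next
  case (add \<phi> \<psi>)
  then show ?case by (simp add: distrib_left sum.distrib)
next
  case (scale \<phi> d)
  have "(\<Sum>w\<in>S. c w * (d * \<phi> w)) = d * (\<Sum>w\<in>S. c w * \<phi> w)" by (simp add: sum_distrib_left mult_ac)
  then show ?case using scale by simp
qed

text \<open>The product of the factorials of the multiplicities, i.e. the number of ways to match
  \<open>v\<close> with a rearrangement of itself.\<close>

fun word_mult :: "'x list \<Rightarrow> nat" where
  "word_mult [] = 1"
| "word_mult (g # v) = word_mult v * count (mset (g # v)) g"

lemma word_mult_pos: "word_mult v > 0"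
  by (induction v) auto

lemma site_single: "site [(a, b)] i j = (if (a, b) = (i, j) then 1 else 0)"
  by (auto simp: site_def)

text \<open>Every place of \<open>v\<close> needs at least one generator, so a word no longer than
  \<open>v\<close> must put exactly one on each place, and \<open>site_single\<close> forces a
  matching. Shorter words are thus invisible, and words of equal length are seen only up to
  order.\<close>

lemma word_coeff_eq:
  assumes "length w \<le> length v"
  shows "word_coeff v w = (if mset w = mset v then of_nat (word_mult v) else 0)"
  using assms
proof (induction v arbitrary: w)
  case (Cons g v)
  obtain i j where g: "g = (i, j)" by (cases g)
  define h where "h = (\<lambda>t. if mset t = mset v then of_nat (word_mult v) else 0 :: complex)"
  have "word_coeff (g # v) w = (\<Sum>(s, t)\<leftarrow>splits w. if s = [g] then h t else 0)"
    unfolding g word_coeff.simps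
  proof (intro arg_cong[where f=sum_list] map_cong refl, clarify)
    fix s t assume "(s, t) \<in> set (splits w)"
    then have len: "length s + length t \<le> Suc (length v)" using length_splits[of s t w] Cons.prems by simp
    show "(if s = [] then 0 else site s i j * word_coeff v t) = (if s = [(i, j)] then h t else 0)"
    proof (cases s)
      case (Cons x s')
      then have "word_coeff v t = h t" using Cons.IH[of t] len by (simp add: h_def)
      \<comment> \<open>A place that takes two generators leaves too few for the others.\<close>
      moreover have "h t = 0" if "s' \<noteq> []"
      proof -
        have "length t < length v" using that len Cons by (cases s') auto
        then have "mset t \<noteq> mset v" using mset_eq_length by force
        then show ?thesis by (simp add: h_def)
      qed
      ultimately show ?thesis using Cons by (cases x; cases s') (auto simp: site_single)
    qed simp
  qed
  also have "\<dots> = (if mset w = mset (g # v) then of_nat (word_mult v) * of_nat (count (mset w) g) else 0)"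
    by (subst sum_list_splits_single[where M="mset v" and c="of_nat (word_mult v)"]) (auto simp: h_def)
  finally show ?case by (simp add: distrib_left)
qed auto

section \<open>Reordering generators modulo shorter words\<close>

lemma gen_word_swap:
  "gen_word (x # g # r) - gen_word (g # x # r) \<in> uea.span {gen_word v :: 'n proper uea | v. length v < length (x # g # r)}"
proof -
  obtain a b c d where xg: "x = (a, b)" "g = (c, d)" by (cases x; cases g)
  have "uea_gen a b * uea_gen c d - uea_gen c d * uea_gen a b =
      (if b = c then uea_gen a d else 0) - (if a = d then uea_gen c b else 0)"
    using uea_gen_supercommutator[of a b c d] by (simp add: super_sign_def parity_proper_def)
  then have "gen_word (x # g # r) - gen_word (g # x # r) =
      ((if b = c then uea_gen a d else 0) - (if a = d then uea_gen c b else 0)) * gen_word r"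
    by (simp add: xg mult.assoc[symmetric] left_diff_distrib[symmetric])
  also have "\<dots> = (if b = c then gen_word ((a, d) # r) else 0) - (if a = d then gen_word ((c, b) # r) else 0)"
    by (simp add: left_diff_distrib)
  also have "\<dots> \<in> uea.span {gen_word v | v. length v < length (x # g # r)}"
  proof -
    have "gen_word (y # r) \<in> uea.span {gen_word v | v. length v < length (x # g # r)}" for y
      by (rule uea.span_base) (metis (mono_tags, lifting) length_Cons lessI mem_Collect_eq)
    then show ?thesis by (auto simp del: gen_word_simps intro!: uea.span_diff uea.span_zero uea.span_neg)
  qed
  finally show ?thesis .
qed

lemma uea_mult_scale:
  "uea_scale c x * y = uea_scale c (x * y)" "x * uea_scale c y = uea_scale c (x * y)"
proof -
  show "uea_scale c x * y = uea_scale c (x * y)"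
    by transfer (simp add: malg_scale_def mult.assoc uea_eq_def uea_ideal_zero)
  show "x * uea_scale c y = uea_scale c (x * y)"
  proof transfer
    fix x y :: "'a free_alg" and c
    have "x * malg_scale c y = malg_scale c (x * y)"
      unfolding malg_scale_def by (simp add: mult.assoc[symmetric] single_zero_commute[of c x])
    then show "uea_eq (x * malg_scale c y) (malg_scale c (x * y))"
      by (simp add: uea_eq_def uea_ideal_zero)
  qed
qed

lemma uea_span_mult_left:
  assumes "x \<in> uea.span S" "\<And>s. s \<in> S \<Longrightarrow> r * s \<in> uea.span T"
  shows "r * x \<in> uea.span T"
  using assms(1)
  by (induction rule: uea.span_induct_alt)
    (auto simp: distrib_left uea_mult_scale intro!: uea.span_zero uea.span_add uea.span_scale assms(2))

lemma uea_span_mult_right: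
  assumes "x \<in> uea.span S" "\<And>s. s \<in> S \<Longrightarrow> s * r \<in> uea.span T"
  shows "x * r \<in> uea.span T"
  using assms(1)
  by (induction rule: uea.span_induct_alt)
    (auto simp: distrib_right uea_mult_scale intro!: uea.span_zero uea.span_add uea.span_scale assms(2))

lemma gen_mult_span_shorter:
  assumes "x \<in> uea.span {gen_word v :: 'n proper uea | v. length v < m}"
  shows "uea_gen a b * x \<in> uea.span {gen_word v | v. length v < Suc m}"
  using assms
proof (rule uea_span_mult_left)
  fix s :: "'n proper uea" assume "s \<in> {gen_word v | v. length v < m}"
  then obtain v where "s = gen_word v" "length v < m" by blast
  then have "uea_gen a b * s = gen_word ((a, b) # v)" "length ((a, b) # v) < Suc m" by simp_all
  then show "uea_gen a b * s \<in> uea.span {gen_word v | v. length v < Suc m}"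
    by (intro uea.span_base) blast
qed

lemma gen_word_move:
  "gen_word (p @ g # q) - gen_word (g # p @ q) \<in>
     uea.span {gen_word v :: 'n proper uea | v. length v < length (g # p @ q)}"
proof (induction p)
  case (Cons x p)
  have "gen_word ((x # p) @ g # q) - gen_word (g # (x # p) @ q) =
     uea_gen (fst x) (snd x) * (gen_word (p @ g # q) - gen_word (g # p @ q)) +
      (gen_word (x # g # p @ q) - gen_word (g # x # p @ q))"
    by (simp add: algebra_simps)
  also have "\<dots> \<in> uea.span {gen_word v | v. length v < length (g # (x # p) @ q)}"
    using gen_mult_span_shorter[OF Cons.IH, of "fst x" "snd x"] gen_word_swap[of x g "p @ q"]
    by (intro uea.span_add) simp_all
  finally show ?case .
qed (simp add: uea.span_zero)

text \<open>Generators commute up to shorter words, since their bracket has degree one. The head of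
  \<open>w\<close> is brought to the front of \<open>w'\<close>, and the tails are treated by
  induction.\<close>

lemma gen_word_mset_cong:
  assumes "mset w = mset w'"
  shows "gen_word w - gen_word w' \<in> uea.span {gen_word v :: 'n proper uea | v. length v < length w}"
  using assms
proof (induction w arbitrary: w')
  case (Cons g w)
  then have "g \<in> set w'" by (metis list.set_intros(1) mset_eq_setD)
  then obtain p q where w': "w' = p @ g # q" by (meson split_list)
  then have m: "mset w = mset (p @ q)" using Cons.prems by simp
  then have len: "length w = length (p @ q)" by (rule mset_eq_length)
  have "gen_word (g # w) - gen_word w' = uea_gen (fst g) (snd g) * (gen_word w - gen_word (p @ q)) -
     (gen_word (p @ g # q) - gen_word (g # p @ q))"
    by (simp add: w' algebra_simps)
  also have "\<dots> \<in> uea.span {gen_word v | v. length v < length (g # w)}"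
  proof (rule uea.span_diff)
    show "uea_gen (fst g) (snd g) * (gen_word w - gen_word (p @ q)) \<in> uea.span {gen_word v | v. length v < length (g # w)}"
      using gen_mult_span_shorter[OF Cons.IH[OF m], of "fst g" "snd g"] by simp
    show "gen_word (p @ g # q) - gen_word (g # p @ q) \<in> uea.span {gen_word v | v. length v < length (g # w)}"
      using gen_word_move[of p g q] len by simp
  qed
  finally show ?case .
qed (simp add: uea.span_zero)

lemma abs_uea_single: "abs_uea (Poly_Mapping.single (Word w) c) = uea_scale c (gen_word w)"
proof -
  have 1: "abs_uea (Poly_Mapping.single (Word w) 1) = gen_word w"
  proof (induction w)
    case (Cons g w)
    have "Poly_Mapping.single (Word (g # w)) (1 :: complex) = free_gen (fst g) (snd g) * Poly_Mapping.single (Word w) 1"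
      by (simp add: free_gen_def mult_single)
    then have "abs_uea (Poly_Mapping.single (Word (g # w)) 1) = uea_gen (fst g) (snd g) * abs_uea (Poly_Mapping.single (Word w) 1)"
      by (simp only: uea_gen.abs_eq times_uea.abs_eq)
    then show ?case by (simp add: Cons.IH)
  qed (simp add: one_uea.abs_eq[symmetric] zero_word_def[symmetric])
  show ?thesis unfolding 1[symmetric] uea_scale.abs_eq by (simp add: malg_scale_def mult_single)
qed

lemma uea_span_gen_words: "(u :: 'a::super_alphabet uea) \<in> uea.span (range gen_word)"
proof (induct u rule: uea.abs_induct)
  case (1 x)
  have "abs_uea (sum f A) = (\<Sum>a\<in>A. abs_uea (f a))" for f :: "('a \<times> 'a) word \<Rightarrow> 'a free_alg" and A
    by (induction A rule: infinite_finite_induct) (simp_all add: zero_uea_def plus_uea.abs_eq[symmetric])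
  then have "abs_uea x = (\<Sum>w\<in>Poly_Mapping.keys x. abs_uea (Poly_Mapping.single w (Poly_Mapping.lookup x w)))"
    by (subst malg_sum_singles[of x]) simp
  moreover have "abs_uea (Poly_Mapping.single w c) \<in> uea.span (range gen_word)" for w :: "('a \<times> 'a) word" and c
    by (cases w) (simp add: abs_uea_single uea.span_scale uea.span_base)
  ultimately show ?case by (simp add: uea.span_sum)
qed

text \<open>Descent on the length bound. For each multiset the functionals of degree
  \<open>D\<close> show that the coefficients of its words of top length \<open>D\<close> sum to
  zero. After replacing these words by one representative the top part cancels, and what remains is
  a combination of words shorter than \<open>D\<close>.\<close>

lemma uea_act_faithful_shorter:
  fixes u :: "'n proper uea"
  assumes "u \<in> uea.span {gen_word w | w. length w < D}" "\<And>f l. uea_act u f l = 0"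
  shows "u = 0"
  using assms
proof (induction D arbitrary: u)
  case (Suc D)
  let ?F = "uea.span {gen_word w :: 'n proper uea | w. length w < D}"
  have "{gen_word w :: 'n proper uea | w. length w < Suc D} = gen_word ` {w. length w < Suc D}" by blast
  with Suc.prems(1) have "u \<in> uea.span (gen_word ` {w. length w < Suc D})" by simp
  then obtain T r where T: "finite T" "T \<subseteq> gen_word ` {w. length w < Suc D}" "u = (\<Sum>a\<in>T. uea_scale (r a) a)"
    unfolding uea.span_explicit by blast
  from T(2) obtain S where S: "S \<subseteq> {w. length w < Suc D}" "inj_on gen_word S" "T = gen_word ` S"
    by (meson subset_image_inj)
  define c where "c = (\<lambda>w :: ('n proper \<times> 'n proper) list. r (gen_word w))"
  have finS: "finite S" using T(1) S(2,3) finite_imageD by blast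
  have u: "u = (\<Sum>w\<in>S. uea_scale (c w) (gen_word w))"
    unfolding T(3) S(3) c_def by (subst sum.reindex[OF S(2)]) simp
  have coeff: "(\<Sum>w\<in>{w\<in>S. mset w = mset v}. c w) = 0" if "length v = D" for v
  proof -
    have "(\<Sum>w\<in>S. c w * word_coeff v w) = 0"
      using sum_act_coeffs_eq_0[OF word_coeff_act_coeffs, of c S v] Suc.prems(2) u by simp
    also have "(\<Sum>w\<in>S. c w * word_coeff v w) = (\<Sum>w\<in>S. if mset w = mset v then c w * of_nat (word_mult v) else 0)"
      using S(1) that by (intro sum.cong refl) (auto simp: word_coeff_eq)
    also have "\<dots> = (\<Sum>w\<in>{w\<in>S. mset w = mset v}. c w) * of_nat (word_mult v)"
      by (simp add: sum.inter_filter[OF finS, symmetric] sum_distrib_right)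
    finally show ?thesis using word_mult_pos[of v] by simp
  qed
  \<comment> \<open>Any choice of one ordering per multiset will do; no order on the generators is
    involved.\<close>
  define rep where "rep = (\<lambda>M :: ('n proper \<times> 'n proper) multiset. SOME v. mset v = M)"
  have rep: "mset (rep M) = M" for M
    unfolding rep_def by (rule someI_ex) (rule ex_mset)
  let ?S = "{w\<in>S. length w = D}"
  have "(\<Sum>w\<in>?S. uea_scale (c w) (gen_word (rep (mset w)))) =
     (\<Sum>M\<in>mset ` ?S. \<Sum>w\<in>{w\<in>?S. mset w = M}. uea_scale (c w) (gen_word (rep (mset w))))"
    by (rule sum.image_gen) (use finS in simp)
  also have "\<dots> = (\<Sum>M\<in>mset ` ?S. 0)"
  proof (intro sum.cong refl)
    fix M assume "M \<in> mset ` ?S"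
    then obtain v where v: "v \<in> ?S" "M = mset v" by blast
    have "{w\<in>?S. mset w = M} = {w\<in>S. mset w = mset v}"
      using v by (auto dest: mset_eq_length)
    then have "(\<Sum>w\<in>{w\<in>?S. mset w = M}. uea_scale (c w) (gen_word (rep (mset w)))) =
      uea_scale (\<Sum>w\<in>{w\<in>S. mset w = mset v}. c w) (gen_word (rep M))"
      by (simp add: uea.scale_sum_left v(2))
    then show "(\<Sum>w\<in>{w\<in>?S. mset w = M}. uea_scale (c w) (gen_word (rep (mset w)))) = 0"
      using coeff[of v] v by simp
  qed
  finally have 0: "(\<Sum>w\<in>?S. uea_scale (c w) (gen_word (rep (mset w)))) = 0" by simp
  have "u = (\<Sum>w\<in>S - ?S. uea_scale (c w) (gen_word w)) + (\<Sum>w\<in>?S. uea_scale (c w) (gen_word w))"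
    unfolding u by (rule sum.subset_diff) (use finS in auto)
  also have "\<dots> = (\<Sum>w\<in>S - ?S. uea_scale (c w) (gen_word w)) +
     (\<Sum>w\<in>?S. uea_scale (c w) (gen_word w - gen_word (rep (mset w))))"
    using 0 by (simp add: uea.scale_right_diff_distrib sum_subtractf)
  also have "\<dots> \<in> ?F"
  proof (intro uea.span_add uea.span_sum uea.span_scale)
    fix w assume "w \<in> S - ?S"
    then have "length w < D" using S(1) by auto
    then show "gen_word w \<in> ?F" by (intro uea.span_base) blast
  next
    fix w assume "w \<in> ?S"
    then show "gen_word w - gen_word (rep (mset w)) \<in> ?F"
      using gen_word_mset_cong[of w "rep (mset w)"] by (simp add: rep)
  qed
  finally show ?case using Suc.IH Suc.prems(2) by blast
qed simp

lemma uea_act_faithful: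
  fixes u :: "'n proper uea"
  assumes "\<And>f l. uea_act u f l = 0"
  shows "u = 0"
proof -
  obtain T r where T: "finite T" "T \<subseteq> range gen_word" "u = (\<Sum>a\<in>T. uea_scale (r a) a)"
    using uea_span_gen_words[of u] unfolding uea.span_explicit by blast
  from T(1,2) obtain S where S: "finite S" "T = gen_word ` S"
    by (meson finite_subset_image subset_UNIV)
  have "u \<in> uea.span {gen_word w | w. length w < Suc (Max (length ` S))}"
    unfolding T(3)
  proof (intro uea.span_sum uea.span_scale uea.span_base)
    fix a assume "a \<in> T"
    then obtain w where w: "w \<in> S" "a = gen_word w" using S by blast
    then have "length w \<le> Max (length ` S)" using S(1) by simp
    then show "a \<in> {gen_word w | w. length w < Suc (Max (length ` S))}"
      using w le_imp_less_Suc by blast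
  qed
  then show ?thesis using assms by (rule uea_act_faithful_shorter)
qed

text \<open>Two candidates for the projection differ by an element whose embedding lies in
  \<open>Irr\<close>, so the difference acts by zero on all tensors and vanishes. From here on a
  projection is evaluated by exhibiting a congruence modulo \<open>Irr\<close>.\<close>

lemma capelli_proj_eqI:
  assumes "x - uea_embed u \<in> Irr"
  shows "capelli_proj x = u"
  unfolding capelli_proj_def
proof (rule the_equality[where P="\<lambda>u. x - uea_embed u \<in> Irr", OF assms])
  fix v assume v: "x - uea_embed v \<in> Irr"
  have I: "left_ideal (Irr :: ('a, 'b, 'c) symbol uea set)" unfolding Irr_def by (rule left_ideal_hull)
  have "- 1 * (x - uea_embed u) \<in> Irr" using I assms unfolding left_ideal_def by blast
  then have "(x - uea_embed v) + - 1 * (x - uea_embed u) \<in> Irr"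
    using I v unfolding left_ideal_def by blast
  also have "(x - uea_embed v) + - 1 * (x - uea_embed u) = uea_embed u - uea_embed v"
    by simp
  finally have 1: "uea_embed u - uea_embed v \<in> (Irr :: ('a, 'b, 'c) symbol uea set)" .
  have "uea_embed (u - v) + uea_embed v = (uea_embed u :: ('a, 'b, 'c) symbol uea)"
    by (simp flip: uea_embed_add)
  then have "uea_embed (u - v) = uea_embed u - (uea_embed v :: ('a, 'b, 'c) symbol uea)"
    by (simp add: eq_diff_eq)
  with 1 have "uea_embed (u - v) \<in> (Irr :: ('a, 'b, 'c) symbol uea set)" by (simp only:)
  from uea_act_faithful[OF uea_embed_in_Irr_act[OF this]] show "v = u" by simp
qed

section \<open>Column bitableaux as elements of the enveloping algebra of gl(n)\<close>

lemma Irr_left_ideal: "left_ideal Irr"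
  unfolding Irr_def by (rule left_ideal_hull)

lemma Irr_zero: "0 \<in> Irr"
  and Irr_add: "x \<in> Irr \<Longrightarrow> y \<in> Irr \<Longrightarrow> x + y \<in> Irr"
  and Irr_mult_left: "x \<in> Irr \<Longrightarrow> r * x \<in> Irr"
  using Irr_left_ideal unfolding left_ideal_def by blast+

lemma Irr_uminus: "x \<in> Irr \<Longrightarrow> - x \<in> Irr"
  using Irr_mult_left[of x "- 1"] by simp

lemma Irr_diff: "x \<in> Irr \<Longrightarrow> y \<in> Irr \<Longrightarrow> x - y \<in> Irr"
  using Irr_add[of x "- y"] Irr_uminus[of y] by simp

lemma Irr_sum: "(\<And>t. t \<in> T \<Longrightarrow> f t \<in> Irr) \<Longrightarrow> sum f T \<in> Irr"
  by (induction T rule: infinite_finite_induct) (simp_all add: Irr_zero Irr_add)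

text \<open>The rightmost factor acts first and consumes the virtual symbol \<gamma> before anything
  has produced it.\<close>

lemma gen_Alpha_in_Irr:
  assumes "\<gamma> \<in> range Alpha"
  shows "x * uea_gen a \<gamma> \<in> Irr"
proof -
  have "irregular 1 (\<lambda>_. a) (\<lambda>_. \<gamma>)"
  proof -
    have "{t. 1 \<le> t \<and> t \<le> (1::nat) \<and> \<gamma> = \<gamma>} = {1}" "{t. 1 \<le> t \<and> t < (1::nat) \<and> a = \<gamma>} = {}" by auto
    then show ?thesis
      unfolding irregular_def using assms by (intro bexI[of _ 1] bexI[of _ \<gamma>]) simp_all
  qed
  then have "gen_product 1 (\<lambda>_. a) (\<lambda>_. \<gamma>) \<in> Irr"
    unfolding Irr_def by (intro hull_inc) blast
  then show ?thesis by (simp add: gen_product_eq Irr_mult_left)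
qed

text \<open>A proper generator on the right shifts all positions by one and neither produces nor
  consumes virtual symbols, so an irregularity survives. This lets a congruence modulo
  \<open>Irr\<close> be multiplied on the right by the generator that the recursion adds.\<close>

lemma Irr_mult_Letter:
  fixes x :: "('m0, 'm1, 'n) symbol uea"
  assumes "x \<in> Irr"
  shows "x * uea_gen (Letter i) (Letter j) \<in> Irr"
proof -
  have "left_ideal hull {gen_product m a b |m a b. irregular m a b} \<subseteq> {x :: ('m0, 'm1, 'n) symbol uea. x * uea_gen (Letter i) (Letter j) \<in> Irr}"
  proof (rule hull_minimal)
    show "left_ideal {x :: ('m0, 'm1, 'n) symbol uea. x * uea_gen (Letter i) (Letter j) \<in> Irr}"
      by (auto simp: left_ideal_def Irr_zero distrib_right mult.assoc intro: Irr_add Irr_mult_left)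
    show "{gen_product m a b |m a b. irregular m a b} \<subseteq> {x :: ('m0, 'm1, 'n) symbol uea. x * uea_gen (Letter i) (Letter j) \<in> Irr}"
    proof clarify
      fix m and a b :: "nat \<Rightarrow> ('m0, 'm1, 'n) symbol"
      assume irr: "irregular m a b"
      \<comment> \<open>Position 1 is the rightmost factor of \<open>gen_product\<close>.\<close>
      define a' where "a' = (\<lambda>t. if t = 1 then Letter i else a (t - 1))"
      define b' where "b' = (\<lambda>t. if t = 1 then Letter j else b (t - 1))"
      have upt: "[1..<Suc (Suc n)] = 1 # map Suc [1..<Suc n]" for n
        by (simp add: map_Suc_upt upt_conv_Cons del: upt_Suc)
      have ab: "map (\<lambda>j. (a' j, b' j)) [1..<Suc (Suc n)] = (Letter i, Letter j) # map (\<lambda>j. (a j, b j)) [1..<Suc n]"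
         "map a' [1..<Suc (Suc n)] = Letter i # map a [1..<Suc n]"
         "map b' [1..<Suc (Suc n)] = Letter j # map b [1..<Suc n]" for n
        unfolding upt by (simp_all add: a'_def b'_def o_def del: upt_Suc)
      have "gen_product m a b * uea_gen (Letter i) (Letter j) = gen_product (Suc m) a' b'"
        unfolding gen_product_eq ab by simp
      moreover have "irregular (Suc m) a' b'"
      proof -
        from irr obtain t \<gamma> where t: "t \<in> {1..m}" "\<gamma> \<in> range Alpha \<union> range Beta"
          "card {j. 1 \<le> j \<and> j \<le> t \<and> b j = \<gamma>} > card {j. 1 \<le> j \<and> j < t \<and> a j = \<gamma>}"
          unfolding irregular_def by blast
        obtain s where s: "t = Suc s" using t(1) by (cases t) auto
        have "count_list (map b' [1..<Suc (Suc t)]) \<gamma> > count_list (map a' [1..<Suc t]) \<gamma>"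
        proof -
          have "count_list (map b [1..<Suc t]) \<gamma> > count_list (map a [1..<t]) \<gamma>"
            using t(3) by (simp only: count_list_map_upt less_Suc_eq_le)
          then show ?thesis
            using t(2) unfolding s ab by (auto simp del: upt_Suc)
        qed
        then show ?thesis using t(1,2) unfolding irregular_def count_list_map_upt less_Suc_eq_le[of _ "Suc t"]
          by (intro bexI[of _ "Suc t"] bexI[of _ \<gamma>]) auto
      qed
      ultimately show "gen_product m a b * uea_gen (Letter i) (Letter j) \<in> Irr"
        unfolding Irr_def by (intro hull_inc) auto
    qed
  qed
  then show ?thesis using assms unfolding Irr_def[symmetric] by blast
qed

section \<open>Moving an annihilating factor through creating factors\<close>

definition creation :: "(nat \<Rightarrow> ('m0, 'm1, 'n) symbol) \<Rightarrow> (nat \<Rightarrow> 'n) \<Rightarrow> nat list \<Rightarrow> ('m0, 'm1, 'n) symbol uea" where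
  "creation \<alpha> j ts = prod_list (map (\<lambda>t. uea_gen (\<alpha> t) (Letter (Proper (j t)))) ts)"

lemma creation_simps [simp]:
  "creation \<alpha> j [] = 1"
  "creation \<alpha> j (t # ts) = uea_gen (\<alpha> t) (Letter (Proper (j t))) * creation \<alpha> j ts"
  by (simp_all add: creation_def)

lemma creation_upd: "t \<notin> set ts \<Longrightarrow> creation \<alpha> (j(t := l)) ts = creation \<alpha> j ts"
  unfolding creation_def by (intro arg_cong[where f=prod_list] map_cong) auto

lemma parity_symbol_simps [simp]: "parity (Alpha x) = 0" "parity (Letter i) = 1"
  by (simp_all add: parity_symbol_def)

text \<open>Both factors are odd, and their bracket vanishes because an \<open>Alpha\<close> is
  never a \<open>Letter\<close>.\<close>

lemma creation_anticommute:
  assumes "\<alpha> ` set ts \<subseteq> range Alpha" "\<beta> \<in> range Alpha"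
  shows "uea_gen \<beta> (Letter l) * creation \<alpha> j ts = (-1) ^ length ts * (creation \<alpha> j ts * uea_gen \<beta> (Letter l))"
  using assms(1)
proof (induction ts)
  case (Cons t ts)
  let ?F = "uea_gen (\<alpha> t) (Letter (Proper (j t)))" and ?Y = "uea_gen \<beta> (Letter l)"
  have "?Y * ?F = - (?F * ?Y)"
    using uea_gen_supercommutator[of \<beta> "Letter l" "\<alpha> t" "Letter (Proper (j t))"] Cons.prems assms(2)
    by (auto simp: super_sign_def eq_neg_iff_add_eq_0)
  then have "?Y * creation \<alpha> j (t # ts) = - (?F * (?Y * creation \<alpha> j ts))"
    by (simp add: mult.assoc[symmetric])
  also have "?Y * creation \<alpha> j ts = (-1) ^ length ts * (creation \<alpha> j ts * ?Y)"
    using Cons by simp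
  finally show ?case by (cases "even (length ts)") (simp_all add: mult.assoc)
qed simp

text \<open>The even generator e_{\<beta>,\<gamma>} passes the creating factors, none of which
  contains \<gamma>. Its bracket with the last factor gives e_{\<beta>,l}; the term in which it
  passes that factor too ends in e_{\<beta>,\<gamma>} on the right and lies in
  \<open>Irr\<close>.\<close>

lemma polarization_creation:
  assumes "\<alpha> ` set ts \<subseteq> range Alpha" "\<beta> \<in> range Alpha" "\<gamma> \<in> range Alpha" "\<gamma> \<notin> \<alpha> ` set ts"
  shows "uea_gen \<beta> \<gamma> * creation \<alpha> j ts * uea_gen \<gamma> (Letter l) - creation \<alpha> j ts * uea_gen \<beta> (Letter l) \<in> Irr"
  using assms(1,4)
proof (induction ts)
  case Nil
  have "uea_gen \<beta> \<gamma> * uea_gen \<gamma> (Letter l) - uea_gen \<beta> (Letter l) = uea_gen \<gamma> (Letter l) * uea_gen \<beta> \<gamma>"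
    using uea_gen_supercommutator[of \<beta> \<gamma> \<gamma> "Letter l"] assms(2,3)
    by (auto simp: super_sign_def algebra_simps)
  then show ?case using gen_Alpha_in_Irr[OF assms(3)] by simp
next
  case (Cons t ts)
  let ?F = "uea_gen (\<alpha> t) (Letter (Proper (j t)))"
  have "uea_gen \<beta> \<gamma> * ?F = ?F * uea_gen \<beta> \<gamma>"
    using uea_gen_supercommutator[of \<beta> \<gamma> "\<alpha> t" "Letter (Proper (j t))"] Cons.prems assms(2,3)
    by (auto simp: super_sign_def)
  then have "uea_gen \<beta> \<gamma> * creation \<alpha> j (t # ts) * uea_gen \<gamma> (Letter l) =
      ?F * (uea_gen \<beta> \<gamma> * creation \<alpha> j ts * uea_gen \<gamma> (Letter l))"
    by (simp add: mult.assoc[symmetric])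
  then have "uea_gen \<beta> \<gamma> * creation \<alpha> j (t # ts) * uea_gen \<gamma> (Letter l) - creation \<alpha> j (t # ts) * uea_gen \<beta> (Letter l) =
     ?F * (uea_gen \<beta> \<gamma> * creation \<alpha> j ts * uea_gen \<gamma> (Letter l) - creation \<alpha> j ts * uea_gen \<beta> (Letter l))"
    by (simp add: right_diff_distrib mult.assoc)
  then show ?case using Cons by (simp add: Irr_mult_left)
qed

text \<open>The odd e_{i,\<gamma>} changes sign at each creating factor. Its bracket with the factor
  of index \<open>t\<close> is nonzero only if \<open>j t = i\<close>; it then replaces the letter
  by \<gamma>, and the result polarizes the final e_{\<gamma>,l}, so that \<open>l\<close> takes the
  place of \<open>j t\<close>. Having passed everything, e_{i,\<gamma>} meets e_{\<gamma>,l} and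
  leaves the proper generator e_{i,l}.\<close>

lemma annihilation_creation:
  assumes "\<alpha> ` set ts \<subseteq> range Alpha" "\<gamma> \<in> range Alpha" "\<gamma> \<notin> \<alpha> ` set ts" "distinct ts"
  shows "uea_gen (Letter (Proper i)) \<gamma> * creation \<alpha> j ts * uea_gen \<gamma> (Letter (Proper l)) -
     (-1) ^ length ts * (creation \<alpha> j ts * uea_gen (Letter (Proper i)) (Letter (Proper l)) -
        (\<Sum>t\<in>{t\<in>set ts. j t = i}. creation \<alpha> (j(t := l)) ts)) \<in> Irr"
  using assms(1,3,4)
proof (induction ts)
  case Nil
  let ?X = "uea_gen (Letter (Proper i)) \<gamma>" and ?L = "uea_gen \<gamma> (Letter (Proper l))"
  have "?X * ?L - uea_gen (Letter (Proper i)) (Letter (Proper l)) =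
      (if i = l then uea_gen \<gamma> \<gamma> else 0) - ?L * ?X"
    using uea_gen_supercommutator[of "Letter (Proper i)" \<gamma> \<gamma> "Letter (Proper l)"] assms(2)
    by (auto simp: super_sign_def algebra_simps)
  also have "\<dots> \<in> Irr"
    using gen_Alpha_in_Irr[OF assms(2), of 1 \<gamma>] gen_Alpha_in_Irr[OF assms(2)]
    by (intro Irr_diff) (simp_all add: Irr_zero)
  finally show ?case by simp
next
  case (Cons t ts)
  let ?X = "uea_gen (Letter (Proper i)) \<gamma>" and ?L = "uea_gen \<gamma> (Letter (Proper l))"
  let ?F = "uea_gen (\<alpha> t) (Letter (Proper (j t)))" and ?e = "uea_gen (Letter (Proper i)) (Letter (Proper l))"
  let ?s = "(-1) ^ length ts"
  let ?S = "\<Sum>s\<in>{s\<in>set ts. j s = i}. creation \<alpha> (j(s := l)) ts"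
  have t: "t \<notin> set ts" "\<alpha> t \<in> range Alpha" "\<gamma> \<noteq> \<alpha> t" using Cons.prems by auto
  have IH: "?X * creation \<alpha> j ts * ?L - ?s * (creation \<alpha> j ts * ?e - ?S) \<in> Irr"
    by (rule Cons.IH) (use Cons.prems in auto)
  have "?X * ?F = - (?F * ?X) + (if j t = i then uea_gen (\<alpha> t) \<gamma> else 0)"
    using uea_gen_supercommutator[of "Letter (Proper i)" \<gamma> "\<alpha> t" "Letter (Proper (j t))"] t assms(2)
    by (auto simp: super_sign_def algebra_simps)
  then have 1: "?X * creation \<alpha> j (t # ts) * ?L = - (?F * (?X * creation \<alpha> j ts * ?L)) +
     (if j t = i then uea_gen (\<alpha> t) \<gamma> * creation \<alpha> j ts * ?L else 0)"
    by (simp add: mult.assoc[symmetric] distrib_right left_diff_distrib)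
  have "{s\<in>set (t # ts). j s = i} = (if j t = i then {t} else {}) \<union> {s\<in>set ts. j s = i}" by auto
  then have "(\<Sum>s\<in>{s\<in>set (t # ts). j s = i}. creation \<alpha> (j(s := l)) (t # ts)) =
      (\<Sum>s\<in>(if j t = i then {t} else {}). creation \<alpha> (j(s := l)) (t # ts)) +
      (\<Sum>s\<in>{s\<in>set ts. j s = i}. creation \<alpha> (j(s := l)) (t # ts))"
    by (simp only:) (rule sum.union_disjoint, use t in auto)
  also have "(\<Sum>s\<in>{s\<in>set ts. j s = i}. creation \<alpha> (j(s := l)) (t # ts)) = ?F * ?S"
    unfolding sum_distrib_left by (intro sum.cong refl) (use t in auto)
  also have "(\<Sum>s\<in>(if j t = i then {t} else {}). creation \<alpha> (j(s := l)) (t # ts)) =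
     (if j t = i then uea_gen (\<alpha> t) (Letter (Proper l)) * creation \<alpha> j ts else 0)"
    using t by (simp add: creation_upd)
  \<comment> \<open>The polarized factor appears at the right end; bringing it back to place
    \<open>t\<close> costs the same sign that e_{i,\<gamma>} would have collected on
    \<open>ts\<close>.\<close>
  also have "uea_gen (\<alpha> t) (Letter (Proper l)) * creation \<alpha> j ts = ?s * (creation \<alpha> j ts * uea_gen (\<alpha> t) (Letter (Proper l)))"
    by (rule creation_anticommute) (use Cons.prems t in auto)
  finally have 2: "(\<Sum>s\<in>{s\<in>set (t # ts). j s = i}. creation \<alpha> (j(s := l)) (t # ts)) =
     (if j t = i then ?s * (creation \<alpha> j ts * uea_gen (\<alpha> t) (Letter (Proper l))) else 0) + ?F * ?S" .
  have "uea_gen (\<alpha> t) \<gamma> * creation \<alpha> j ts * ?L - creation \<alpha> j ts * uea_gen (\<alpha> t) (Letter (Proper l)) \<in> Irr"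
    by (rule polarization_creation) (use Cons.prems t assms(2) in auto)
  then have 3: "(if j t = i then uea_gen (\<alpha> t) \<gamma> * creation \<alpha> j ts * ?L - creation \<alpha> j ts * uea_gen (\<alpha> t) (Letter (Proper l)) else 0) \<in> Irr"
    by (simp add: Irr_zero)
  have "?X * creation \<alpha> j (t # ts) * ?L - (-1) ^ length (t # ts) * (creation \<alpha> j (t # ts) * ?e -
        (\<Sum>s\<in>{s\<in>set (t # ts). j s = i}. creation \<alpha> (j(s := l)) (t # ts))) =
     - (?F * (?X * creation \<alpha> j ts * ?L - ?s * (creation \<alpha> j ts * ?e - ?S))) +
     (if j t = i then uea_gen (\<alpha> t) \<gamma> * creation \<alpha> j ts * ?L - creation \<alpha> j ts * uea_gen (\<alpha> t) (Letter (Proper l)) else 0)"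
    unfolding 1 2 by (cases "even (length ts)"; cases "j t = i") (simp_all add: algebra_simps)
  also have "\<dots> \<in> Irr" by (intro Irr_add Irr_uminus Irr_mult_left IH 3)
  finally show ?case .
qed

text \<open>The sign counts the \<open>k\<close> odd creating factors passed by the last
  annihilating factor; each correction term puts \<open>j (Suc k)\<close> in place of a
  \<open>j t\<close> that equals \<open>i (Suc k)\<close>. No virtual symbols occur, whence the
  independence of their choice.\<close>

fun column_bitableau_rec :: "nat \<Rightarrow> (nat \<Rightarrow> 'n) \<Rightarrow> (nat \<Rightarrow> 'n) \<Rightarrow> 'n proper uea" where
  "column_bitableau_rec 0 i j = 1"
| "column_bitableau_rec (Suc k) i j = (-1) ^ k *
     (column_bitableau_rec k i j * uea_gen (Proper (i (Suc k))) (Proper (j (Suc k))) -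
      (\<Sum>t\<in>{t\<in>{1..k}. j t = i (Suc k)}. column_bitableau_rec k i (j(t := j (Suc k)))))"

lemma uea_embed_zero: "uea_embed 0 = 0"
  using uea_embed_add[of 0 0] by simp

lemma uea_embed_uminus: "uea_embed (- x) = - uea_embed x"
  using uea_embed_add[of x "- x"] by (simp add: uea_embed_zero eq_neg_iff_add_eq_0 add.commute)

lemma uea_embed_diff: "uea_embed (x - y) = uea_embed x - uea_embed y"
  using uea_embed_add[of x "- y"] by (simp add: uea_embed_uminus)

lemma uea_embed_sum: "uea_embed (sum f T) = (\<Sum>t\<in>T. uea_embed (f t))"
  by (induction T rule: infinite_finite_induct) (simp_all add: uea_embed_add uea_embed_zero)

lemma uea_embed_sign: "uea_embed ((-1) ^ k) = (-1) ^ k"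
  by (cases "even k") (simp_all add: uea_embed_uminus uea_embed_one)

text \<open>Induction on the height, with \<open>j\<close> arbitrary because the correction terms
  change it. \<open>annihilation_creation\<close> treats the last annihilating factor; the induction
  hypothesis is then used under \<open>P\<close>, since \<open>Irr\<close> admits left factors, and
  under a proper generator on the right.\<close>

lemma column_bitableau_rec_cong_Irr:
  assumes "inj_on \<alpha> {1..k}" "\<alpha> ` {1..k} \<subseteq> range Alpha"
  shows "prod_list (map (\<lambda>t. uea_gen (Letter (Proper (i t))) (\<alpha> t)) [1..<Suc k]) * creation \<alpha> j [1..<Suc k] -
    uea_embed (column_bitableau_rec k i j) \<in> Irr"
  using assms
proof (induction k arbitrary: j)
  case (Suc k)
  let ?\<gamma> = "\<alpha> (Suc k)" and ?i = "i (Suc k)" and ?l = "j (Suc k)"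
  let ?X = "uea_gen (Letter (Proper ?i)) ?\<gamma>" and ?L = "uea_gen ?\<gamma> (Letter (Proper ?l))"
  let ?e = "uea_gen (Letter (Proper ?i)) (Letter (Proper ?l))" and ?ts = "[1..<Suc k]"
  let ?T = "{t\<in>{1..k}. j t = ?i}"
  define P where "P = prod_list (map (\<lambda>t. uea_gen (Letter (Proper (i t))) (\<alpha> t)) [1..<Suc k])"
  have IH: "P * creation \<alpha> j ?ts - uea_embed (column_bitableau_rec k i j) \<in> Irr" for j
    unfolding P_def using Suc.prems by (intro Suc.IH) (auto intro: inj_on_subset)
  have set: "set ?ts = {1..k}" by auto
  have 0: "?X * creation \<alpha> j ?ts * ?L - (-1) ^ k * (creation \<alpha> j ?ts * ?e - (\<Sum>t\<in>?T. creation \<alpha> (j(t := ?l)) ?ts)) \<in> Irr"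
  proof -
    have "\<alpha> ` set ?ts \<subseteq> range Alpha" "?\<gamma> \<in> range Alpha" "?\<gamma> \<notin> \<alpha> ` set ?ts"
      using Suc.prems inj_on_image_mem_iff[OF Suc.prems(1), of "Suc k" "{1..k}"] unfolding set by auto
    from annihilation_creation[OF this, of ?i j ?l] show ?thesis
      by (simp only: set distinct_upt simp_thms length_upt diff_Suc_1)
  qed
  have upt: "[1..<Suc (Suc k)] = ?ts @ [Suc k]" by simp
  have eq: "prod_list (map (\<lambda>t. uea_gen (Letter (Proper (i t))) (\<alpha> t)) [1..<Suc (Suc k)]) = P * ?X"
    "creation \<alpha> j [1..<Suc (Suc k)] = creation \<alpha> j ?ts * ?L"
    unfolding upt by (simp_all add: P_def creation_def del: upt_Suc)
  \<comment> \<open>A plain ring identity; the ring being noncommutative, \<open>s\<close> must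
    commute with \<open>P\<close>, as a sign does.\<close>
  have rearrange: "P * x * (c * l) - s * (a * e - b) = P * (x * c * l - s * (c * e - d)) + s * ((P * c - a) * e - (P * d - b))"
    if "P * s = s * P" for x c l s a e b d
  proof -
    have "P * (s * y) = s * (P * y)" for y
      unfolding mult.assoc[symmetric] that ..
    then show ?thesis
      by (simp only: right_diff_distrib left_diff_distrib mult.assoc) simp
  qed
  have comm: "P * (-1) ^ k = (-1) ^ k * P"
    by (cases "even k") simp_all
  have "P * ?X * (creation \<alpha> j ?ts * ?L) - uea_embed (column_bitableau_rec (Suc k) i j) =
    P * (?X * creation \<alpha> j ?ts * ?L - (-1) ^ k * (creation \<alpha> j ?ts * ?e - (\<Sum>t\<in>?T. creation \<alpha> (j(t := ?l)) ?ts))) +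
    (-1) ^ k * ((P * creation \<alpha> j ?ts - uea_embed (column_bitableau_rec k i j)) * ?e -
       (\<Sum>t\<in>?T. P * creation \<alpha> (j(t := ?l)) ?ts - uea_embed (column_bitableau_rec k i (j(t := ?l)))))"
    unfolding column_bitableau_rec.simps uea_embed_diff uea_embed_mult uea_embed_sign uea_embed_sum uea_embed_gen
      sum_subtractf sum_distrib_left[of P, symmetric]
    by (rule rearrange[OF comm])
  also have "\<dots> \<in> Irr"
    by (rule Irr_add[OF Irr_mult_left[OF 0]
          Irr_mult_left[OF Irr_diff[OF Irr_mult_Letter[OF IH] Irr_sum[OF IH]]]])
  finally show ?case unfolding eq .
qed (simp add: uea_embed_one Irr_zero)

lemma column_bitableau_eq:
  assumes "inj_on \<alpha> {1..k}" "\<alpha> ` {1..k} \<subseteq> range Alpha"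
  shows "column_bitableau \<alpha> k i j = column_bitableau_rec k i j"
  unfolding column_bitableau_def creation_def[symmetric]
  by (intro capelli_proj_eqI column_bitableau_rec_cong_Irr assms)

section \<open>The filtration and the span of column bitableaux\<close>

lemma uea_filtration_eq: "uea_filtration h = uea.span {gen_word w :: 'n proper uea | w. length w \<le> h}"
proof (rule antisym)
  have "prod_list xs \<in> uea.span {gen_word w :: 'n proper uea | w. length w \<le> length xs}"
    if "set xs \<subseteq> gl_subspace" for xs :: "'n proper uea list"
    using that
  proof (induction xs)
    case Nil
    have "gen_word [] \<in> {gen_word w :: 'n proper uea | w. length w \<le> length []}"
      by (intro CollectI exI[of _ "[]"]) simp
    from uea.span_base[OF this] show ?case by simp
  next
    case (Cons x xs)
    let ?F = "uea.span {gen_word w :: 'n proper uea | w. length w \<le> length (x # xs)}"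
    have x: "x \<in> uea.span {uea_gen i j | i j. True}" using Cons.prems by (simp add: gl_subspace_def)
    have "s * prod_list xs \<in> ?F" if sg: "s \<in> {uea_gen i j | i j. True}" for s :: "'n proper uea"
    proof -
      obtain i j where s: "s = uea_gen i j" using sg by blast
      have "prod_list xs \<in> uea.span {gen_word w :: 'n proper uea | w. length w \<le> length xs}"
        using Cons by simp
      then show ?thesis
      proof (rule uea_span_mult_left)
        fix r :: "'n proper uea" assume "r \<in> {gen_word w | w. length w \<le> length xs}"
        then obtain w where "r = gen_word w" "length w \<le> length xs" by blast
        then have "s * r = gen_word ((i, j) # w)" "length ((i, j) # w) \<le> length (x # xs)" by (simp_all add: s)
        then show "s * r \<in> ?F" by (intro uea.span_base) blast
      qed
    qed
    with x show ?case unfolding prod_list.Cons by (rule uea_span_mult_right)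
  qed
  moreover have "uea.span {gen_word w :: 'n proper uea | w. length w \<le> length xs} \<subseteq>
      uea.span {gen_word w | w. length w \<le> h}" if "length xs \<le> h" for xs :: "'n proper uea list"
    using that by (intro uea.span_mono) auto
  ultimately have "{prod_list xs | xs. length xs \<le> h \<and> set xs \<subseteq> gl_subspace} \<subseteq>
      uea.span {gen_word w :: 'n proper uea | w. length w \<le> h}"
    by blast
  then show "uea_filtration h \<subseteq> uea.span {gen_word w :: 'n proper uea | w. length w \<le> h}"
    unfolding uea_filtration_def by (rule uea.span_minimal) simp
  have "uea_gen i j \<in> gl_subspace" for i j :: "'n proper"
    unfolding gl_subspace_def by (rule uea.span_base) blast
  then have "gen_word w \<in> {prod_list xs | xs. length xs \<le> h \<and> set xs \<subseteq> gl_subspace}"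
    if "length w \<le> h" for w :: "('n proper \<times> 'n proper) list"
    using that unfolding gen_word_def
    by (intro CollectI exI[of _ "map (case_prod uea_gen) w"]) auto
  then have "{gen_word w :: 'n proper uea | w. length w \<le> h} \<subseteq> {prod_list xs | xs. length xs \<le> h \<and> set xs \<subseteq> gl_subspace}"
    by blast
  then show "uea.span {gen_word w :: 'n proper uea | w. length w \<le> h} \<subseteq> uea_filtration h"
    unfolding uea_filtration_def by (rule uea.span_mono)
qed

lemma sign_mult_uea: "(-1) ^ k * x = uea_scale ((-1) ^ k) x"
proof -
  have "uea_scale (-1) x = - x" by (simp add: uea.scale_minus_left)
  then show ?thesis by (cases "even k") (simp_all del: uea.scale_minus_left)
qed

lemma column_bitableau_rec_in_filtration:
  "column_bitableau_rec k i j \<in> uea_filtration k"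
  unfolding uea_filtration_eq
proof (induction k arbitrary: j)
  case 0
  have "gen_word [] \<in> {gen_word w :: 'a proper uea | w. length w \<le> 0}"
    by (intro CollectI exI[of _ "[]"]) simp
  from uea.span_base[OF this] show ?case by simp
next
  case (Suc k)
  let ?F = "uea.span {gen_word w :: 'a proper uea | w. length w \<le> Suc k}"
  have le: "uea.span {gen_word w :: 'a proper uea | w. length w \<le> k} \<subseteq> ?F"
    by (intro uea.span_mono) auto
  have "column_bitableau_rec k i j * uea_gen a b \<in> ?F" for a b j
    using Suc.IH
  proof (rule uea_span_mult_right)
    fix r :: "'a proper uea" assume "r \<in> {gen_word w | w. length w \<le> k}"
    then obtain w where "r = gen_word w" "length w \<le> k" by blast
    then have "r * uea_gen a b = gen_word (w @ [(a, b)])" "length (w @ [(a, b)]) \<le> Suc k" by simp_all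
    then show "r * uea_gen a b \<in> ?F" by (intro uea.span_base) blast
  qed
  then show ?case
    unfolding column_bitableau_rec.simps sign_mult_uea
    by (intro uea.span_scale uea.span_diff uea.span_sum subsetD[OF le Suc.IH])
qed

lemma column_bitableau_rec_cong:
  assumes "\<And>t. t \<in> {1..k} \<Longrightarrow> i t = i' t" "\<And>t. t \<in> {1..k} \<Longrightarrow> j t = j' t"
  shows "column_bitableau_rec k i j = column_bitableau_rec k i' j'"
  using assms
proof (induction k arbitrary: j j')
  case (Suc k)
  have 1: "column_bitableau_rec k i j = column_bitableau_rec k i' j'"
    using Suc.prems by (intro Suc.IH) auto
  have 2: "column_bitableau_rec k i (j(t := j (Suc k))) = column_bitableau_rec k i' (j'(t := j' (Suc k)))" for t
    using Suc.prems by (intro Suc.IH) auto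
  have 3: "{t\<in>{1..k}. j t = i (Suc k)} = {t\<in>{1..k}. j' t = i' (Suc k)}"
    using Suc.prems by auto
  have "i (Suc k) = i' (Suc k)" "j (Suc k) = j' (Suc k)"
    using Suc.prems by simp_all
  then show ?case unfolding column_bitableau_rec.simps 1 2 3 by (simp only:)
qed simp

lemma gen_word_in_span_column_bitableaux:
  "gen_word w \<in> uea.span {column_bitableau_rec k i j :: 'n proper uea | k i j. k \<le> length w}"
proof (induction w rule: rev_induct)
  case Nil
  have "column_bitableau_rec 0 undefined undefined \<in> {column_bitableau_rec k i j :: 'n proper uea | k i j. k \<le> length []}"
    by (intro CollectI exI[of _ 0] exI[of _ undefined]) simp
  from uea.span_base[OF this] show ?case by simp
next
  case (snoc g w)
  let ?F = "uea.span {column_bitableau_rec k i j :: 'n proper uea | k i j. k \<le> length (w @ [g])}"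
  obtain a b where g: "g = (Proper a, Proper b)" by (metis prod.exhaust proper.exhaust)
  have "gen_word w * uea_gen (Proper a) (Proper b) \<in> ?F"
    using snoc
  proof (rule uea_span_mult_right)
    fix s :: "'n proper uea"
    assume "s \<in> {column_bitableau_rec k i j | k i j. k \<le> length w}"
    then obtain k i j where s: "s = column_bitableau_rec k i j" "k \<le> length w" by blast
    \<comment> \<open>Only the values on \<open>{1..k}\<close> matter for \<open>s\<close>, so the
      entries at \<open>Suc k\<close> are free to hold the letters of the new generator.\<close>
    define i' where "i' = i(Suc k := a)"
    define j' where "j' = j(Suc k := b)"
    have s': "s = column_bitableau_rec k i' j'"
      unfolding s(1) by (rule column_bitableau_rec_cong) (simp_all add: i'_def j'_def)
    have base: "column_bitableau_rec m a b \<in> ?F" if "m \<le> Suc k" for m a b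
    proof -
      have "m \<le> length (w @ [g])" using that s(2) by simp
      then show ?thesis by (intro uea.span_base) blast
    qed
    have "s * uea_gen (Proper a) (Proper b) = uea_scale ((-1) ^ k) (column_bitableau_rec (Suc k) i' j') +
       (\<Sum>t\<in>{t\<in>{1..k}. j' t = i' (Suc k)}. column_bitableau_rec k i' (j'(t := j' (Suc k))))"
    proof -
      have "uea_scale ((-1) ^ k) ((-1) ^ k * x) = x" for x :: "'n proper uea"
        by (cases "even k") (simp_all add: uea.scale_minus_left)
      then show ?thesis
        unfolding column_bitableau_rec.simps s' by (simp add: i'_def j'_def)
    qed
    also have "\<dots> \<in> ?F" by (intro uea.span_add uea.span_scale uea.span_sum base) simp_all
    finally show "s * uea_gen (Proper a) (Proper b) \<in> ?F" .
  qed
  then show ?case by (simp add: g)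
qed

lemma span_column_bitableaux:
  "uea.span {column_bitableau_rec k i j | k i j. k \<le> h} = (uea_filtration h :: 'n proper uea set)"
proof (rule antisym)
  have "column_bitableau_rec k i j \<in> (uea_filtration h :: 'n proper uea set)" if "k \<le> h" for k i j
  proof -
    have "uea_filtration k \<subseteq> (uea_filtration h :: 'n proper uea set)"
      unfolding uea_filtration_eq using that by (intro uea.span_mono) auto
    then show ?thesis using column_bitableau_rec_in_filtration by blast
  qed
  then have "{column_bitableau_rec k i j | k i j. k \<le> h} \<subseteq> (uea_filtration h :: 'n proper uea set)"
    by blast
  then show "uea.span {column_bitableau_rec k i j | k i j. k \<le> h} \<subseteq> (uea_filtration h :: 'n proper uea set)"
    by (rule uea.span_minimal) (simp add: uea_filtration_def)
  have "gen_word w \<in> uea.span {column_bitableau_rec k i j :: 'n proper uea | k i j. k \<le> h}" if "length w \<le> h" for w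
  proof -
    have "{column_bitableau_rec k i j :: 'n proper uea | k i j. k \<le> length w} \<subseteq> {column_bitableau_rec k i j | k i j. k \<le> h}"
      using that order_trans by blast
    from uea.span_mono[OF this] show ?thesis using gen_word_in_span_column_bitableaux by blast
  qed
  then show "uea_filtration h \<subseteq> uea.span {column_bitableau_rec k i j :: 'n proper uea | k i j. k \<le> h}"
    unfolding uea_filtration_eq by (intro uea.span_minimal) auto
qed

section \<open>Partitions, diagrams and cycle types\<close>

text \<open>Remove the maximum: in a set with \<open>n + 1\<close> elements it is at least
  \<open>n\<close>, and equality of the sums forces it to be \<open>n\<close>. Applied below to the
  columns occupied in each row.\<close>

lemma sum_lessThan_card_le:
  fixes S :: "nat set"
  assumes "finite S"
  shows "\<Sum>{..<card S} \<le> \<Sum>S \<and> (\<Sum>{..<card S} = \<Sum>S \<longrightarrow> S = {..<card S})"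
  using assms
proof (induction "card S" arbitrary: S)
  case (Suc n)
  define M where "M = Max S"
  define S' where "S' = S - {M}"
  have ne: "S \<noteq> {}" using Suc.hyps(2) by auto
  have M: "M \<in> S" unfolding M_def using Suc.prems ne by simp
  have S: "S = insert M S'" "M \<notin> S'" "finite S'" using M Suc.prems by (auto simp: S'_def)
  have card: "card S' = n" using Suc.hyps(2) S by simp
  have "S' \<subseteq> {..<M}"
  proof
    fix x assume "x \<in> S'"
    then have "x \<le> M" "x \<noteq> M" using Suc.prems by (auto simp: S'_def M_def)
    then show "x \<in> {..<M}" by simp
  qed
  from card_mono[OF _ this] card have nM: "n \<le> M" by simp
  have IH: "\<Sum>{..<n} \<le> \<Sum>S'" "\<Sum>{..<n} = \<Sum>S' \<Longrightarrow> S' = {..<n}"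
    using Suc.hyps(1)[of S'] card S(3) by auto
  have sum: "\<Sum>S = M + \<Sum>S'" using S by simp
  have sum_n: "\<Sum>{..<card S} = n + \<Sum>{..<n}" unfolding Suc.hyps(2)[symmetric] by simp
  have "S = {..<card S}" if eq: "\<Sum>{..<card S} = \<Sum>S"
  proof -
    from eq IH(1) nM sum sum_n have "n = M" "\<Sum>{..<n} = \<Sum>S'" by linarith+
    with IH(2) S(1) show ?thesis unfolding Suc.hyps(2)[symmetric] by auto
  qed
  then show ?case using IH(1) nM sum sum_n by linarith
qed simp

text \<open>A finite set of cells has at least the column weight of the left-justified diagram with the
  same row lengths, with equality only for that diagram.\<close>

lemma left_justified_minimal:
  fixes E D :: "(nat \<times> nat) set"
  assumes fin: "finite E" "finite D"
    and card: "\<And>r. card {c. (r, c) \<in> E} = card {c. (r, c) \<in> D}"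
    and D: "\<And>r. {c. (r, c) \<in> D} = {..<card {c. (r, c) \<in> D}}"
  shows "(\<Sum>x\<in>D. snd x) \<le> (\<Sum>x\<in>E. snd x)" and "(\<Sum>x\<in>D. snd x) = (\<Sum>x\<in>E. snd x) \<Longrightarrow> E = D"
proof -
  define R where "R = fst ` E \<union> fst ` D"
  have R: "finite R" using fin by (simp add: R_def)
  have sum: "(\<Sum>x\<in>X. snd x) = (\<Sum>r\<in>R. \<Sum>{c. (r, c) \<in> X})" if "X = E \<or> X = D" for X
  proof -
    have finX: "finite {c. (r, c) \<in> X}" for r
    proof -
      have "{c. (r, c) \<in> X} \<subseteq> snd ` X" by force
      then show ?thesis using that fin by (auto intro: finite_subset)
    qed
    have "X = Sigma R (\<lambda>r. {c. (r, c) \<in> X})" using that by (force simp: R_def)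
    then have "(\<Sum>x\<in>X. snd x) = (\<Sum>x\<in>Sigma R (\<lambda>r. {c. (r, c) \<in> X}). snd x)" by simp
    also have "\<dots> = (\<Sum>r\<in>R. \<Sum>{c. (r, c) \<in> X})"
      using sum.Sigma[of R "\<lambda>r. {c. (r, c) \<in> X}" "\<lambda>r c. c"] R finX by (simp add: case_prod_unfold)
    finally show ?thesis .
  qed
  have finE: "finite {c. (r, c) \<in> E}" for r
  proof -
    have "{c. (r, c) \<in> E} \<subseteq> snd ` E" by force
    then show ?thesis using fin by (auto intro: finite_subset)
  qed
  have row: "\<Sum>{c. (r, c) \<in> D} \<le> \<Sum>{c. (r, c) \<in> E}"
    and row_eq: "\<Sum>{c. (r, c) \<in> D} = \<Sum>{c. (r, c) \<in> E} \<Longrightarrow> {c. (r, c) \<in> E} = {c. (r, c) \<in> D}" for r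
  proof -
    have D': "{c. (r, c) \<in> D} = {..<card {c. (r, c) \<in> E}}" using D[of r] card[of r] by simp
    show "\<Sum>{c. (r, c) \<in> D} \<le> \<Sum>{c. (r, c) \<in> E}"
      unfolding D' using sum_lessThan_card_le[OF finE] by simp
    show "{c. (r, c) \<in> E} = {c. (r, c) \<in> D}" if "\<Sum>{c. (r, c) \<in> D} = \<Sum>{c. (r, c) \<in> E}"
      using sum_lessThan_card_le[OF finE, of r] that unfolding D' by simp
  qed
  show "(\<Sum>x\<in>D. snd x) \<le> (\<Sum>x\<in>E. snd x)"
    unfolding sum[of D, simplified] sum[of E, simplified] by (intro sum_mono row)
  assume "(\<Sum>x\<in>D. snd x) = (\<Sum>x\<in>E. snd x)"
  then have "(\<Sum>r\<in>R. \<Sum>{c. (r, c) \<in> D}) = (\<Sum>r\<in>R. \<Sum>{c. (r, c) \<in> E})"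
    unfolding sum[of D, simplified] sum[of E, simplified] .
  then have "\<Sum>{c. (r, c) \<in> D} = \<Sum>{c. (r, c) \<in> E}" if "r \<in> R" for r
    using sum_mono_inv[OF _ _ that R] row by blast
  then have "{c. (r, c) \<in> E} = {c. (r, c) \<in> D}" if "r \<in> R" for r
    using row_eq that by blast
  then have "(r, c) \<in> E \<longleftrightarrow> (r, c) \<in> D" if "r \<in> R" for r c
    using that by blast
  then show "E = D" unfolding R_def by (intro set_eqI) (metis UnI1 UnI2 image_eqI fst_conv prod.collapse)
qed

section \<open>Young diagrams, conjugation and tableaux without collisions\<close>

definition diagram :: "nat list \<Rightarrow> (nat \<times> nat) set" where
  "diagram \<mu> = {(r, c). r < length \<mu> \<and> c < \<mu> ! r}"

lemma set_cells: "set (cells \<mu>) = diagram \<mu>"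
  by (auto simp: cells_def diagram_def)

lemma length_cells: "length (cells \<mu>) = sum_list \<mu>"
  by (simp add: cells_def length_concat o_def map_nth)

lemma distinct_cells: "distinct (cells \<mu>)"
proof -
  have "distinct rs \<Longrightarrow> distinct (concat (map (\<lambda>r. map (Pair r) [0..<\<mu> ! r]) rs))" for rs
    by (induction rs) (auto simp: distinct_map inj_on_def)
  then show ?thesis by (simp add: cells_def)
qed

lemma bij_betw_cells: "bij_betw (\<lambda>t. cells \<mu> ! (t - 1)) {1..sum_list \<mu>} (diagram \<mu>)"
proof -
  have "bij_betw (\<lambda>t. t - 1) {1..sum_list \<mu>} {..<length (cells \<mu>)}"
    by (rule bij_betw_byWitness[where f'=Suc]) (auto simp: length_cells)
  from bij_betw_trans[OF this bij_betw_nth[OF distinct_cells refl set_cells[symmetric]]]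
  show ?thesis by (simp add: o_def)
qed

lemma finite_diagram: "finite (diagram \<mu>)"
  by (metis List.finite_set set_cells)

definition row_of :: "nat list \<Rightarrow> nat \<Rightarrow> nat" where "row_of \<mu> t = fst (cells \<mu> ! (t - 1))"
definition col_of :: "nat list \<Rightarrow> nat \<Rightarrow> nat" where "col_of \<mu> t = snd (cells \<mu> ! (t - 1))"
text \<open>Columns count from 0, so this is the sum of \<open>p choose 2\<close> over the row
  lengths \<open>p\<close>. It is monotone for the dominance order and serves as a numerical
  substitute for it.\<close>

definition col_weight :: "nat list \<Rightarrow> nat" where "col_weight \<mu> = (\<Sum>x\<in>diagram \<mu>. snd x)"

lemma bij_betw_row_col: "bij_betw (\<lambda>t. (row_of \<mu> t, col_of \<mu> t)) {1..sum_list \<mu>} (diagram \<mu>)"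
  using bij_betw_cells[of \<mu>] by (simp add: row_of_def col_of_def)

lemma row_diagram: "{c. (r, c) \<in> diagram \<mu>} = {..<if r < length \<mu> then \<mu> ! r else 0}"
  by (auto simp: diagram_def)

text \<open>In a weakly decreasing list the parts exceeding \<open>c\<close> form an initial
  segment; this yields the columns of the diagram.\<close>

lemma sorted_filter_less:
  assumes "sorted_wrt (\<ge>) \<mu>"
  shows "r < length (filter (\<lambda>p. c < p) \<mu>) \<longleftrightarrow> r < length \<mu> \<and> c < (\<mu> :: nat list) ! r"
  using assms
proof (induction \<mu> arbitrary: r)
  case (Cons p \<mu>)
  show ?case
  proof (cases "c < p")
    case True
    then show ?thesis using Cons by (cases r) auto
  next
    case False
    then have "filter (\<lambda>p. c < p) \<mu> = []" using Cons.prems by (auto simp: filter_empty_conv)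
    moreover have "\<not> (r < length (p # \<mu>) \<and> c < (p # \<mu>) ! r)"
    proof (cases r)
      case (Suc i)
      have "\<mu> ! i \<le> p" if "i < length \<mu>" using nth_mem[OF that] Cons.prems by simp
      then show ?thesis using False Suc by auto
    qed (use False in simp)
    ultimately show ?thesis using False by simp
  qed
qed simp

lemma column_diagram:
  assumes "sorted_wrt (\<ge>) \<mu>"
  shows "{r. (r, c) \<in> diagram \<mu>} = {..<length (filter (\<lambda>p. c < p) \<mu>)}"
  using sorted_filter_less[OF assms] by (auto simp: diagram_def)

lemma first_part_conv: "first_part \<mu> = (if \<mu> = [] then 0 else \<mu> ! 0)"
  by (cases \<mu>) (simp_all add: first_part_def)

lemma nth_le_first_part:
  assumes "sorted_wrt (\<ge>) \<mu>" "r < length \<mu>"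
  shows "\<mu> ! r \<le> first_part \<mu>"
  using assms sorted_wrt_nth_less[OF assms(1), of 0 r] by (cases r) (auto simp: first_part_conv)

lemma length_conjugate: "length (conjugate \<mu>) = first_part \<mu>"
  by (simp add: conjugate_def)

lemma nth_conjugate: "c < first_part \<mu> \<Longrightarrow> conjugate \<mu> ! c = length (filter (\<lambda>p. c < p) \<mu>)"
  by (simp add: conjugate_def)

lemma diagram_conjugate:
  assumes "sorted_wrt (\<ge>) \<mu>"
  shows "diagram (conjugate \<mu>) = prod.swap ` diagram \<mu>"
proof -
  have "(c, r) \<in> diagram (conjugate \<mu>) \<longleftrightarrow> (r, c) \<in> diagram \<mu>" for r c
    using nth_le_first_part[OF assms, of r]
    by (auto simp: diagram_def length_conjugate nth_conjugate sorted_filter_less[OF assms])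
  then show ?thesis by (force simp: image_iff)
qed

lemma card_diagram: "card (diagram \<mu>) = sum_list \<mu>"
  using bij_betw_same_card[OF bij_betw_cells[of \<mu>]] by simp

lemma partition_of_conjugate:
  assumes "partition_of k \<mu>"
  shows "partition_of k (conjugate \<mu>)"
proof -
  have s: "sorted_wrt (\<ge>) \<mu>" and pos: "\<forall>p\<in>set \<mu>. p > 0" and k: "sum_list \<mu> = k"
    using assms by (auto simp: partition_of_def)
  have "length (filter (\<lambda>p. d < p) \<mu>) \<le> length (filter (\<lambda>p. c < p) \<mu>)" if "c \<le> d" for c d
  proof -
    have "{r. (r, d) \<in> diagram \<mu>} \<subseteq> {r. (r, c) \<in> diagram \<mu>}" using that by (auto simp: diagram_def)
    then show ?thesis unfolding column_diagram[OF s] by simp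
  qed
  then have "sorted_wrt (\<ge>) (conjugate \<mu>)"
    by (simp add: sorted_wrt_iff_nth_less length_conjugate nth_conjugate)
  moreover have "p > 0" if p: "p \<in> set (conjugate \<mu>)" for p
  proof -
    obtain c where c: "c < first_part \<mu>" "p = length (filter (\<lambda>p. c < p) \<mu>)"
      using p by (auto simp: conjugate_def)
    then have "0 < length \<mu> \<and> c < \<mu> ! 0" by (auto simp: first_part_conv split: if_splits)
    then show ?thesis using sorted_filter_less[OF s, of 0 c] c by simp
  qed
  moreover have "sum_list (conjugate \<mu>) = k"
    unfolding card_diagram[symmetric] diagram_conjugate[OF s] using k
    by (simp add: card_image card_diagram)
  ultimately show ?thesis by (simp add: partition_of_def)
qed

lemma partition_eqI:
  assumes "partition_of k \<mu>" "partition_of k \<nu>" "diagram \<mu> = diagram \<nu>"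
  shows "\<mu> = \<nu>"
proof -
  have len: "{r. (r, 0) \<in> diagram \<mu>} = {..<length \<mu>}" if "partition_of k \<mu>" for \<mu>
    using that by (auto simp: diagram_def partition_of_def)
  have "length \<mu> = length \<nu>"
    using len[OF assms(1)] len[OF assms(2)] assms(3) by (metis lessThan_eq_iff)
  moreover have "\<mu> ! r = \<nu> ! r" if "r < length \<mu>" for r
    using row_diagram[of r \<mu>] row_diagram[of r \<nu>] assms(3) calculation that by (metis lessThan_eq_iff)
  ultimately show ?thesis by (rule nth_equalityI)
qed

lemma conjugate_conjugate:
  assumes "partition_of k \<mu>"
  shows "conjugate (conjugate \<mu>) = \<mu>"
proof (rule partition_eqI)
  show "partition_of k (conjugate (conjugate \<mu>))" using assms by (intro partition_of_conjugate)
  have "sorted_wrt (\<ge>) \<mu>" "sorted_wrt (\<ge>) (conjugate \<mu>)"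
    using assms partition_of_conjugate[OF assms] by (auto simp: partition_of_def)
  then show "diagram (conjugate (conjugate \<mu>)) = diagram \<mu>"
    by (simp add: diagram_conjugate image_image)
qed (rule assms)

lemma finite_partitions: "finite {\<mu>. partition_of k \<mu>}"
proof (rule finite_subset)
  show "{\<mu>. partition_of k \<mu>} \<subseteq> {\<mu>. set \<mu> \<subseteq> {..k} \<and> length \<mu> \<le> k}"
  proof clarify
    fix \<mu> assume \<mu>: "partition_of k \<mu>"
    then have "length \<mu> \<le> sum_list \<mu>"
    proof -
      have "(\<forall>p\<in>set \<mu>. p > 0) \<Longrightarrow> length \<mu> \<le> sum_list \<mu>"
        by (induction \<mu>) auto
      then show ?thesis using \<mu> by (simp add: partition_of_def)
    qed
    then show "set \<mu> \<subseteq> {..k} \<and> length \<mu> \<le> k"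
      using \<mu> member_le_sum_list[of _ \<mu>] by (auto simp: partition_of_def)
  qed
  show "finite {\<mu>. set \<mu> \<subseteq> {..k} \<and> length \<mu> \<le> k}"
    by (rule finite_lists_length_le) simp
qed

text \<open>The tableau translated by \<sigma> has the entry \<open>x\<close> where the canonical
  one has \<open>inv \<sigma> x\<close>. If no two entries share a row of the \<mu>-tableau and a
  column of the translated \<nu>-tableau, the pairs form a set of cells with the row lengths of
  \<mu> and the column weight of \<nu>, to which \<open>left_justified_minimal\<close>
  applies.\<close>

lemma no_collision_fill:
  assumes \<mu>: "partition_of k \<mu>" and \<nu>: "partition_of k \<nu>" and \<sigma>: "\<sigma> permutes {1..k}"
    and inj: "inj_on (\<lambda>x. (row_of \<mu> x, col_of \<nu> (inv \<sigma> x))) {1..k}"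
  shows "col_weight \<mu> \<le> col_weight \<nu>"
    and "col_weight \<mu> = col_weight \<nu> \<Longrightarrow>
      (\<lambda>x. (row_of \<mu> x, col_of \<nu> (inv \<sigma> x))) ` {1..k} = diagram \<mu>"
proof -
  let ?f = "\<lambda>x. (row_of \<mu> x, col_of \<nu> (inv \<sigma> x))"
  let ?g = "\<lambda>x. (row_of \<mu> x, col_of \<mu> x)"
  let ?E = "?f ` {1..k}"
  have k: "sum_list \<mu> = k" "sum_list \<nu> = k" using \<mu> \<nu> by (auto simp: partition_of_def)
  have g: "bij_betw ?g {1..k} (diagram \<mu>)" using bij_betw_row_col[of \<mu>] k by simp
  have card: "card {c. (r, c) \<in> ?E} = card {c. (r, c) \<in> diagram \<mu>}" for r
  proof -
    let ?X = "{x\<in>{1..k}. row_of \<mu> x = r}"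
    have 1: "{c. (r, c) \<in> ?E} = (\<lambda>x. col_of \<nu> (inv \<sigma> x)) ` ?X" by blast
    have 2: "inj_on (\<lambda>x. col_of \<nu> (inv \<sigma> x)) ?X"
      by (rule inj_onI) (rule inj_onD[OF inj], auto)
    have 3: "{c. (r, c) \<in> diagram \<mu>} = col_of \<mu> ` ?X"
      unfolding bij_betw_imp_surj_on[OF g, symmetric] by blast
    have 4: "inj_on (col_of \<mu>) ?X"
      by (rule inj_onI) (rule inj_onD[OF bij_betw_imp_inj_on[OF g]], auto)
    show ?thesis unfolding 1 3 card_image[OF 2] card_image[OF 4] ..
  qed
  have E: "(\<Sum>x\<in>?E. snd x) = col_weight \<nu>"
  proof -
    have "(\<Sum>x\<in>?E. snd x) = (\<Sum>x\<in>{1..k}. col_of \<nu> (inv \<sigma> x))"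
      unfolding sum.reindex[OF inj] by simp
    also have "\<dots> = (\<Sum>x\<in>{1..k}. col_of \<nu> x)"
      using sum.permute[OF permutes_inv[OF \<sigma>], of "col_of \<nu>"] unfolding o_def by (rule sym)
    also have "\<dots> = col_weight \<nu>"
      using sum.reindex_bij_betw[OF bij_betw_row_col[of \<nu>], of snd] unfolding k col_weight_def snd_conv .
    finally show ?thesis .
  qed
  have init: "{c. (r, c) \<in> diagram \<mu>} = {..<card {c. (r, c) \<in> diagram \<mu>}}" for r
    by (simp add: row_diagram)
  have fin: "finite ?E" by simp
  show "col_weight \<mu> \<le> col_weight \<nu>"
    using left_justified_minimal(1)[OF fin finite_diagram card init]
    unfolding E col_weight_def[of \<mu>, symmetric] .
  show "?E = diagram \<mu>" if "col_weight \<mu> = col_weight \<nu>"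
    by (rule left_justified_minimal(2)[OF fin finite_diagram card init])
      (unfold E col_weight_def[of \<mu>, symmetric], rule that)
qed

text \<open>With equal weights the pairs fill exactly \<open>diagram \<mu>\<close>; counted by
  columns they have the column lengths of \<nu>, so the diagrams agree.\<close>

lemma no_collision_eq:
  assumes \<mu>: "partition_of k \<mu>" and \<nu>: "partition_of k \<nu>" and \<sigma>: "\<sigma> permutes {1..k}"
    and inj: "inj_on (\<lambda>x. (row_of \<mu> x, col_of \<nu> (inv \<sigma> x))) {1..k}"
    and weight: "col_weight \<mu> = col_weight \<nu>"
  shows "\<mu> = \<nu>"
proof -
  let ?f = "\<lambda>x. (row_of \<mu> x, col_of \<nu> (inv \<sigma> x))"
  have im: "?f ` {1..k} = diagram \<mu>" by (rule no_collision_fill(2)[OF \<mu> \<nu> \<sigma> inj weight])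
  have k: "sum_list \<nu> = k" using \<nu> by (auto simp: partition_of_def)
  have g: "bij_betw (\<lambda>x. (row_of \<nu> x, col_of \<nu> x)) {1..k} (diagram \<nu>)" using bij_betw_row_col[of \<nu>] k by simp
  have s: "sorted_wrt (\<ge>) \<mu>" "sorted_wrt (\<ge>) \<nu>" using \<mu> \<nu> by (auto simp: partition_of_def)
  have "card {r. (r, c) \<in> diagram \<mu>} = card {r. (r, c) \<in> diagram \<nu>}" for c
  proof -
    let ?X = "{x\<in>{1..k}. col_of \<nu> (inv \<sigma> x) = c}" and ?Y = "{x\<in>{1..k}. col_of \<nu> x = c}"
    have "{r. (r, c) \<in> diagram \<mu>} = row_of \<mu> ` ?X" unfolding im[symmetric] by blast
    moreover have "inj_on (row_of \<mu>) ?X"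
      by (rule inj_onI) (rule inj_onD[OF inj], auto)
    moreover have "{r. (r, c) \<in> diagram \<nu>} = row_of \<nu> ` ?Y"
      unfolding bij_betw_imp_surj_on[OF g, symmetric] by blast
    moreover have "inj_on (row_of \<nu>) ?Y"
      by (rule inj_onI) (rule inj_onD[OF bij_betw_imp_inj_on[OF g]], auto)
    moreover have "card ?X = card ?Y"
    proof -
      have "?X = \<sigma> ` ?Y"
      proof (intro set_eqI iffI)
        fix x assume "x \<in> ?X"
        then have "inv \<sigma> x \<in> ?Y" using permutes_in_image[OF permutes_inv[OF \<sigma>], of x] by simp
        moreover have "x = \<sigma> (inv \<sigma> x)" using \<sigma> by (simp add: permutes_inverses)
        ultimately show "x \<in> \<sigma> ` ?Y" by blast
      next
        fix x assume "x \<in> \<sigma> ` ?Y"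
        then show "x \<in> ?X" using permutes_in_image[OF \<sigma>] permutes_inverses[OF \<sigma>] by auto
      qed
      then show ?thesis using permutes_inj[OF \<sigma>] by (simp add: card_image inj_on_subset)
    qed
    ultimately show ?thesis by (simp add: card_image)
  qed
  then have "{r. (r, c) \<in> diagram \<mu>} = {r. (r, c) \<in> diagram \<nu>}" for c
    unfolding column_diagram[OF s(1)] column_diagram[OF s(2)] by simp
  then have "diagram \<mu> = diagram \<nu>" by auto
  then show ?thesis by (rule partition_eqI[OF \<mu> \<nu>])
qed

lemma mem_row_stabilizer:
  "partition_of k \<mu> \<Longrightarrow> \<sigma> \<in> row_stabilizer \<mu> \<longleftrightarrow> \<sigma> permutes {1..k} \<and> (\<forall>t\<in>{1..k}. row_of \<mu> (\<sigma> t) = row_of \<mu> t)"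
  by (simp add: row_stabilizer_def row_of_def partition_of_def)

lemma mem_column_stabilizer:
  "partition_of k \<mu> \<Longrightarrow> \<sigma> \<in> column_stabilizer \<mu> \<longleftrightarrow> \<sigma> permutes {1..k} \<and> (\<forall>t\<in>{1..k}. col_of \<mu> (\<sigma> t) = col_of \<mu> t)"
  by (simp add: column_stabilizer_def col_of_def partition_of_def)

text \<open>Since the pairs fill the whole diagram, each entry can be moved inside its row to the
  column demanded by its second coordinate. This rearrangement \<pi> yields the factors
  \<open>inv \<pi>\<close> and \<open>\<pi> \<circ> \<sigma>\<close>.\<close>

lemma no_collision_factor:
  assumes \<mu>: "partition_of k \<mu>" and \<sigma>: "\<sigma> permutes {1..k}"
    and inj: "inj_on (\<lambda>x. (row_of \<mu> x, col_of \<mu> (inv \<sigma> x))) {1..k}"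
  obtains p q where "p \<in> row_stabilizer \<mu>" "q \<in> column_stabilizer \<mu>" "\<sigma> = p \<circ> q"
proof -
  let ?f = "\<lambda>x. (row_of \<mu> x, col_of \<mu> (inv \<sigma> x))" and ?g = "\<lambda>x. (row_of \<mu> x, col_of \<mu> x)"
  have f: "bij_betw ?f {1..k} (diagram \<mu>)"
    using no_collision_fill(2)[OF \<mu> \<mu> \<sigma> inj] inj by (simp add: bij_betw_def)
  have g: "bij_betw ?g {1..k} (diagram \<mu>)" using bij_betw_row_col[of \<mu>] \<mu> by (simp add: partition_of_def)
  define \<pi> where "\<pi> = (\<lambda>x. if x \<in> {1..k} then the_inv_into {1..k} ?g (?f x) else x)"
  have bij: "bij_betw \<pi> {1..k} {1..k}"
  proof -
    have "bij_betw (the_inv_into {1..k} ?g \<circ> ?f) {1..k} {1..k}"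
      using bij_betw_trans[OF f bij_betw_the_inv_into[OF g]] .
    then show ?thesis by (rule bij_betw_cong[THEN iffD1, rotated]) (simp add: \<pi>_def)
  qed
  then have \<pi>: "\<pi> permutes {1..k}" by (rule bij_imp_permutes) (simp add: \<pi>_def del: atLeastAtMost_iff)
  have eq: "?g (\<pi> x) = ?f x" if "x \<in> {1..k}" for x
  proof -
    have "?f x \<in> ?g ` {1..k}" using f g that by (auto simp: bij_betw_def)
    then have "?g (the_inv_into {1..k} ?g (?f x)) = ?f x"
      using g by (intro f_the_inv_into_f) (auto simp: bij_betw_def)
    then show ?thesis using that by (simp only: \<pi>_def if_True)
  qed
  have row: "row_of \<mu> (\<pi> x) = row_of \<mu> x" and col: "col_of \<mu> (\<pi> x) = col_of \<mu> (inv \<sigma> x)" if "x \<in> {1..k}" for x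
    using eq[OF that] by simp_all
  have "inv \<pi> \<in> row_stabilizer \<mu>"
    unfolding mem_row_stabilizer[OF \<mu>]
  proof (intro conjI ballI)
    fix t assume t: "t \<in> {1..k}"
    have "inv \<pi> t \<in> {1..k}" using permutes_in_image[OF permutes_inv[OF \<pi>]] t by simp
    then show "row_of \<mu> (inv \<pi> t) = row_of \<mu> t" using row[of "inv \<pi> t"] permutes_inverses[OF \<pi>] by simp
  qed (rule permutes_inv[OF \<pi>])
  moreover have "\<pi> \<circ> \<sigma> \<in> column_stabilizer \<mu>"
    unfolding mem_column_stabilizer[OF \<mu>]
  proof (intro conjI ballI)
    fix t assume t: "t \<in> {1..k}"
    have "\<sigma> t \<in> {1..k}" using permutes_in_image[OF \<sigma>] t by simp
    then show "col_of \<mu> ((\<pi> \<circ> \<sigma>) t) = col_of \<mu> t" using col[of "\<sigma> t"] permutes_inverses[OF \<sigma>] by simp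
  qed (rule permutes_compose[OF \<sigma> \<pi>])
  moreover have "\<sigma> = inv \<pi> \<circ> (\<pi> \<circ> \<sigma>)"
    using permutes_inverses[OF \<pi>] by (simp add: fun_eq_iff)
  ultimately show ?thesis by (rule that)
qed

section \<open>Cycle types and conjugacy\<close>

inductive cycle_type :: "('a \<Rightarrow> 'a) \<Rightarrow> 'a set \<Rightarrow> nat list \<Rightarrow> bool" for \<sigma> where
  empty: "cycle_type \<sigma> {} []"
| cycle: "cycle_type \<sigma> S \<rho> \<Longrightarrow> p > 0 \<Longrightarrow> inj_on (\<lambda>i. (\<sigma> ^^ i) x) {..<p} \<Longrightarrow> (\<sigma> ^^ p) x = x \<Longrightarrow>
    (\<lambda>i. (\<sigma> ^^ i) x) ` {..<p} \<inter> S = {} \<Longrightarrow> cycle_type \<sigma> ((\<lambda>i. (\<sigma> ^^ i) x) ` {..<p} \<union> S) (p # \<rho>)"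

text \<open>Cycles at the same position of the list have equal length; sending the i-th iterate of
  one starting point to the i-th iterate of the other intertwines the two maps.\<close>

lemma cycle_type_conj:
  assumes "cycle_type \<sigma> S \<rho>" "cycle_type \<sigma>' S' \<rho>"
  shows "\<exists>g. bij_betw g S S' \<and> (\<forall>x\<in>S. \<sigma> x \<in> S \<and> g (\<sigma> x) = \<sigma>' (g x))"
  using assms
proof (induction arbitrary: S' rule: cycle_type.induct)
  case empty
  then have "S' = {}" by cases auto
  then show ?case by (auto simp: bij_betw_def)
next
  case (cycle S \<rho> p x)
  let ?h = "\<lambda>i. (\<sigma> ^^ i) x"
  from cycle.prems obtain T y where T: "S' = (\<lambda>i. (\<sigma>' ^^ i) y) ` {..<p} \<union> T" "cycle_type \<sigma>' T \<rho>"
    "inj_on (\<lambda>i. (\<sigma>' ^^ i) y) {..<p}" "(\<sigma>' ^^ p) y = y" "(\<lambda>i. (\<sigma>' ^^ i) y) ` {..<p} \<inter> T = {}"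
    by (cases rule: cycle_type.cases) auto
  let ?h' = "\<lambda>i. (\<sigma>' ^^ i) y"
  from cycle.IH[OF T(2)] obtain g where g: "bij_betw g S T" "\<And>x. x \<in> S \<Longrightarrow> \<sigma> x \<in> S \<and> g (\<sigma> x) = \<sigma>' (g x)"
    by blast
  define g' where "g' = (\<lambda>z. if z \<in> ?h ` {..<p} then ?h' (the_inv_into {..<p} ?h z) else g z)"
  have g'h: "g' (?h i) = ?h' i" if "i < p" for i
    using that the_inv_into_f_f[OF cycle.hyps(3), of i] by (simp add: g'_def)
  have bij1: "bij_betw g' (?h ` {..<p}) (?h' ` {..<p})"
    unfolding bij_betw_def
  proof
    show "inj_on g' (?h ` {..<p})"
      using g'h T(3) by (auto simp: inj_on_def)
    show "g' ` ?h ` {..<p} = ?h' ` {..<p}"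
      unfolding image_image by (intro image_cong refl) (use g'h in auto)
  qed
  have gS: "g' z = g z" if "z \<in> S" for z using that cycle.hyps(5) by (auto simp: g'_def)
  have bij2: "bij_betw g' S T" using g(1) gS bij_betw_cong[of S g' g] by simp
  have "bij_betw g' (?h ` {..<p} \<union> S) S'"
    unfolding T(1) by (rule bij_betw_combine[OF bij1 bij2 T(5)])
  moreover have "\<sigma> z \<in> ?h ` {..<p} \<union> S \<and> g' (\<sigma> z) = \<sigma>' (g' z)" if z: "z \<in> ?h ` {..<p} \<union> S" for z
  proof (cases "z \<in> S")
    case True
    then show ?thesis using g(2) gS by auto
  next
    case False
    then obtain i where i: "i < p" "z = ?h i" using z by auto
    show ?thesis
    proof (cases "Suc i < p")
      case True
      then have "\<sigma> z = ?h (Suc i)" "Suc i \<in> {..<p}" using i by simp_all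
      moreover have "g' (?h (Suc i)) = \<sigma>' (g' z)" unfolding g'h[OF True] i(2) g'h[OF i(1)] by simp
      ultimately show ?thesis by (metis UnI1 image_eqI)
    next
      case False
      then have p: "p = Suc i" using i by simp
      then have "\<sigma> z = ?h 0" using cycle.hyps(4) i by simp
      moreover have "g' (?h 0) = \<sigma>' (g' z)"
        using T(4) p g'h[OF i(1)] g'h[OF cycle.hyps(2)] i(2) by simp
      ultimately show ?thesis using cycle.hyps(2) by (metis UnI1 image_eqI lessThan_iff)
    qed
  qed
  ultimately show ?case by blast
qed

text \<open>A largest orbit is removed first, so the list comes out weakly decreasing. The last
  conjunct, that every part is an orbit size, is carried along to compare later parts with that
  maximum.\<close>

lemma cycle_type_exists:
  assumes "finite U" "\<sigma> permutes U" "S \<subseteq> U" "\<sigma> ` S \<subseteq> S"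
  shows "\<exists>\<rho>. cycle_type \<sigma> S \<rho> \<and> sorted_wrt (\<ge>) \<rho> \<and> (\<forall>p\<in>set \<rho>. p > 0) \<and> sum_list \<rho> = card S \<and>
    (\<forall>p\<in>set \<rho>. \<exists>x\<in>S. p = card (orbit \<sigma> x))"
  using assms(3,4)
proof (induction "card S" arbitrary: S rule: less_induct)
  case less
  have fin: "finite S" using less.prems(1) assms(1) finite_subset by blast
  show ?case
  proof (cases "S = {}")
    case True
    then show ?thesis using cycle_type.empty by (intro exI[of _ "[]"]) auto
  next
    case False
    have perm: "permutation \<sigma>" using assms(1,2) permutation_permutes by blast
    have "Max ((\<lambda>x. card (orbit \<sigma> x)) ` S) \<in> (\<lambda>x. card (orbit \<sigma> x)) ` S"
      using fin False by (intro Max_in) auto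
    then obtain x where x: "x \<in> S" "card (orbit \<sigma> x) = Max ((\<lambda>x. card (orbit \<sigma> x)) ` S)" by auto
    define p where "p = funpow_dist1 \<sigma> x x"
    have self: "x \<in> orbit \<sigma> x" by (rule permutation_self_in_orbit[OF perm])
    have orb: "orbit \<sigma> x = (\<lambda>i. (\<sigma> ^^ i) x) ` {..<p}"
      using orbit_conv_funpow_dist1[OF self] by (simp add: p_def atLeast0LessThan)
    have inj: "inj_on (\<lambda>i. (\<sigma> ^^ i) x) {..<p}"
      using inj_on_funpow_dist1[OF self] by (simp add: p_def atLeast0LessThan)
    have cyc: "(\<sigma> ^^ p) x = x" unfolding p_def by (rule funpow_dist1_prop[OF self])
    have p: "p > 0" "card (orbit \<sigma> x) = p" using inj by (simp_all add: p_def orb card_image)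
    have "(\<sigma> ^^ i) x \<in> S" for i by (induction i) (use x(1) less.prems(2) in auto)
    then have sub: "orbit \<sigma> x \<subseteq> S" unfolding orb by blast
    define T where "T = S - orbit \<sigma> x"
    have card: "card S = p + card T"
      using card_Diff_subset[OF finite_subset[OF sub fin] sub] p card_mono[OF fin sub] by (simp add: T_def)
    have inv: "\<sigma> ` T \<subseteq> T"
    proof
      fix z assume "z \<in> \<sigma> ` T"
      then obtain y where y: "y \<in> T" "z = \<sigma> y" by blast
      have "\<sigma> y \<notin> orbit \<sigma> x" using permutation_orbit_step[OF perm, of y] y(1)
        by (metis Diff_iff T_def orbit_swap orbit_step orbit.base perm permutation_self_in_orbit orbit_trans)
      then show "z \<in> T" using y less.prems(2) by (auto simp: T_def)
    qed
    obtain \<rho> where \<rho>: "cycle_type \<sigma> T \<rho>" "sorted_wrt (\<ge>) \<rho>" "\<forall>p\<in>set \<rho>. p > 0" "sum_list \<rho> = card T"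
      "\<forall>p\<in>set \<rho>. \<exists>x\<in>T. p = card (orbit \<sigma> x)"
      using less.hyps[of T] card p less.prems(1) inv by (auto simp: T_def)
    have TS: "T \<subseteq> S" "orbit \<sigma> x \<union> T = S" "orbit \<sigma> x \<inter> T = {}" using sub by (auto simp: T_def)
    have "cycle_type \<sigma> S (p # \<rho>)"
      using cycle_type.cycle[OF \<rho>(1) p(1) inj cyc] TS(2,3) by (simp add: orb)
    moreover have "q \<le> p" if "q \<in> set \<rho>" for q
    proof -
      obtain y where y: "y \<in> S" "q = card (orbit \<sigma> y)" using \<rho>(5) \<open>q \<in> set \<rho>\<close> TS(1) by blast
      have "card (orbit \<sigma> y) \<le> Max ((\<lambda>x. card (orbit \<sigma> x)) ` S)" using fin y(1) by (intro Max_ge) auto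
      then show ?thesis using x(2) p(2) y(2) by simp
    qed
    moreover have "\<exists>x\<in>S. q = card (orbit \<sigma> x)" if "q \<in> set (p # \<rho>)" for q
      using that \<rho>(5) TS(1) x(1) p(2) by auto
    ultimately show ?thesis using \<rho>(2-4) p(1) card by (intro exI[of _ "p # \<rho>"]) simp
  qed
qed

definition cycle_partition :: "nat \<Rightarrow> (nat \<Rightarrow> nat) \<Rightarrow> nat list" where
  "cycle_partition k \<sigma> = (SOME \<rho>. cycle_type \<sigma> {1..k} \<rho> \<and> partition_of k \<rho>)"

lemma cycle_partition:
  assumes "\<sigma> permutes {1..k}"
  shows "cycle_type \<sigma> {1..k} (cycle_partition k \<sigma>)" "partition_of k (cycle_partition k \<sigma>)"
proof -
  have "\<exists>\<rho>. cycle_type \<sigma> {1..k} \<rho> \<and> partition_of k \<rho>"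
  proof -
    obtain \<rho> where "cycle_type \<sigma> {1..k} \<rho>" "sorted_wrt (\<ge>) \<rho>" "\<forall>p\<in>set \<rho>. p > 0" "sum_list \<rho> = card {1..k}"
      using cycle_type_exists[OF _ assms, of "{1..k}"] permutes_image[OF assms] by (simp only:) blast
    then show ?thesis unfolding partition_of_def by (intro exI[of _ \<rho>]) simp
  qed
  then have "cycle_type \<sigma> {1..k} (cycle_partition k \<sigma>) \<and> partition_of k (cycle_partition k \<sigma>)"
    unfolding cycle_partition_def by (rule someI_ex)
  then show "cycle_type \<sigma> {1..k} (cycle_partition k \<sigma>)" "partition_of k (cycle_partition k \<sigma>)" by auto
qed

lemma cycle_partition_eq_conj:
  assumes "\<sigma> permutes {1..k}" "\<sigma>' permutes {1..k}" "cycle_partition k \<sigma> = cycle_partition k \<sigma>'"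
  obtains \<tau> where "\<tau> permutes {1..k}" "\<sigma>' = \<tau> \<circ> \<sigma> \<circ> inv \<tau>"
proof -
  obtain g where g: "bij_betw g {1..k} {1..k}" "\<And>x. x \<in> {1..k} \<Longrightarrow> \<sigma> x \<in> {1..k} \<and> g (\<sigma> x) = \<sigma>' (g x)"
    using cycle_type_conj[OF cycle_partition(1)[OF assms(1)] cycle_partition(1)[OF assms(2), folded assms(3)]]
    by blast
  define \<tau> where "\<tau> = (\<lambda>x. if x \<in> {1..k} then g x else x)"
  have "bij_betw \<tau> {1..k} {1..k}"
    using g(1) bij_betw_cong[of "{1..k}" \<tau> g] by (simp add: \<tau>_def del: atLeastAtMost_iff)
  then have \<tau>: "\<tau> permutes {1..k}" by (rule bij_imp_permutes) (simp add: \<tau>_def del: atLeastAtMost_iff)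
  have "\<tau> (\<sigma> x) = \<sigma>' (\<tau> x)" for x
    using g(2)[of x] permutes_not_in[OF assms(1), of x] permutes_not_in[OF assms(2), of x] by (auto simp: \<tau>_def)
  then have "\<sigma>' = \<tau> \<circ> \<sigma> \<circ> inv \<tau>"
    using permutes_inverses[OF \<tau>] by (simp add: fun_eq_iff)
  with \<tau> show ?thesis by (rule that)
qed

section \<open>Young symmetrizers\<close>

lemma malg_mult_scale:
  "malg_scale c x * y = malg_scale c (x * y)" "x * malg_scale c y = malg_scale c (x * y)"
proof -
  show "malg_scale c x * y = malg_scale c (x * y)" by (simp add: malg_scale_def mult.assoc)
  have "x * malg_scale c y = (x * Poly_Mapping.single 0 c) * y" by (simp add: malg_scale_def mult.assoc)
  then show "x * malg_scale c y = malg_scale c (x * y)"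
    by (simp add: malg_scale_def mult.assoc single_zero_commute[symmetric])
qed

lemma lookup_malg_scale: "Poly_Mapping.lookup (malg_scale c x) w = c * Poly_Mapping.lookup x w"
proof -
  have "malg_scale c x = (\<Sum>v\<in>Poly_Mapping.keys x. Poly_Mapping.single v (c * Poly_Mapping.lookup x v))"
    by (subst malg_sum_singles[of x]) (simp add: malg_scale_def sum_distrib_left mult_single)
  then show ?thesis by (auto simp: lookup_sum lookup_single when_def in_keys_iff)
qed

lemma malg_self_neg: "x = - x \<Longrightarrow> x = (0 :: 'm::monoid_add \<Rightarrow>\<^sub>0 complex)"
proof -
  assume "x = - x"
  then have "x + x = 0" by (metis add.right_inverse)
  then have "malg_scale 2 x = 0" using malg.scale_left_distrib[of 1 1 x] by simp
  then show "x = 0" by simp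
qed

lemma malg_span_mult_left:
  assumes "x \<in> malg.span S" "\<And>s. s \<in> S \<Longrightarrow> r * s \<in> malg.span T"
  shows "r * x \<in> malg.span T"
  using assms(1)
  by (induction rule: malg.span_induct_alt)
    (auto simp: distrib_left malg_mult_scale intro!: malg.span_zero malg.span_add malg.span_scale assms(2))

lemma malg_span_mult_right:
  assumes "x \<in> malg.span S" "\<And>s. s \<in> S \<Longrightarrow> s * r \<in> malg.span T"
  shows "x * r \<in> malg.span T"
  using assms(1)
  by (induction rule: malg.span_induct_alt)
    (auto simp: distrib_right malg_mult_scale intro!: malg.span_zero malg.span_add malg.span_scale assms(2))

definition perm_coeff :: "(nat self_map \<Rightarrow>\<^sub>0 complex) \<Rightarrow> (nat \<Rightarrow> nat) \<Rightarrow> complex" where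
  "perm_coeff x \<sigma> = Poly_Mapping.lookup x (Self_Map \<sigma>)"

lemma perm_coeff_simps [simp]:
  "perm_coeff 0 \<sigma> = 0"
  "perm_coeff (x + y) \<sigma> = perm_coeff x \<sigma> + perm_coeff y \<sigma>"
  "perm_coeff (malg_scale c x) \<sigma> = c * perm_coeff x \<sigma>"
  "perm_coeff (perm_elt \<tau>) \<sigma> = (if \<tau> = \<sigma> then 1 else 0)"
  by (simp_all add: perm_coeff_def lookup_add lookup_malg_scale perm_elt_def lookup_single when_def)

lemma perm_coeff_sum: "perm_coeff (sum f A) \<sigma> = (\<Sum>a\<in>A. perm_coeff (f a) \<sigma>)"
  by (simp add: perm_coeff_def lookup_sum)

lemma perm_elt_mult [simp]: "perm_elt \<sigma> * perm_elt \<tau> = perm_elt (\<sigma> \<circ> \<tau>)"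
  by (simp add: perm_elt_def mult_single)

lemma perm_elt_id: "perm_elt id = 1"
  by (simp add: perm_elt_def flip: zero_self_map_def)

abbreviation sym_group :: "nat \<Rightarrow> (nat \<Rightarrow> nat) set" where
  "sym_group k \<equiv> {\<sigma>. \<sigma> permutes {1..k}}"

lemma finite_sym_group: "finite (sym_group k)"
  by (rule finite_permutations) simp

lemma perm_elt_in_alg: "\<sigma> permutes {1..k} \<Longrightarrow> perm_elt \<sigma> \<in> sym_group_alg k"
  unfolding sym_group_alg_def by (rule malg.span_base) blast

lemma sym_group_alg_induct [consumes 1, case_names zero step]:
  assumes "x \<in> sym_group_alg k" "P 0"
    "\<And>c \<sigma> y. \<sigma> permutes {1..k} \<Longrightarrow> y \<in> sym_group_alg k \<Longrightarrow> P y \<Longrightarrow> P (malg_scale c (perm_elt \<sigma>) + y)"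
  shows "P x"
proof -
  have "x \<in> sym_group_alg k \<and> P x"
    using assms(1)[unfolded sym_group_alg_def]
  proof (induction rule: malg.span_induct_alt)
    case base
    then show ?case using assms(2) by (simp add: sym_group_alg_def malg.span_zero)
  next
    case (step c s y)
    then obtain \<sigma> where \<sigma>: "\<sigma> permutes {1..k}" "s = perm_elt \<sigma>" by blast
    have "malg_scale c s + y \<in> sym_group_alg k"
      using perm_elt_in_alg[OF \<sigma>(1)] step.IH unfolding \<sigma>(2) sym_group_alg_def
      by (intro malg.span_add malg.span_scale) simp_all
    then show ?case using assms(3)[OF \<sigma>(1)] step.IH unfolding \<sigma>(2) by blast
  qed
  then show ?thesis ..
qed

lemma sym_group_alg_expand:
  "x \<in> sym_group_alg k \<Longrightarrow> x = (\<Sum>\<sigma>\<in>sym_group k. malg_scale (perm_coeff x \<sigma>) (perm_elt \<sigma>))"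
proof (induction rule: sym_group_alg_induct)
  case (step c \<sigma> y)
  have "(\<Sum>\<tau>\<in>sym_group k. malg_scale (if \<sigma> = \<tau> then c else 0) (perm_elt \<tau>)) =
    (\<Sum>\<tau>\<in>sym_group k. if \<tau> = \<sigma> then malg_scale c (perm_elt \<sigma>) else 0)"
    by (intro sum.cong refl) auto
  also have "\<dots> = malg_scale c (perm_elt \<sigma>)" using step.hyps finite_sym_group by (simp add: sum.delta)
  finally have "malg_scale c (perm_elt \<sigma>) + y = (\<Sum>\<tau>\<in>sym_group k. malg_scale (if \<sigma> = \<tau> then c else 0) (perm_elt \<tau>)) +
     (\<Sum>\<tau>\<in>sym_group k. malg_scale (perm_coeff y \<tau>) (perm_elt \<tau>))"
    using step.IH by simp
  also have "\<dots> = (\<Sum>\<tau>\<in>sym_group k. malg_scale (perm_coeff (malg_scale c (perm_elt \<sigma>) + y) \<tau>) (perm_elt \<tau>))"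
    unfolding sum.distrib[symmetric] malg.scale_left_distrib[symmetric]
    by (intro sum.cong refl) (simp add: if_distrib)
  finally show ?case .
qed simp

lemma sym_group_alg_zero: "0 \<in> sym_group_alg k"
  and sym_group_alg_add: "x \<in> sym_group_alg k \<Longrightarrow> y \<in> sym_group_alg k \<Longrightarrow> x + y \<in> sym_group_alg k"
  and sym_group_alg_scale: "x \<in> sym_group_alg k \<Longrightarrow> malg_scale c x \<in> sym_group_alg k"
  and sym_group_alg_sum: "(\<And>i. i \<in> I \<Longrightarrow> f i \<in> sym_group_alg k) \<Longrightarrow> sum f I \<in> sym_group_alg k"
  by (simp_all add: sym_group_alg_def malg.span_zero malg.span_add malg.span_scale malg.span_sum)

lemma sym_group_alg_mult:
  assumes "x \<in> sym_group_alg k" "y \<in> sym_group_alg k"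
  shows "x * y \<in> sym_group_alg k"
proof -
  have "x * perm_elt \<sigma> \<in> sym_group_alg k" if "\<sigma> permutes {1..k}" for \<sigma>
    using assms(1) unfolding sym_group_alg_def
    by (rule malg_span_mult_right) (use that in \<open>auto intro!: malg.span_base permutes_compose\<close>)
  then show ?thesis
    using assms(2) unfolding sym_group_alg_def[of k]
    by (elim malg_span_mult_left) auto
qed

lemma bij_comp_eq_iff:
  assumes "bij \<tau>"
  shows "\<tau> \<circ> \<rho> = \<sigma> \<longleftrightarrow> \<rho> = inv \<tau> \<circ> \<sigma>" "\<rho>' \<circ> \<tau> = \<sigma>' \<longleftrightarrow> \<rho>' = \<sigma>' \<circ> inv \<tau>"
proof -
  have c: "inv \<tau> \<circ> \<tau> = id" "\<tau> \<circ> inv \<tau> = id"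
    using assms by (simp_all add: bij_is_inj bij_is_surj surj_iff[symmetric])
  show "\<tau> \<circ> \<rho> = \<sigma> \<longleftrightarrow> \<rho> = inv \<tau> \<circ> \<sigma>"
  proof
    assume "\<tau> \<circ> \<rho> = \<sigma>"
    then have "inv \<tau> \<circ> \<sigma> = (inv \<tau> \<circ> \<tau>) \<circ> \<rho>" by (simp add: comp_assoc)
    then show "\<rho> = inv \<tau> \<circ> \<sigma>" unfolding c by simp
  next
    assume "\<rho> = inv \<tau> \<circ> \<sigma>"
    then have "\<tau> \<circ> \<rho> = (\<tau> \<circ> inv \<tau>) \<circ> \<sigma>" by (simp only: comp_assoc)
    then show "\<tau> \<circ> \<rho> = \<sigma>" unfolding c by simp
  qed
  show "\<rho>' \<circ> \<tau> = \<sigma>' \<longleftrightarrow> \<rho>' = \<sigma>' \<circ> inv \<tau>"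
  proof
    assume "\<rho>' \<circ> \<tau> = \<sigma>'"
    then have "\<sigma>' \<circ> inv \<tau> = \<rho>' \<circ> (\<tau> \<circ> inv \<tau>)" by (simp only: comp_assoc[symmetric])
    then show "\<rho>' = \<sigma>' \<circ> inv \<tau>" unfolding c by simp
  next
    assume "\<rho>' = \<sigma>' \<circ> inv \<tau>"
    then have "\<rho>' \<circ> \<tau> = \<sigma>' \<circ> (inv \<tau> \<circ> \<tau>)" by (simp only: comp_assoc)
    then show "\<rho>' \<circ> \<tau> = \<sigma>'" unfolding c by simp
  qed
qed

lemma perm_coeff_mult_left:
  assumes "x \<in> sym_group_alg k" "bij \<tau>"
  shows "perm_coeff (perm_elt \<tau> * x) \<sigma> = perm_coeff x (inv \<tau> \<circ> \<sigma>)"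
  using assms(1)
proof (induction rule: sym_group_alg_induct)
  case (step c \<rho> y)
  show ?case
    by (simp only: distrib_left malg_mult_scale perm_elt_mult perm_coeff_simps bij_comp_eq_iff[OF assms(2)] step.IH)
qed simp

lemma perm_coeff_mult_right:
  assumes "x \<in> sym_group_alg k" "bij \<tau>"
  shows "perm_coeff (x * perm_elt \<tau>) \<sigma> = perm_coeff x (\<sigma> \<circ> inv \<tau>)"
  using assms(1)
proof (induction rule: sym_group_alg_induct)
  case (step c \<rho> y)
  show ?case
    by (simp only: distrib_right malg_mult_scale perm_elt_mult perm_coeff_simps bij_comp_eq_iff[OF assms(2)] step.IH)
qed simp

text \<open>The coefficient at \<open>id\<close> is a trace on the group algebra, because
  \<open>\<sigma> \<circ> \<tau> = id\<close> is symmetric in the two permutations. Later it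
  evaluates scalars by rotating products.\<close>

lemma perm_coeff_id_commute:
  assumes "x \<in> sym_group_alg k" "y \<in> sym_group_alg k"
  shows "perm_coeff (x * y) id = perm_coeff (y * x) id"
  using assms(2)
proof (induction rule: sym_group_alg_induct)
  case (step c \<sigma> y)
  have "bij \<sigma>" using step.hyps permutes_bij by blast
  then show ?case
    by (simp only: distrib_left distrib_right malg_mult_scale perm_coeff_simps step.IH
        perm_coeff_mult_left[OF assms(1)] perm_coeff_mult_right[OF assms(1)] id_comp comp_id)
qed simp

text \<open>Row stabilizers, column stabilizers and the full group need the same reindexing of sums
  by translation, and partly by inversion.\<close>

locale perm_subgroup =
  fixes H :: "(nat \<Rightarrow> nat) set" and k :: nat
  assumes sub: "H \<subseteq> sym_group k" and id_mem: "id \<in> H"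
    and comp_mem: "p \<in> H \<Longrightarrow> q \<in> H \<Longrightarrow> p \<circ> q \<in> H" and inv_mem: "p \<in> H \<Longrightarrow> inv p \<in> H"
begin

lemma permutes: "p \<in> H \<Longrightarrow> p permutes {1..k}" using sub by blast

lemma fin: "finite H" using finite_subset[OF sub finite_sym_group] .

lemma sum_comp_left: "p \<in> H \<Longrightarrow> (\<Sum>\<sigma>\<in>H. f (p \<circ> \<sigma>)) = (\<Sum>\<sigma>\<in>H. f \<sigma>)"
  by (rule sum.reindex_bij_witness[where i="\<lambda>\<sigma>. inv p \<circ> \<sigma>" and j="\<lambda>\<sigma>. p \<circ> \<sigma>"])
    (auto simp: comp_mem inv_mem fun_eq_iff permutes_inverses[OF permutes])

lemma sum_comp_right: "p \<in> H \<Longrightarrow> (\<Sum>\<sigma>\<in>H. f (\<sigma> \<circ> p)) = (\<Sum>\<sigma>\<in>H. f \<sigma>)"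
  by (rule sum.reindex_bij_witness[where i="\<lambda>\<sigma>. \<sigma> \<circ> inv p" and j="\<lambda>\<sigma>. \<sigma> \<circ> p"])
    (auto simp: comp_mem inv_mem fun_eq_iff permutes_inverses[OF permutes])

lemma sum_inv: "(\<Sum>\<sigma>\<in>H. f (inv \<sigma>)) = (\<Sum>\<sigma>\<in>H. f \<sigma>)"
  by (rule sum.reindex_bij_witness[where i=inv and j=inv])
    (auto simp: inv_mem permutes_inv_inv[OF permutes])

end

lemma perm_subgroup_sym_group: "perm_subgroup (sym_group k) k"
  by standard (auto simp: permutes_id permutes_compose permutes_inv)

lemma
  assumes "partition_of k \<mu>"
  shows perm_subgroup_row: "perm_subgroup (row_stabilizer \<mu>) k"
    and perm_subgroup_column: "perm_subgroup (column_stabilizer \<mu>) k"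
proof -
  have "perm_subgroup {\<sigma>. \<sigma> permutes {1..k} \<and> (\<forall>t\<in>{1..k}. f (\<sigma> t) = f t)} k" (is "perm_subgroup ?H k")
    for f :: "nat \<Rightarrow> nat"
  proof
    have perm: "p permutes {1..k}" and stab: "t \<in> {1..k} \<Longrightarrow> f (p t) = f t" if "p \<in> ?H" for p t
      using that by auto
    show "inv p \<in> ?H" if p: "p \<in> ?H" for p
    proof (intro CollectI conjI ballI)
      show inv: "inv p permutes {1..k}" by (rule permutes_inv[OF perm[OF p]])
      fix t assume t: "t \<in> {1..k}"
      then have "inv p t \<in> {1..k}" by (simp only: permutes_in_image[OF inv])
      from stab[OF p this] show "f (inv p t) = f t" by (simp only: permutes_inverses(1)[OF perm[OF p]])
    qed
    show "p \<circ> q \<in> ?H" if p: "p \<in> ?H" and q: "q \<in> ?H" for p q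
    proof (intro CollectI conjI ballI)
      show "p \<circ> q permutes {1..k}" by (rule permutes_compose[OF perm[OF q] perm[OF p]])
      fix t assume t: "t \<in> {1..k}"
      then have "q t \<in> {1..k}" by (simp only: permutes_in_image[OF perm[OF q]])
      then show "f ((p \<circ> q) t) = f t" using stab[OF p] stab[OF q t] by (simp only: o_apply)
    qed
  qed (auto simp: permutes_id)
  note H = this
  have k: "sum_list \<mu> = k" using assms by (simp add: partition_of_def)
  show "perm_subgroup (row_stabilizer \<mu>) k" unfolding row_stabilizer_def k by (rule H[of "\<lambda>t. fst (cells \<mu> ! (t - 1))"])
  show "perm_subgroup (column_stabilizer \<mu>) k" unfolding column_stabilizer_def k by (rule H[of "\<lambda>t. snd (cells \<mu> ! (t - 1))"])
qed

section \<open>Row sums, column sums and Young symmetrizers\<close>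

definition row_sum :: "nat list \<Rightarrow> nat self_map \<Rightarrow>\<^sub>0 complex" where
  "row_sum \<mu> = (\<Sum>\<sigma>\<in>row_stabilizer \<mu>. perm_elt \<sigma>)"

definition column_sum :: "nat list \<Rightarrow> nat self_map \<Rightarrow>\<^sub>0 complex" where
  "column_sum \<mu> = (\<Sum>\<tau>\<in>column_stabilizer \<mu>. malg_scale (of_int (sign \<tau>)) (perm_elt \<tau>))"

lemma young_symmetrizer_eq: "young_symmetrizer \<mu> = row_sum \<mu> * column_sum \<mu>"
  by (simp add: young_symmetrizer_def row_sum_def column_sum_def)

context
  fixes k :: nat and \<mu> :: "nat list"
  assumes \<mu>: "partition_of k \<mu>"
begin

interpretation R: perm_subgroup "row_stabilizer \<mu>" k by (rule perm_subgroup_row[OF \<mu>])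
interpretation C: perm_subgroup "column_stabilizer \<mu>" k by (rule perm_subgroup_column[OF \<mu>])

lemma row_sum_in_alg: "row_sum \<mu> \<in> sym_group_alg k"
  unfolding row_sum_def by (intro sym_group_alg_sum perm_elt_in_alg R.permutes)

lemma column_sum_in_alg: "column_sum \<mu> \<in> sym_group_alg k"
  unfolding column_sum_def by (intro sym_group_alg_sum sym_group_alg_scale perm_elt_in_alg C.permutes)

lemma young_symmetrizer_in_alg: "young_symmetrizer \<mu> \<in> sym_group_alg k"
  unfolding young_symmetrizer_eq by (intro sym_group_alg_mult row_sum_in_alg column_sum_in_alg)

lemma row_sum_absorb:
  assumes "p \<in> row_stabilizer \<mu>"
  shows "perm_elt p * row_sum \<mu> = row_sum \<mu>" "row_sum \<mu> * perm_elt p = row_sum \<mu>"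
  unfolding row_sum_def sum_distrib_left sum_distrib_right perm_elt_mult
  by (rule R.sum_comp_left[OF assms], rule R.sum_comp_right[OF assms])

lemma column_sum_absorb:
  assumes "q \<in> column_stabilizer \<mu>"
  shows "perm_elt q * column_sum \<mu> = malg_scale (of_int (sign q)) (column_sum \<mu>)"
    "column_sum \<mu> * perm_elt q = malg_scale (of_int (sign q)) (column_sum \<mu>)"
proof -
  have perm: "permutation p" if "p \<in> column_stabilizer \<mu>" for p
    using C.permutes[OF that] by (meson finite_atLeastAtMost permutation_permutes)
  have sq: "of_int (sign q) * of_int (sign q * sign p) = (of_int (sign p) :: complex)" for p
    by (simp add: sign_def)
  have "perm_elt q * column_sum \<mu> = malg_scale (of_int (sign q)) (\<Sum>\<tau>\<in>column_stabilizer \<mu>. malg_scale (of_int (sign (q \<circ> \<tau>))) (perm_elt (q \<circ> \<tau>)))"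
    unfolding column_sum_def sum_distrib_left malg.scale_sum_right
    by (intro sum.cong refl)
      (simp only: malg_mult_scale perm_elt_mult sign_compose[OF perm[OF assms] perm] malg.scale_scale sq)
  then show "perm_elt q * column_sum \<mu> = malg_scale (of_int (sign q)) (column_sum \<mu>)"
    unfolding C.sum_comp_left[OF assms, of "\<lambda>\<tau>. malg_scale (of_int (sign \<tau>)) (perm_elt \<tau>)"] column_sum_def .
  have "column_sum \<mu> * perm_elt q = malg_scale (of_int (sign q)) (\<Sum>\<tau>\<in>column_stabilizer \<mu>. malg_scale (of_int (sign (\<tau> \<circ> q))) (perm_elt (\<tau> \<circ> q)))"
    unfolding column_sum_def sum_distrib_right malg.scale_sum_right
    by (intro sum.cong refl)
      (simp only: malg_mult_scale perm_elt_mult sign_compose[OF perm perm[OF assms]] malg.scale_scale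
        mult.commute[of "sign _" "sign q"] sq)
  then show "column_sum \<mu> * perm_elt q = malg_scale (of_int (sign q)) (column_sum \<mu>)"
    unfolding C.sum_comp_right[OF assms, of "\<lambda>\<tau>. malg_scale (of_int (sign \<tau>)) (perm_elt \<tau>)"] column_sum_def .
qed

lemma row_column_disjoint:
  assumes "p \<in> row_stabilizer \<mu>" "p \<in> column_stabilizer \<mu>"
  shows "p = id"
proof
  fix t
  show "p t = id t"
  proof (cases "t \<in> {1..k}")
    case True
    have pt: "p t \<in> {1..k}" using True by (simp only: permutes_in_image[OF R.permutes[OF assms(1)]])
    have inj: "inj_on (\<lambda>t. (row_of \<mu> t, col_of \<mu> t)) {1..k}"
      using bij_betw_row_col[of \<mu>] \<mu> by (simp add: partition_of_def bij_betw_def)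
    have "row_of \<mu> (p t) = row_of \<mu> t" "col_of \<mu> (p t) = col_of \<mu> t"
      using assms True unfolding mem_row_stabilizer[OF \<mu>] mem_column_stabilizer[OF \<mu>] by blast+
    then show ?thesis using inj_onD[OF inj _ pt True] by simp
  next
    case False
    then show ?thesis using permutes_not_in[OF R.permutes[OF assms(1)] False] by simp
  qed
qed

text \<open>A permutation preserving rows and columns fixes every cell, so only the term with both
  factors \<open>id\<close> contributes. Consequently the scalar of any multiple of the symmetrizer
  can be read off at \<open>id\<close>.\<close>

lemma perm_coeff_young_symmetrizer_id: "perm_coeff (young_symmetrizer \<mu>) id = 1"
proof -
  let ?R = "row_stabilizer \<mu>" and ?C = "column_stabilizer \<mu>"
  have "perm_coeff (young_symmetrizer \<mu>) id = (\<Sum>p\<in>?R. \<Sum>q\<in>?C. if p \<circ> q = id then of_int (sign q) else 0)"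
    unfolding young_symmetrizer_eq row_sum_def column_sum_def sum_product perm_coeff_sum
    by (intro sum.cong refl) (simp add: malg_mult_scale)
  also have "\<dots> = (\<Sum>p\<in>?R. \<Sum>q\<in>?C. if q = id then (if p = id then 1 else 0) else 0)"
  proof (intro sum.cong refl)
    fix p q assume pq: "p \<in> ?R" "q \<in> ?C"
    have "p = id \<and> q = id" if "p \<circ> q = id"
    proof -
      have "inv p = q" by (metis that R.permutes[OF pq(1)] comp_assoc comp_id id_comp permutes_inv_o(2))
      then have "q = id" using row_column_disjoint R.inv_mem[OF pq(1)] pq(2) by blast
      then show ?thesis using that by simp
    qed
    then show "(if p \<circ> q = id then of_int (sign q) else 0 :: complex) = (if q = id then (if p = id then 1 else 0) else 0)"
      by auto
  qed
  also have "\<dots> = 1"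
    using R.fin C.fin R.id_mem C.id_mem by (simp add: sum.delta)
  finally show ?thesis .
qed

end

text \<open>If two entries share a row of the first tableau and a column of the second, their
  transposition is absorbed with sign \<open>1\<close> on one side and \<open>-1\<close> on the other.\<close>

lemma collision_vanish:
  assumes \<mu>: "partition_of k \<mu>" and \<nu>: "partition_of k \<nu>" and \<sigma>: "\<sigma> permutes {1..k}"
    and noninj: "\<not> inj_on (\<lambda>x. (row_of \<mu> x, col_of \<nu> (inv \<sigma> x))) {1..k}"
  shows "row_sum \<mu> * perm_elt \<sigma> * column_sum \<nu> = 0"
    and "column_sum \<nu> * perm_elt (inv \<sigma>) * row_sum \<mu> = 0"
proof -
  obtain x y where xy: "x \<in> {1..k}" "y \<in> {1..k}" "x \<noteq> y" "row_of \<mu> x = row_of \<mu> y"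
    "col_of \<nu> (inv \<sigma> x) = col_of \<nu> (inv \<sigma> y)"
    using noninj unfolding inj_on_def by blast
  define w where "w = transpose x y"
  define x' where "x' = inv \<sigma> x"
  define y' where "y' = inv \<sigma> y"
  define w' where "w' = transpose x' y'"
  have inv\<sigma>: "inv \<sigma> permutes {1..k}" by (rule permutes_inv[OF \<sigma>])
  have x'y': "x' \<in> {1..k}" "y' \<in> {1..k}"
    unfolding x'_def y'_def using xy(1,2) by (simp_all only: permutes_in_image[OF inv\<sigma>])
  have \<sigma>x': "\<sigma> x' = x" "\<sigma> y' = y" by (simp_all add: x'_def y'_def permutes_inverses(1)[OF \<sigma>])
  then have ne: "x' \<noteq> y'" using xy(3) by auto
  have w: "w \<in> row_stabilizer \<mu>"
    unfolding mem_row_stabilizer[OF \<mu>] w_def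
  proof (intro conjI ballI)
    show "row_of \<mu> (transpose x y t) = row_of \<mu> t" for t
      using xy(4) by (cases "t = x"; cases "t = y") (simp_all add: transpose_def)
  qed (rule permutes_swap_id[OF xy(1,2)])
  have w': "w' \<in> column_stabilizer \<nu>"
    unfolding mem_column_stabilizer[OF \<nu>] w'_def
  proof (intro conjI ballI)
    show "col_of \<nu> (transpose x' y' t) = col_of \<nu> t" for t
      using xy(5)[folded x'_def y'_def] by (cases "t = x'"; cases "t = y'") (simp_all add: transpose_def)
  qed (rule permutes_swap_id[OF x'y'])
  have sgn: "sign w' = - 1" using ne by (simp add: w'_def sign_swap_id)
  \<comment> \<open>Moved through \<sigma>, the transposition \<open>w\<close> of \<open>x\<close>
    and \<open>y\<close> becomes the transposition \<open>w'\<close> of their preimages.\<close>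
  have w\<sigma>: "w (\<sigma> t) = \<sigma> (w' t)" for t
  proof -
    have "\<sigma> t = x \<longleftrightarrow> t = x'" "\<sigma> t = y \<longleftrightarrow> t = y'"
      unfolding \<sigma>x'[symmetric] by (simp_all only: inj_eq[OF permutes_inj[OF \<sigma>]])
    then show ?thesis unfolding w_def w'_def transpose_def using \<sigma>x' by simp
  qed
  then have comm: "w \<circ> \<sigma> = \<sigma> \<circ> w'" by (simp add: fun_eq_iff)
  have "inv \<sigma> (w t) = w' (inv \<sigma> t)" for t
    using w\<sigma>[of "inv \<sigma> t"] by (simp only: permutes_inverses[OF \<sigma>])
  then have comm': "inv \<sigma> \<circ> w = w' \<circ> inv \<sigma>" by (simp add: fun_eq_iff)
  have "row_sum \<mu> * perm_elt \<sigma> * column_sum \<nu> = (row_sum \<mu> * perm_elt w) * perm_elt \<sigma> * column_sum \<nu>"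
    by (simp only: row_sum_absorb(2)[OF \<mu> w])
  also have "\<dots> = row_sum \<mu> * perm_elt (w \<circ> \<sigma>) * column_sum \<nu>"
    by (simp only: mult.assoc perm_elt_mult[symmetric])
  also have "\<dots> = row_sum \<mu> * perm_elt \<sigma> * (perm_elt w' * column_sum \<nu>)"
    unfolding comm by (simp only: mult.assoc perm_elt_mult[symmetric])
  also have "\<dots> = - (row_sum \<mu> * perm_elt \<sigma> * column_sum \<nu>)"
    unfolding column_sum_absorb(1)[OF \<nu> w'] sgn by (simp add: malg_mult_scale)
  finally show "row_sum \<mu> * perm_elt \<sigma> * column_sum \<nu> = 0" by (rule malg_self_neg)
  have "column_sum \<nu> * perm_elt (inv \<sigma>) * row_sum \<mu> = column_sum \<nu> * perm_elt (inv \<sigma>) * (perm_elt w * row_sum \<mu>)"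
    by (simp only: row_sum_absorb(1)[OF \<mu> w])
  also have "\<dots> = column_sum \<nu> * perm_elt (inv \<sigma> \<circ> w) * row_sum \<mu>"
    by (simp only: mult.assoc perm_elt_mult[symmetric])
  also have "\<dots> = (column_sum \<nu> * perm_elt w') * perm_elt (inv \<sigma>) * row_sum \<mu>"
    unfolding comm' by (simp only: mult.assoc perm_elt_mult[symmetric])
  also have "\<dots> = - (column_sum \<nu> * perm_elt (inv \<sigma>) * row_sum \<mu>)"
    unfolding column_sum_absorb(2)[OF \<nu> w'] sgn by (simp add: malg_mult_scale)
  finally show "column_sum \<nu> * perm_elt (inv \<sigma>) * row_sum \<mu> = 0" by (rule malg_self_neg)
qed

text \<open>For a single \<sigma> either there is a collision and the product vanishes, or \<sigma>
  is a row permutation times a column permutation and both are absorbed.\<close>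

lemma young_sandwich:
  assumes \<mu>: "partition_of k \<mu>" and "x \<in> sym_group_alg k"
  shows "\<exists>\<kappa>. row_sum \<mu> * x * column_sum \<mu> = malg_scale \<kappa> (young_symmetrizer \<mu>)"
  using assms(2)
proof (induction rule: sym_group_alg_induct)
  case zero
  show ?case by (rule exI[of _ 0]) simp
next
  case (step c \<sigma> y)
  have "\<exists>\<kappa>. row_sum \<mu> * perm_elt \<sigma> * column_sum \<mu> = malg_scale \<kappa> (young_symmetrizer \<mu>)"
  proof (cases "inj_on (\<lambda>x. (row_of \<mu> x, col_of \<mu> (inv \<sigma> x))) {1..k}")
    case True
    then obtain p q where pq: "p \<in> row_stabilizer \<mu>" "q \<in> column_stabilizer \<mu>" "\<sigma> = p \<circ> q"
      by (rule no_collision_factor[OF \<mu> step.hyps(1)])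
    have "row_sum \<mu> * perm_elt \<sigma> * column_sum \<mu> = (row_sum \<mu> * perm_elt p) * (perm_elt q * column_sum \<mu>)"
      unfolding pq(3) by (simp only: mult.assoc perm_elt_mult[symmetric])
    then show ?thesis
      unfolding row_sum_absorb(2)[OF \<mu> pq(1)] column_sum_absorb(1)[OF \<mu> pq(2)] malg_mult_scale
        young_symmetrizer_eq by blast
  next
    case False
    then have "row_sum \<mu> * perm_elt \<sigma> * column_sum \<mu> = malg_scale 0 (young_symmetrizer \<mu>)"
      using collision_vanish(1)[OF \<mu> \<mu> step.hyps(1)] by simp
    then show ?thesis by blast
  qed
  then obtain \<kappa> \<kappa>' where "row_sum \<mu> * perm_elt \<sigma> * column_sum \<mu> = malg_scale \<kappa> (young_symmetrizer \<mu>)"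
    "row_sum \<mu> * y * column_sum \<mu> = malg_scale \<kappa>' (young_symmetrizer \<mu>)" using step.IH by blast
  then have "row_sum \<mu> * (malg_scale c (perm_elt \<sigma>) + y) * column_sum \<mu> = malg_scale (c * \<kappa> + \<kappa>') (young_symmetrizer \<mu>)"
    by (simp add: distrib_left distrib_right malg_mult_scale malg.scale_left_distrib)
  then show ?case by blast
qed

lemma sandwich_eq_0:
  assumes "\<And>\<sigma>. \<sigma> permutes {1..k} \<Longrightarrow> u * perm_elt \<sigma> * v = 0" "x \<in> sym_group_alg k"
  shows "u * x * v = 0"
  using assms(2)
  by (induction rule: sym_group_alg_induct)
    (simp_all add: distrib_left distrib_right malg_mult_scale assms(1))

text \<open>If the weight of \<mu> is not the smaller one, absence of a collision would force equal
  weights and then equal partitions, so the outer factors \<open>row_sum \<mu>\<close> and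
  \<open>column_sum \<nu>\<close> annihilate everything between them. Otherwise a collision always
  occurs between the inner factors \<open>column_sum \<mu>\<close> and
  \<open>row_sum \<nu>\<close>.\<close>

lemma young_symmetrizer_orthogonal:
  assumes \<mu>: "partition_of k \<mu>" and \<nu>: "partition_of k \<nu>" and "\<mu> \<noteq> \<nu>" and x: "x \<in> sym_group_alg k"
  shows "young_symmetrizer \<mu> * x * young_symmetrizer \<nu> = 0"
proof (cases "col_weight \<mu> < col_weight \<nu>")
  case False
  have "row_sum \<mu> * perm_elt \<sigma> * column_sum \<nu> = 0" if \<sigma>: "\<sigma> permutes {1..k}" for \<sigma>
  proof (rule collision_vanish(1)[OF \<mu> \<nu> \<sigma>], rule notI)
    assume inj: "inj_on (\<lambda>x. (row_of \<mu> x, col_of \<nu> (inv \<sigma> x))) {1..k}"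
    from no_collision_fill(1)[OF \<mu> \<nu> \<sigma> inj] False have "col_weight \<mu> = col_weight \<nu>" by simp
    from no_collision_eq[OF \<mu> \<nu> \<sigma> inj this] show False using assms(3) by contradiction
  qed
  moreover have "column_sum \<mu> * x * row_sum \<nu> \<in> sym_group_alg k"
    by (rule sym_group_alg_mult[OF sym_group_alg_mult[OF column_sum_in_alg[OF \<mu>] x] row_sum_in_alg[OF \<nu>]])
  ultimately have "row_sum \<mu> * (column_sum \<mu> * x * row_sum \<nu>) * column_sum \<nu> = 0"
    by (rule sandwich_eq_0)
  then show ?thesis by (simp add: young_symmetrizer_eq mult.assoc)
next
  case True
  have "column_sum \<mu> * perm_elt \<sigma> * row_sum \<nu> = 0" if \<sigma>: "\<sigma> permutes {1..k}" for \<sigma>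
  proof -
    have "column_sum \<mu> * perm_elt (inv (inv \<sigma>)) * row_sum \<nu> = 0"
    proof (rule collision_vanish(2)[OF \<nu> \<mu> permutes_inv[OF \<sigma>]], rule notI)
      assume inj: "inj_on (\<lambda>x. (row_of \<nu> x, col_of \<mu> (inv (inv \<sigma>) x))) {1..k}"
      from no_collision_fill(1)[OF \<nu> \<mu> permutes_inv[OF \<sigma>] inj] True show False by simp
    qed
    then show ?thesis by (simp only: permutes_inv_inv[OF \<sigma>])
  qed
  then have "column_sum \<mu> * x * row_sum \<nu> = 0"
    using x by (rule sandwich_eq_0)
  then have "row_sum \<mu> * (column_sum \<mu> * x * row_sum \<nu>) * column_sum \<nu> = 0" by simp
  then show ?thesis by (simp add: young_symmetrizer_eq mult.assoc)
qed

text \<open>The square of the symmetrizer is this multiple of the symmetrizer, whose own coefficient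
  at \<open>id\<close> is 1; classically it is the product of the hook lengths of \<mu>.\<close>

definition young_scalar :: "nat list \<Rightarrow> complex" where
  "young_scalar \<mu> = perm_coeff (young_symmetrizer \<mu> * young_symmetrizer \<mu>) id"

lemma young_symmetrizer_sandwich:
  assumes \<mu>: "partition_of k \<mu>" and x: "x \<in> sym_group_alg k"
  shows "young_symmetrizer \<mu> * x * young_symmetrizer \<mu> =
    malg_scale (perm_coeff (young_symmetrizer \<mu> * x * young_symmetrizer \<mu>) id) (young_symmetrizer \<mu>)"
proof -
  have "column_sum \<mu> * x * row_sum \<mu> \<in> sym_group_alg k"
    by (rule sym_group_alg_mult[OF sym_group_alg_mult[OF column_sum_in_alg[OF \<mu>] x] row_sum_in_alg[OF \<mu>]])
  from young_sandwich[OF \<mu> this] obtain \<kappa> where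
    "young_symmetrizer \<mu> * x * young_symmetrizer \<mu> = malg_scale \<kappa> (young_symmetrizer \<mu>)"
    by (auto simp: young_symmetrizer_eq mult.assoc)
  then show ?thesis by (simp add: perm_coeff_young_symmetrizer_id[OF \<mu>])
qed

lemma one_in_alg: "1 \<in> sym_group_alg k"
  using perm_elt_in_alg[OF permutes_id] by (simp only: perm_elt_id)

lemma young_symmetrizer_square:
  assumes \<mu>: "partition_of k \<mu>"
  shows "young_symmetrizer \<mu> * young_symmetrizer \<mu> = malg_scale (young_scalar \<mu>) (young_symmetrizer \<mu>)"
  using young_symmetrizer_sandwich[OF \<mu> one_in_alg] by (simp add: young_scalar_def)

text \<open>The element \<open>row_sum \<mu> * column_sum \<mu> * row_sum \<mu>\<close> has integral coefficients and is fixed by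
  the anti-involution inverting permutations, so its square has a positive coefficient at \<open>id\<close>; but
  it would square to \<open>0\<close> if the Young symmetrizer did.\<close>

lemma young_scalar_nonzero:
  assumes \<mu>: "partition_of k \<mu>"
  shows "young_scalar \<mu> \<noteq> 0"
proof
  assume 0: "young_scalar \<mu> = 0"
  interpret R: perm_subgroup "row_stabilizer \<mu>" k by (rule perm_subgroup_row[OF \<mu>])
  interpret C: perm_subgroup "column_stabilizer \<mu>" k by (rule perm_subgroup_column[OF \<mu>])
  let ?R = "row_stabilizer \<mu>" and ?C = "column_stabilizer \<mu>"
  let ?a = "row_sum \<mu>" and ?b = "column_sum \<mu>"
  define y where "y = ?a * ?b * ?a"
  have in_alg: "?a \<in> sym_group_alg k" "?b \<in> sym_group_alg k" "y \<in> sym_group_alg k"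
    unfolding y_def
    by (rule row_sum_in_alg[OF \<mu>] column_sum_in_alg[OF \<mu>] sym_group_alg_mult)+
  have aa: "?a * ?a = malg_scale (of_nat (card ?R)) ?a"
  proof -
    have "?a * ?a = (\<Sum>p\<in>?R. perm_elt p * ?a)" by (simp add: row_sum_def sum_distrib_right)
    also have "\<dots> = (\<Sum>p\<in>?R. malg_scale 1 ?a)" by (intro sum.cong refl) (simp add: row_sum_absorb(1)[OF \<mu>])
    also have "\<dots> = malg_scale (of_nat (card ?R)) ?a" by (simp only: malg.scale_sum_left[symmetric]) simp
    finally show ?thesis .
  qed
  have abab: "?a * (?b * (?a * ?b)) = 0"
    using young_symmetrizer_square[OF \<mu>] 0 by (simp add: young_symmetrizer_eq mult.assoc)
  have "y * y = ?a * (?b * ((?a * ?a) * (?b * ?a)))" by (simp add: y_def mult.assoc)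
  also have "\<dots> = malg_scale (of_nat (card ?R)) ((?a * (?b * (?a * ?b))) * ?a)"
    unfolding aa malg_mult_scale by (simp only: mult.assoc)
  finally have yy: "y * y = 0" unfolding abab by simp
  define m where "m = (\<lambda>\<sigma>. \<Sum>p\<in>?R. \<Sum>q\<in>?C. \<Sum>r\<in>?R. if p \<circ> q \<circ> r = \<sigma> then sign q else 0)"
  have y_coeff: "perm_coeff y \<sigma> = of_int (m \<sigma>)" for \<sigma>
  proof -
    have ab: "?a * ?b = (\<Sum>p\<in>?R. \<Sum>q\<in>?C. malg_scale (of_int (sign q)) (perm_elt (p \<circ> q)))"
      unfolding row_sum_def column_sum_def sum_product malg_mult_scale perm_elt_mult ..
    have "y = (\<Sum>p\<in>?R. \<Sum>q\<in>?C. \<Sum>r\<in>?R. malg_scale (of_int (sign q)) (perm_elt (p \<circ> q \<circ> r)))"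
      unfolding y_def ab unfolding row_sum_def sum_distrib_right
      unfolding sum_distrib_left malg_mult_scale perm_elt_mult ..
    then show ?thesis unfolding m_def of_int_sum
      by (simp only: perm_coeff_sum) (intro sum.cong refl, simp)
  qed
  have m_inv: "m (inv \<sigma>) = m \<sigma>" if \<sigma>: "\<sigma> permutes {1..k}" for \<sigma>
  proof -
    define h where "h = (\<lambda>p q r. if (p :: nat \<Rightarrow> nat) \<circ> q \<circ> r = \<sigma> then sign q else 0)"
    have "m (inv \<sigma>) = (\<Sum>p\<in>?R. \<Sum>q\<in>?C. \<Sum>r\<in>?R. h (inv r) (inv q) (inv p))"
      unfolding m_def
    proof (intro sum.cong refl)
      fix p q r assume pqr: "p \<in> ?R" "q \<in> ?C" "r \<in> ?R"
      note perms = R.permutes[OF pqr(1)] C.permutes[OF pqr(2)] R.permutes[OF pqr(3)]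
      have bij: "bij p" "bij q" "bij r" "bij \<sigma>"
        using perms[THEN permutes_bij] permutes_bij[OF \<sigma>] by simp_all
      note bij = bij bij_comp[OF bij(2,1)] bij_comp[OF bij(3) bij_comp[OF bij(2,1)]]
      have "inv (p \<circ> q \<circ> r) = inv r \<circ> inv q \<circ> inv p"
        unfolding o_inv_distrib[OF bij(5,3)] o_inv_distrib[OF bij(1,2)] by (rule comp_assoc[symmetric])
      moreover have "p \<circ> q \<circ> r = inv \<sigma> \<longleftrightarrow> inv (p \<circ> q \<circ> r) = \<sigma>"
      proof
        assume "p \<circ> q \<circ> r = inv \<sigma>"
        then show "inv (p \<circ> q \<circ> r) = \<sigma>" by (simp only: inv_inv_eq[OF bij(4)])
      next
        assume "inv (p \<circ> q \<circ> r) = \<sigma>"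
        then have "inv (inv (p \<circ> q \<circ> r)) = inv \<sigma>" by (rule arg_cong)
        then show "p \<circ> q \<circ> r = inv \<sigma>" by (simp only: inv_inv_eq[OF bij(6)])
      qed
      moreover have "sign (inv q) = sign q"
        by (rule sign_inverse[OF permutes_imp_permutation[OF finite_atLeastAtMost perms(2)]])
      ultimately show "(if p \<circ> q \<circ> r = inv \<sigma> then sign q else 0) = h (inv r) (inv q) (inv p)"
        by (simp only: h_def)
    qed
    also have "\<dots> = (\<Sum>p\<in>?R. \<Sum>q\<in>?C. \<Sum>r\<in>?R. h r q p)"
      unfolding R.sum_inv[of "\<lambda>r. h r _ _"] C.sum_inv[of "\<lambda>q. \<Sum>r\<in>?R. h r q _"]
      by (rule R.sum_inv[of "\<lambda>p. \<Sum>q\<in>?C. \<Sum>r\<in>?R. h r q p"])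
    also have "\<dots> = (\<Sum>q\<in>?C. \<Sum>p\<in>?R. \<Sum>r\<in>?R. h r q p)" by (rule sum.swap)
    also have "\<dots> = (\<Sum>q\<in>?C. \<Sum>r\<in>?R. \<Sum>p\<in>?R. h r q p)" by (rule sum.cong[OF refl sum.swap])
    also have "\<dots> = (\<Sum>r\<in>?R. \<Sum>q\<in>?C. \<Sum>p\<in>?R. h r q p)" by (rule sum.swap)
    finally show ?thesis by (simp only: m_def h_def)
  qed
  have "perm_coeff (y * y) id = perm_coeff ((\<Sum>\<sigma>\<in>sym_group k. malg_scale (perm_coeff y \<sigma>) (perm_elt \<sigma>)) * y) id"
    by (simp only: sym_group_alg_expand[OF in_alg(3), symmetric])
  also have "\<dots> = (\<Sum>\<sigma>\<in>sym_group k. of_int (m \<sigma> * m \<sigma>))"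
    unfolding sum_distrib_right perm_coeff_sum
  proof (intro sum.cong refl)
    fix \<sigma> assume "\<sigma> \<in> sym_group k"
    then have \<sigma>: "\<sigma> permutes {1..k}" by simp
    show "perm_coeff (malg_scale (perm_coeff y \<sigma>) (perm_elt \<sigma>) * y) id = of_int (m \<sigma> * m \<sigma>)"
      by (simp only: malg_mult_scale perm_coeff_simps perm_coeff_mult_left[OF in_alg(3) permutes_bij[OF \<sigma>]]
          comp_id y_coeff m_inv[OF \<sigma>] of_int_mult)
  qed
  finally have "of_int (\<Sum>\<sigma>\<in>sym_group k. m \<sigma> * m \<sigma>) = (0 :: complex)"
    unfolding yy of_int_sum by (simp only: perm_coeff_simps)
  then have "(\<Sum>\<sigma>\<in>sym_group k. m \<sigma> * m \<sigma>) = 0" by (simp only: of_int_eq_0_iff)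
  moreover have "id \<in> sym_group k" by (simp add: permutes_id)
  ultimately have "m id * m id = 0"
    by (rule sum_nonneg_0[OF finite_sym_group zero_le_square])
  then have "m id = 0" by simp
  then have 0: "perm_coeff y id = 0" by (simp only: y_coeff of_int_0)
  \<comment> \<open>Rotating the product under the trace property turns \<open>y\<close> into the
    symmetrizer times the order of the row stabilizer.\<close>
  have "perm_coeff y id = of_nat (card ?R)"
  proof -
    have "perm_coeff y id = perm_coeff (?a * (?a * ?b)) id"
      unfolding y_def by (rule perm_coeff_id_commute[OF sym_group_alg_mult[OF in_alg(1,2)] in_alg(1)])
    also have "?a * (?a * ?b) = malg_scale (of_nat (card ?R)) (young_symmetrizer \<mu>)"
      by (simp only: mult.assoc[symmetric] aa malg_mult_scale young_symmetrizer_eq)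
    finally show ?thesis
      by (simp only: perm_coeff_simps perm_coeff_young_symmetrizer_id[OF \<mu>] mult_1_right)
  qed
  then have "card ?R = 0" unfolding 0 by simp
  then show False using card_0_eq[OF R.fin] R.id_mem by blast
qed

text \<open>Right multiplication by \<open>e\<close> projects the group algebra onto
  \<open>W\<close>, so the trace of \<open>T\<close> on \<open>W\<close> is that of
  \<open>x \<mapsto> T (x * e)\<close> on the whole algebra, read off in the basis of permutations.
  This removes the arbitrary basis chosen in \<open>trace_on\<close>.\<close>

lemma trace_on_idempotent_ideal:
  assumes e: "e \<in> sym_group_alg k" "e * e = e"
    and W: "W = {x * e | x. x \<in> sym_group_alg k}"
    and T: "\<And>x. x \<in> W \<Longrightarrow> T x \<in> W"
    and T_sum: "\<And>(I :: (nat \<Rightarrow> nat) set) f. T (sum f I) = (\<Sum>i\<in>I. T (f i))"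
    and T_scale: "\<And>c x. T (malg_scale c x) = malg_scale c (T x)"
  shows "trace_on W T = (\<Sum>\<tau>\<in>sym_group k. perm_coeff (T (perm_elt \<tau> * e)) \<tau>)"
proof -
  let ?G = "sym_group k"
  have sub: "malg.subspace W"
    unfolding malg.subspace_def
  proof (intro conjI ballI allI)
    show "0 \<in> W" unfolding W using sym_group_alg_zero by (intro CollectI exI[of _ 0]) simp
    fix x y c assume "x \<in> W"
    then obtain x' where x: "x = x' * e" "x' \<in> sym_group_alg k" unfolding W by blast
    have "malg_scale c x = malg_scale c x' * e" by (simp only: x malg_mult_scale)
    then show "malg_scale c x \<in> W" unfolding W using sym_group_alg_scale[OF x(2)] by blast
    assume "y \<in> W"
    then obtain y' where y: "y = y' * e" "y' \<in> sym_group_alg k" unfolding W by blast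
    have "x + y = (x' + y') * e" by (simp only: x y distrib_right)
    then show "x + y \<in> W" unfolding W using sym_group_alg_add[OF x(2) y(2)] by blast
  qed
  have fix_e: "x * e = x" if x: "x \<in> W" for x
  proof -
    obtain x' where x': "x = x' * e" using x unfolding W by blast
    show ?thesis by (simp only: x' mult.assoc e(2))
  qed
  have W_alg: "W \<subseteq> sym_group_alg k"
  proof
    fix x assume "x \<in> W"
    then obtain x' where x': "x = x' * e" "x' \<in> sym_group_alg k" unfolding W by blast
    show "x \<in> sym_group_alg k" unfolding x'(1) by (rule sym_group_alg_mult[OF x'(2) e(1)])
  qed
  have ex: "\<exists>B. malg.independent B \<and> malg.span B = W"
  proof -
    obtain B where B: "B \<subseteq> W" "malg.independent B" "W \<subseteq> malg.span B"
      by (rule malg.basis_exists[of W])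
    have "malg.span B \<subseteq> W" by (rule malg.span_minimal[OF B(1) sub])
    then show ?thesis using B(2,3) by (intro exI[of _ B] conjI equalityI)
  qed
  obtain B where B_def: "B = (SOME B. malg.independent B \<and> malg.span B = W)" by (rule that[OF refl])
  have B: "malg.independent B" "malg.span B = W"
    using someI_ex[OF ex] unfolding B_def[symmetric] by (rule conjunct1, rule conjunct2)
  have BW: "B \<subseteq> W" using malg.span_superset[of B] B(2) by simp
  have "{perm_elt \<sigma> |\<sigma>. \<sigma> permutes {1..k}} = perm_elt ` ?G" by blast
  then have "B \<subseteq> malg.span (perm_elt ` ?G)"
    using order_trans[OF BW W_alg] unfolding sym_group_alg_def by (simp only:)
  from malg.independent_span_bound[OF finite_imageI[OF finite_sym_group] B(1) this]
  have finB: "finite B" by (rule conjunct1)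
  have rep_T: "malg.representation B (T v) v =
      (\<Sum>\<tau>\<in>?G. perm_coeff v \<tau> * malg.representation B (T (perm_elt \<tau> * e)) v)" if v: "v \<in> B" for v
  proof -
    have vW: "v \<in> W" using v BW by blast
    have mem: "T (perm_elt \<tau> * e) \<in> malg.span B" if "\<tau> \<in> ?G" for \<tau>
      unfolding B(2)
    proof (rule T)
      show "perm_elt \<tau> * e \<in> W" unfolding W using that perm_elt_in_alg[of \<tau> k] by blast
    qed
    have "v = (\<Sum>\<tau>\<in>?G. malg_scale (perm_coeff v \<tau>) (perm_elt \<tau>))"
      using vW W_alg by (intro sym_group_alg_expand) blast
    from arg_cong[OF this, of "\<lambda>v. v * e"]
    have "v = (\<Sum>\<tau>\<in>?G. malg_scale (perm_coeff v \<tau>) (perm_elt \<tau> * e))"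
      unfolding fix_e[OF vW] sum_distrib_right malg_mult_scale .
    from arg_cong[OF this, of T]
    have "T v = (\<Sum>\<tau>\<in>?G. malg_scale (perm_coeff v \<tau>) (T (perm_elt \<tau> * e)))"
      unfolding T_sum T_scale .
    then have "malg.representation B (T v) v =
        (\<Sum>\<tau>\<in>?G. malg.representation B (malg_scale (perm_coeff v \<tau>) (T (perm_elt \<tau> * e))) v)"
      by (simp only: malg.representation_sum[OF B(1) malg.span_scale[OF mem]])
    also have "\<dots> = (\<Sum>\<tau>\<in>?G. perm_coeff v \<tau> * malg.representation B (T (perm_elt \<tau> * e)) v)"
      by (intro sum.cong refl) (simp only: malg.representation_scale[OF B(1) mem])
    finally show ?thesis .
  qed
  have "trace_on W T = (\<Sum>v\<in>B. malg.representation B (T v) v)"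
    unfolding trace_on_def B_def[symmetric] Let_def ..
  also have "\<dots> = (\<Sum>v\<in>B. \<Sum>\<tau>\<in>?G. perm_coeff v \<tau> * malg.representation B (T (perm_elt \<tau> * e)) v)"
    by (intro sum.cong refl rep_T)
  \<comment> \<open>Both traces are this double sum: the vectors of \<open>B\<close> are expanded in
    permutations, and each \<open>T (perm_elt \<tau> * e)\<close> in \<open>B\<close>.\<close>
  also have "\<dots> = (\<Sum>\<tau>\<in>?G. \<Sum>v\<in>B. perm_coeff v \<tau> * malg.representation B (T (perm_elt \<tau> * e)) v)"
    by (rule sum.swap)
  also have "\<dots> = (\<Sum>\<tau>\<in>?G. perm_coeff (T (perm_elt \<tau> * e)) \<tau>)"
  proof (intro sum.cong refl)
    fix \<tau> assume "\<tau> \<in> ?G"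
    then have "perm_elt \<tau> * e \<in> W" unfolding W using perm_elt_in_alg[of \<tau> k] by blast
    then have mem: "T (perm_elt \<tau> * e) \<in> malg.span B"
      unfolding B(2) by (rule T)
    have "T (perm_elt \<tau> * e) = (\<Sum>v\<in>B. malg_scale (malg.representation B (T (perm_elt \<tau> * e)) v) v)"
      by (rule malg.sum_representation_eq[OF B(1) mem finB order_refl, symmetric])
    then have "perm_coeff (T (perm_elt \<tau> * e)) \<tau> =
        perm_coeff (\<Sum>v\<in>B. malg_scale (malg.representation B (T (perm_elt \<tau> * e)) v) v) \<tau>"
      by (rule arg_cong)
    then show "(\<Sum>v\<in>B. perm_coeff v \<tau> * malg.representation B (T (perm_elt \<tau> * e)) v) = perm_coeff (T (perm_elt \<tau> * e)) \<tau>"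
      by (simp only: perm_coeff_sum perm_coeff_simps mult.commute)
  qed
  finally show ?thesis .
qed

text \<open>Dividing the symmetrizer by \<open>young_scalar \<mu>\<close> gives an idempotent
  \<open>e\<close> generating the same left ideal. The coefficient at \<tau> of
  \<open>perm_elt \<sigma> * (perm_elt \<tau> * e)\<close> is that of \<open>e\<close> at
  \<open>inv \<tau> \<circ> inv \<sigma> \<circ> \<tau>\<close>.\<close>

lemma usual_character_eq:
  assumes \<mu>: "partition_of k \<mu>" and \<sigma>: "\<sigma> permutes {1..k}"
  shows "usual_character \<mu> \<sigma> =
    (\<Sum>\<tau>\<in>sym_group k. perm_coeff (young_symmetrizer \<mu>) (inv \<tau> \<circ> inv \<sigma> \<circ> \<tau>)) / young_scalar \<mu>"
proof -
  let ?c = "young_symmetrizer \<mu>"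
  note n = young_scalar_nonzero[OF \<mu>]
  note c = young_symmetrizer_in_alg[OF \<mu>]
  define e where "e = malg_scale (1 / young_scalar \<mu>) ?c"
  have e: "e \<in> sym_group_alg k" unfolding e_def by (rule sym_group_alg_scale[OF c])
  have ee: "e * e = e"
    using n by (simp add: e_def malg_mult_scale young_symmetrizer_square[OF \<mu>])
  have k: "sum_list \<mu> = k" using \<mu> by (simp add: partition_of_def)
  have W: "irr_module \<mu> = {x * e | x. x \<in> sym_group_alg k}"
  proof (intro set_eqI iffI)
    fix y assume "y \<in> irr_module \<mu>"
    then obtain x where x: "y = x * ?c" "x \<in> sym_group_alg k" unfolding irr_module_def k by blast
    have "y = malg_scale (young_scalar \<mu>) x * e" using n by (simp add: x e_def malg_mult_scale)
    then show "y \<in> {x * e | x. x \<in> sym_group_alg k}" using sym_group_alg_scale[OF x(2)] by blast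
  next
    fix y assume "y \<in> {x * e | x. x \<in> sym_group_alg k}"
    then obtain x where x: "y = x * e" "x \<in> sym_group_alg k" by blast
    have "y = malg_scale (1 / young_scalar \<mu>) x * ?c" by (simp add: x e_def malg_mult_scale)
    then show "y \<in> irr_module \<mu>" unfolding irr_module_def k using sym_group_alg_scale[OF x(2)] by blast
  qed
  have "usual_character \<mu> \<sigma> = (\<Sum>\<tau>\<in>sym_group k. perm_coeff (perm_elt \<sigma> * (perm_elt \<tau> * e)) \<tau>)"
    unfolding usual_character_def
  proof (rule trace_on_idempotent_ideal[OF e ee W])
    fix x assume "x \<in> irr_module \<mu>"
    then obtain x' where x: "x = x' * e" "x' \<in> sym_group_alg k" unfolding W by blast
    then have "perm_elt \<sigma> * x = (perm_elt \<sigma> * x') * e" by (simp only: mult.assoc)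
    then show "perm_elt \<sigma> * x \<in> irr_module \<mu>"
      unfolding W using sym_group_alg_mult[OF perm_elt_in_alg[OF \<sigma>] x(2)] by blast
  qed (simp_all only: sum_distrib_left malg_mult_scale)
  also have "\<dots> = (\<Sum>\<tau>\<in>sym_group k. perm_coeff ?c (inv \<tau> \<circ> inv \<sigma> \<circ> \<tau>) / young_scalar \<mu>)"
  proof (intro sum.cong refl)
    fix \<tau> assume "\<tau> \<in> sym_group k"
    then have \<tau>: "\<tau> permutes {1..k}" by simp
    have "perm_coeff (perm_elt \<sigma> * (perm_elt \<tau> * e)) \<tau> = perm_coeff (perm_elt (\<sigma> \<circ> \<tau>) * e) \<tau>"
      by (simp only: mult.assoc[symmetric] perm_elt_mult)
    also have "\<dots> = perm_coeff e (inv (\<sigma> \<circ> \<tau>) \<circ> \<tau>)"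
      by (rule perm_coeff_mult_left[OF e permutes_bij[OF permutes_compose[OF \<tau> \<sigma>]]])
    also have "inv (\<sigma> \<circ> \<tau>) = inv \<tau> \<circ> inv \<sigma>"
      by (rule o_inv_distrib[OF permutes_bij[OF \<sigma>] permutes_bij[OF \<tau>]])
    finally show "perm_coeff (perm_elt \<sigma> * (perm_elt \<tau> * e)) \<tau> = perm_coeff ?c (inv \<tau> \<circ> inv \<sigma> \<circ> \<tau>) / young_scalar \<mu>"
      by (simp only: e_def perm_coeff_simps) simp
  qed
  finally show ?thesis by (simp only: sum_divide_distrib)
qed

text \<open>For a Young symmetrizer the coefficient of this class function at
  \<open>inv \<sigma>\<close> is \<open>young_scalar\<close> times the usual character at \<sigma>,
  which turns relations between characters into relations in the group algebra.\<close>

definition conj_sum :: "nat \<Rightarrow> (nat self_map \<Rightarrow>\<^sub>0 complex) \<Rightarrow> nat self_map \<Rightarrow>\<^sub>0 complex" where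
  "conj_sum k x = (\<Sum>\<tau>\<in>sym_group k. perm_elt \<tau> * x * perm_elt (inv \<tau>))"

text \<open>For different partitions every summand dies by orthogonality. For equal ones the trace
  property evaluates the sandwich around \<open>inv \<tau>\<close> as
  \<open>young_scalar \<mu>\<close> times the coefficient at \<tau>; the sum over \<tau> rebuilds
  the symmetrizer, and its square contributes the second factor.\<close>

lemma conj_sum_young_symmetrizer:
  assumes \<mu>: "partition_of k \<mu>" and \<nu>: "partition_of k \<nu>"
  shows "conj_sum k (young_symmetrizer \<mu>) * young_symmetrizer \<nu> =
    (if \<mu> = \<nu> then malg_scale (young_scalar \<mu> * young_scalar \<mu>) (young_symmetrizer \<mu>) else 0)"
proof -
  let ?c = "young_symmetrizer \<mu>"
  note c = young_symmetrizer_in_alg[OF \<mu>]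
  have expand: "conj_sum k ?c * young_symmetrizer \<nu> =
      (\<Sum>\<tau>\<in>sym_group k. perm_elt \<tau> * (?c * perm_elt (inv \<tau>) * young_symmetrizer \<nu>))"
    unfolding conj_sum_def sum_distrib_right by (simp only: mult.assoc)
  show ?thesis
  proof (cases "\<mu> = \<nu>")
    case False
    have "?c * perm_elt (inv \<tau>) * young_symmetrizer \<nu> = 0" if "\<tau> \<in> sym_group k" for \<tau>
      using that by (intro young_symmetrizer_orthogonal[OF \<mu> \<nu> False] perm_elt_in_alg permutes_inv) simp
    then show ?thesis unfolding expand using False by simp
  next
    case True
    have "?c * perm_elt (inv \<tau>) * ?c = malg_scale (young_scalar \<mu> * perm_coeff ?c \<tau>) ?c" if "\<tau> \<in> sym_group k" for \<tau>
    proof -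
      have \<tau>: "\<tau> permutes {1..k}" using that by simp
      have a: "perm_elt (inv \<tau>) \<in> sym_group_alg k" by (rule perm_elt_in_alg[OF permutes_inv[OF \<tau>]])
      have "perm_coeff (?c * perm_elt (inv \<tau>) * ?c) id = perm_coeff (?c * (?c * perm_elt (inv \<tau>))) id"
        by (rule perm_coeff_id_commute[OF sym_group_alg_mult[OF c a] c])
      also have "?c * (?c * perm_elt (inv \<tau>)) = malg_scale (young_scalar \<mu>) (?c * perm_elt (inv \<tau>))"
        by (simp only: mult.assoc[symmetric] young_symmetrizer_square[OF \<mu>] malg_mult_scale)
      also have "perm_coeff (malg_scale (young_scalar \<mu>) (?c * perm_elt (inv \<tau>))) id = young_scalar \<mu> * perm_coeff ?c \<tau>"
        by (simp only: perm_coeff_simps perm_coeff_mult_right[OF c permutes_bij[OF permutes_inv[OF \<tau>]]]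
            permutes_inv_inv[OF \<tau>] id_comp)
      finally show ?thesis using young_symmetrizer_sandwich[OF \<mu> a] by (simp only:)
    qed
    then have "conj_sum k ?c * ?c =
       (\<Sum>\<tau>\<in>sym_group k. perm_elt \<tau> * malg_scale (young_scalar \<mu> * perm_coeff ?c \<tau>) ?c)"
      unfolding expand[folded True] by (intro sum.cong refl) (simp only:)
    also have "\<dots> = malg_scale (young_scalar \<mu>) ((\<Sum>\<tau>\<in>sym_group k. malg_scale (perm_coeff ?c \<tau>) (perm_elt \<tau>)) * ?c)"
      unfolding sum_distrib_right malg.scale_sum_right by (simp only: malg_mult_scale malg.scale_scale)
    also have "(\<Sum>\<tau>\<in>sym_group k. malg_scale (perm_coeff ?c \<tau>) (perm_elt \<tau>)) = ?c"
      by (rule sym_group_alg_expand[OF c, symmetric])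
    finally have "conj_sum k ?c * ?c = malg_scale (young_scalar \<mu> * young_scalar \<mu>) ?c"
      unfolding young_symmetrizer_square[OF \<mu>] malg.scale_scale .
    then show ?thesis unfolding True[symmetric] by (simp only: if_True simp_thms)
  qed
qed

text \<open>The conjugation averages of Young symmetrizers are linearly independent by orthogonality, and
  there are at least as many of them as conjugacy classes, so they span the class functions.\<close>

lemma one_in_span_conj_sums:
  "1 \<in> malg.span ((\<lambda>\<mu>. conj_sum k (young_symmetrizer \<mu>)) ` {\<mu>. partition_of k \<mu>})"
proof -
  let ?P = "{\<mu>. partition_of k \<mu>}" and ?z = "\<lambda>\<mu>. conj_sum k (young_symmetrizer \<mu>)"
  let ?T = "(\<lambda>\<sigma>. conj_sum k (perm_elt \<sigma>)) ` sym_group k"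
  have c_ne: "young_symmetrizer \<mu> \<noteq> 0" if "partition_of k \<mu>" for \<mu>
    using perm_coeff_young_symmetrizer_id[OF that] by auto
  have inj: "inj_on ?z ?P"
  proof (rule inj_onI)
    fix \<mu> \<nu> assume \<mu>\<nu>: "\<mu> \<in> ?P" "\<nu> \<in> ?P" "?z \<mu> = ?z \<nu>"
    show "\<mu> = \<nu>"
    proof (rule ccontr)
      assume "\<mu> \<noteq> \<nu>"
      then have "?z \<mu> * young_symmetrizer \<nu> = 0" "?z \<nu> * young_symmetrizer \<nu> \<noteq> 0"
        using \<mu>\<nu>(1,2) c_ne young_scalar_nonzero by (auto simp: conj_sum_young_symmetrizer)
      then show False using \<mu>\<nu>(3) by simp
    qed
  qed
  have indep: "malg.independent (?z ` ?P)"
  proof (rule malg.independent_if_scalars_zero)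
    show "finite (?z ` ?P)" using finite_partitions by simp
    fix f x assume sum: "(\<Sum>x\<in>?z ` ?P. malg_scale (f x) x) = 0" and "x \<in> ?z ` ?P"
    then obtain \<nu> where \<nu>: "partition_of k \<nu>" "x = ?z \<nu>" by blast
    have "0 = (\<Sum>\<mu>\<in>?P. malg_scale (f (?z \<mu>)) (?z \<mu>)) * young_symmetrizer \<nu>"
      using sum by (simp add: sum.reindex[OF inj])
    also have "\<dots> = (\<Sum>\<mu>\<in>?P. if \<mu> = \<nu> then malg_scale (f x * (young_scalar \<nu> * young_scalar \<nu>)) (young_symmetrizer \<nu>) else 0)"
      unfolding sum_distrib_right
      by (intro sum.cong refl) (auto simp: malg_mult_scale conj_sum_young_symmetrizer \<nu>)
    also have "\<dots> = malg_scale (f x * (young_scalar \<nu> * young_scalar \<nu>)) (young_symmetrizer \<nu>)"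
      using finite_partitions \<nu>(1) by (simp add: sum.delta)
    finally show "f x = 0" using c_ne[OF \<nu>(1)] young_scalar_nonzero[OF \<nu>(1)] by simp
  qed
  \<comment> \<open>The elements of \<open>?T\<close> depend only on the cycle partition, because
    permutations with equal cycle partitions are conjugate.\<close>
  have card: "card ?T \<le> card ?P"
  proof -
    have class_eq: "conj_sum k (perm_elt \<sigma>) = conj_sum k (perm_elt \<sigma>')"
      if \<sigma>: "\<sigma> permutes {1..k}" and \<sigma>': "\<sigma>' permutes {1..k}" and eq: "cycle_partition k \<sigma> = cycle_partition k \<sigma>'" for \<sigma> \<sigma>'
    proof -
      interpret G: perm_subgroup "sym_group k" k by (rule perm_subgroup_sym_group)
      obtain \<rho> where \<rho>: "\<rho> permutes {1..k}" "\<sigma>' = \<rho> \<circ> \<sigma> \<circ> inv \<rho>"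
        using cycle_partition_eq_conj[OF \<sigma> \<sigma>' eq] .
      have "conj_sum k (perm_elt \<sigma>') = (\<Sum>\<tau>\<in>sym_group k. perm_elt (\<tau> \<circ> \<rho>) * perm_elt \<sigma> * perm_elt (inv (\<tau> \<circ> \<rho>)))"
        unfolding conj_sum_def
      proof (intro sum.cong refl)
        fix \<tau> assume "\<tau> \<in> sym_group k"
        then have "inv (\<tau> \<circ> \<rho>) = inv \<rho> \<circ> inv \<tau>"
          by (intro o_inv_distrib permutes_bij[OF \<rho>(1)]) (simp add: permutes_bij)
        then show "perm_elt \<tau> * perm_elt \<sigma>' * perm_elt (inv \<tau>) = perm_elt (\<tau> \<circ> \<rho>) * perm_elt \<sigma> * perm_elt (inv (\<tau> \<circ> \<rho>))"
          by (simp only: \<rho>(2) perm_elt_mult comp_assoc)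
      qed
      also have "\<dots> = conj_sum k (perm_elt \<sigma>)"
        unfolding conj_sum_def using \<rho>(1)
        by (intro G.sum_comp_right[of \<rho> "\<lambda>\<tau>. perm_elt \<tau> * perm_elt \<sigma> * perm_elt (inv \<tau>)"]) simp
      finally show ?thesis by (rule sym)
    qed
    have "card ?T \<le> card (cycle_partition k ` sym_group k)"
    proof -
      let ?r = "\<lambda>\<rho>. SOME \<sigma>. \<sigma> permutes {1..k} \<and> cycle_partition k \<sigma> = \<rho>"
      have "?T \<subseteq> (\<lambda>\<rho>. conj_sum k (perm_elt (?r \<rho>))) ` cycle_partition k ` sym_group k"
      proof clarify
        fix \<sigma> assume \<sigma>: "\<sigma> permutes {1..k}"
        have "?r (cycle_partition k \<sigma>) permutes {1..k} \<and> cycle_partition k (?r (cycle_partition k \<sigma>)) = cycle_partition k \<sigma>"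
          by (rule someI[of _ \<sigma>]) (use \<sigma> in simp)
        then have "conj_sum k (perm_elt \<sigma>) = conj_sum k (perm_elt (?r (cycle_partition k \<sigma>)))"
          using class_eq[OF \<sigma>] by metis
        then show "conj_sum k (perm_elt \<sigma>) \<in> (\<lambda>\<rho>. conj_sum k (perm_elt (?r \<rho>))) ` cycle_partition k ` sym_group k"
          using \<sigma> by blast
      qed
      then show ?thesis using finite_sym_group by (meson finite_imageI surj_card_le)
    qed
    also have "\<dots> \<le> card ?P"
      using cycle_partition(2) finite_partitions by (intro card_mono) auto
    finally show ?thesis .
  qed
  have span: "conj_sum k x \<in> malg.span ?T" if "x \<in> sym_group_alg k" for x
    using that
  proof (induction rule: sym_group_alg_induct)
    case zero
    show ?case by (simp add: conj_sum_def malg.span_zero)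
  next
    case (step c \<sigma> y)
    have "conj_sum k (malg_scale c (perm_elt \<sigma>) + y) = malg_scale c (conj_sum k (perm_elt \<sigma>)) + conj_sum k y"
      unfolding conj_sum_def
      by (simp only: distrib_left distrib_right sum.distrib malg_mult_scale malg.scale_sum_right)
    moreover have "conj_sum k (perm_elt \<sigma>) \<in> ?T" using step.hyps by blast
    ultimately show ?case using step.IH by (simp add: malg.span_add malg.span_scale malg.span_base)
  qed
  \<comment> \<open>Otherwise adjoining this element would give more independent vectors than the
    spanning set \<open>?T\<close> allows. The element is the group order times 1, and the order is
    divided out below.\<close>
  have "conj_sum k 1 \<in> malg.span (?z ` ?P)"
  proof (rule ccontr)
    assume notin: "conj_sum k 1 \<notin> malg.span (?z ` ?P)"
    have ind: "malg.independent (insert (conj_sum k 1) (?z ` ?P))"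
      by (rule malg.independent_insertI[OF notin indep])
    have sub: "insert (conj_sum k 1) (?z ` ?P) \<subseteq> malg.span ?T"
    proof (intro insert_subsetI image_subsetI)
      show "conj_sum k 1 \<in> malg.span ?T" by (rule span[OF one_in_alg])
      show "?z \<mu> \<in> malg.span ?T" if "\<mu> \<in> ?P" for \<mu>
        using that by (intro span young_symmetrizer_in_alg) simp
    qed
    have le: "card (insert (conj_sum k 1) (?z ` ?P)) \<le> card ?T"
      using malg.independent_span_bound[OF finite_imageI[OF finite_sym_group] ind sub] by (rule conjunct2)
    have "conj_sum k 1 \<notin> ?z ` ?P" using notin malg.span_base[of "conj_sum k 1"] by (rule contrapos_nn)
    then have "Suc (card ?P) \<le> card ?T"
      using le finite_partitions by (simp only: card_insert_disjoint finite_imageI card_image[OF inj] not_False_eq_True)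
    then show False using card by simp
  qed
  moreover have "conj_sum k 1 = malg_scale (of_nat (card (sym_group k))) 1"
  proof -
    have "conj_sum k 1 = (\<Sum>\<tau>\<in>sym_group k. malg_scale 1 1)"
      unfolding conj_sum_def
      by (intro sum.cong refl) (simp add: permutes_inv_o(1) perm_elt_id del: id_apply)
    then show ?thesis by (simp only: malg.scale_sum_left[symmetric]) simp
  qed
  moreover have card_ne: "card (sym_group k) \<noteq> 0"
  proof -
    have "id \<in> sym_group k" by (simp add: permutes_id)
    then show ?thesis using card_0_eq[OF finite_sym_group] by blast
  qed
  ultimately have "malg_scale (1 / of_nat (card (sym_group k))) (malg_scale (of_nat (card (sym_group k))) 1) \<in> malg.span (?z ` ?P)"
    by (simp only: malg.span_scale)
  then show ?thesis using card_ne by simp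
qed

lemma span_image_finite:
  assumes "finite P" "x \<in> malg.span (f ` P)"
  obtains d where "x = (\<Sum>p\<in>P. malg_scale (d p) (f p))"
proof -
  have "\<exists>d. x = (\<Sum>p\<in>P. malg_scale (d p) (f p))"
    using assms(2)
  proof (induction rule: malg.span_induct_alt)
    case base
    show ?case by (rule exI[of _ "\<lambda>_. 0"]) simp
  next
    case (step c s y)
    then obtain q d where q: "q \<in> P" "s = f q" and d: "y = (\<Sum>p\<in>P. malg_scale (d p) (f p))" by blast
    have "malg_scale c s = (\<Sum>p\<in>P. malg_scale (if p = q then c else 0) (f p))"
      using q assms(1) by (simp add: if_distrib[of "\<lambda>c. malg_scale c _"] cong: if_cong)
    then have "malg_scale c s + y = (\<Sum>p\<in>P. malg_scale ((if p = q then c else 0) + d p) (f p))"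
      by (simp only: d malg.scale_left_distrib sum.distrib)
    then show ?case by (rule exI[of _ "\<lambda>p. (if p = q then c else 0) + d p"])
  qed
  then show thesis using that by blast
qed

lemma perm_coeff_conj_sum:
  assumes "x \<in> sym_group_alg k"
  shows "perm_coeff (conj_sum k x) \<sigma> = (\<Sum>\<tau>\<in>sym_group k. perm_coeff x (inv \<tau> \<circ> \<sigma> \<circ> \<tau>))"
  unfolding conj_sum_def perm_coeff_sum
proof (intro sum.cong refl)
  fix \<tau> assume "\<tau> \<in> sym_group k"
  then have \<tau>: "\<tau> permutes {1..k}" by simp
  show "perm_coeff (perm_elt \<tau> * x * perm_elt (inv \<tau>)) \<sigma> = perm_coeff x (inv \<tau> \<circ> \<sigma> \<circ> \<tau>)"
    by (simp only: perm_coeff_mult_right[OF sym_group_alg_mult[OF perm_elt_in_alg[OF \<tau>] assms] permutes_bij[OF permutes_inv[OF \<tau>]]]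
        permutes_inv_inv[OF \<tau>] perm_coeff_mult_left[OF assms permutes_bij[OF \<tau>]] comp_assoc)
qed

text \<open>Coefficients at \<open>inv \<sigma>\<close> are compared in an expansion of 1 by
  conjugation sums; the factor \<open>young_scalar \<mu>\<close> cancels the denominator in the
  character formula. The classical coefficients are the dimensions divided by the group
  order.\<close>

lemma characters_span_identity_indicator:
  "\<exists>d. \<forall>\<sigma>. \<sigma> permutes {1..k} \<longrightarrow>
    (\<Sum>\<mu> | partition_of k \<mu>. d \<mu> * usual_character \<mu> \<sigma>) = (if \<sigma> = id then 1 else 0)"
proof -
  let ?P = "{\<mu>. partition_of k \<mu>}" and ?z = "\<lambda>\<mu>. conj_sum k (young_symmetrizer \<mu>)"
  from one_in_span_conj_sums[of k] obtain d' where d': "1 = (\<Sum>\<mu>\<in>?P. malg_scale (d' \<mu>) (?z \<mu>))"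
    by (rule span_image_finite[OF finite_partitions])
  show ?thesis
  proof (intro exI[of _ "\<lambda>\<mu>. d' \<mu> * young_scalar \<mu>"] allI impI)
    fix \<sigma> assume \<sigma>: "\<sigma> permutes {1..k}"
    have "(\<Sum>\<mu>\<in>?P. d' \<mu> * young_scalar \<mu> * usual_character \<mu> \<sigma>) = (\<Sum>\<mu>\<in>?P. d' \<mu> * perm_coeff (?z \<mu>) (inv \<sigma>))"
      using young_scalar_nonzero
      by (intro sum.cong refl) (simp add: usual_character_eq[OF _ \<sigma>] perm_coeff_conj_sum[OF young_symmetrizer_in_alg])
    also have "\<dots> = perm_coeff 1 (inv \<sigma>)"
      unfolding d' by (simp only: perm_coeff_sum perm_coeff_simps)
    also have "\<dots> = (if id = inv \<sigma> then 1 else 0)"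
      by (simp only: perm_elt_id[symmetric] perm_coeff_simps)
    also have "id = inv \<sigma> \<longleftrightarrow> \<sigma> = id"
      using permutes_inv_inv[OF \<sigma>] by (metis inv_id)
    finally show "(\<Sum>\<mu>\<in>?P. d' \<mu> * young_scalar \<mu> * usual_character \<mu> \<sigma>) = (if \<sigma> = id then 1 else 0)" .
  qed
qed

section \<open>Capelli immanants\<close>

text \<open>All parts are positive, so each row meets column 0.\<close>

lemma length_le_card_first_column:
  assumes \<nu>: "partition_of k \<nu>"
  shows "length \<nu> \<le> card {x\<in>{1..k}. col_of \<nu> x = 0}"
proof -
  let ?X = "{x\<in>{1..k}. col_of \<nu> x = 0}"
  have k: "sum_list \<nu> = k" using \<nu> by (simp add: partition_of_def)
  have pos: "\<nu> ! r > 0" if "r < length \<nu>" for r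
    using \<nu> nth_mem[OF that] by (simp add: partition_of_def)
  have "{..<length \<nu>} = {r. (r, 0) \<in> diagram \<nu>}"
    by (intro set_eqI) (simp add: diagram_def, use pos in fast)
  also have "{r. (r, c) \<in> diagram \<nu>} = row_of \<nu> ` {x\<in>{1..k}. col_of \<nu> x = c}" for c
    unfolding bij_betw_imp_surj_on[OF bij_betw_row_col[of \<nu>], symmetric] k by blast
  finally have "{..<length \<nu>} = row_of \<nu> ` ?X" .
  from arg_cong[OF this, of card] have "length \<nu> = card (row_of \<nu> ` ?X)" by simp
  also have "\<dots> \<le> card ?X" by (rule card_image_le) simp
  finally show ?thesis .
qed

lemma uea_self_neg:
  assumes "x = - x"
  shows "x = (0 :: 'a::super_alphabet uea)"
proof -
  have "x + x = 0" using assms by (metis add.right_inverse)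
  then have "uea_scale 2 x = 0" using uea.scale_left_distrib[of 1 1 x] by simp
  then show ?thesis by simp
qed

text \<open>A column longer than the number of letters contains two places with equal letters, and their
  transposition changes the sign of the Young symmetrizer.\<close>

lemma usual_character_symmetrization_eq_0:
  fixes i :: "nat \<Rightarrow> 'n::finite" and F :: "(nat \<Rightarrow> 'n) \<Rightarrow> 'a::super_alphabet uea"
  assumes \<nu>: "partition_of k \<nu>" and long: "CARD('n) < length \<nu>"
  shows "(\<Sum>\<sigma>\<in>sym_group k. uea_scale (usual_character \<nu> \<sigma>) (F (i \<circ> \<sigma>))) = 0"
proof -
  let ?G = "sym_group k" and ?c = "young_symmetrizer \<nu>"
  interpret G: perm_subgroup ?G k by (rule perm_subgroup_sym_group)
  \<comment> \<open>Already the contribution of each \<tau> in the character formula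
    vanishes.\<close>
  have inner: "(\<Sum>\<sigma>\<in>?G. uea_scale (perm_coeff ?c (inv \<tau> \<circ> inv \<sigma> \<circ> \<tau>)) (F (i \<circ> \<sigma>))) = 0" (is "?S = 0")
    if "\<tau> \<in> ?G" for \<tau>
  proof -
    from that have \<tau>: "\<tau> permutes {1..k}" by simp
    let ?X = "{x\<in>{1..k}. col_of \<nu> x = 0}"
    have "card ((i \<circ> \<tau>) ` ?X) \<le> CARD('n)" by (rule card_mono) auto
    then have "card ((i \<circ> \<tau>) ` ?X) < card ?X" using long length_le_card_first_column[OF \<nu>] by linarith
    from pigeonhole[OF this] obtain x y where xy: "x \<in> {1..k}" "y \<in> {1..k}" "x \<noteq> y"
      "col_of \<nu> x = 0" "col_of \<nu> y = 0" "i (\<tau> x) = i (\<tau> y)"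
      by (auto simp: inj_on_def)
    define w where "w = transpose x y"
    have wp: "w permutes {1..k}" unfolding w_def by (rule permutes_swap_id[OF xy(1,2)])
    have w: "w \<in> column_stabilizer \<nu>"
      unfolding mem_column_stabilizer[OF \<nu>]
    proof (intro conjI ballI)
      show "col_of \<nu> (w t) = col_of \<nu> t" for t
        using xy(4,5) by (cases "t = x"; cases "t = y") (simp_all add: transpose_def w_def)
    qed (rule wp)
    have iw: "i (\<tau> (w t)) = i (\<tau> t)" for t
      using xy(6) by (cases "t = x"; cases "t = y") (simp_all add: transpose_def w_def)
    have ww: "inv w = w"
      unfolding w_def by (rule inv_equality) (rule transpose_involutory)+
    have c_w: "perm_coeff ?c (\<rho> \<circ> w) = - perm_coeff ?c \<rho>" for \<rho>
    proof -
      have "?c * perm_elt w = malg_scale (- 1) ?c"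
        unfolding young_symmetrizer_eq mult.assoc column_sum_absorb(2)[OF \<nu> w] malg_mult_scale
        using xy(3) by (simp add: w_def sign_swap_id)
      then have "perm_coeff (?c * perm_elt w) \<rho> = - perm_coeff ?c \<rho>"
        by (simp only: perm_coeff_simps mult_minus1)
      then show ?thesis
        unfolding perm_coeff_mult_right[OF young_symmetrizer_in_alg[OF \<nu>] permutes_bij[OF wp]] ww .
    qed
    \<comment> \<open>The transposition of the places \<open>\<tau> x\<close> and
      \<open>\<tau> y\<close>, where \<open>i\<close> agrees: it leaves \<open>i\<close> unchanged,
      while inside the argument of the coefficient it becomes the column transposition
      \<open>w\<close>.\<close>
    define \<pi> where "\<pi> = \<tau> \<circ> w \<circ> inv \<tau>"
    have \<pi>: "\<pi> permutes {1..k}"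
      unfolding \<pi>_def by (rule permutes_compose[OF permutes_inv[OF \<tau>] permutes_compose[OF wp \<tau>]])
    have "?S = (\<Sum>\<sigma>\<in>?G. uea_scale (perm_coeff ?c (inv \<tau> \<circ> inv (\<pi> \<circ> \<sigma>) \<circ> \<tau>)) (F (i \<circ> (\<pi> \<circ> \<sigma>))))"
      by (rule G.sum_comp_left[symmetric]) (use \<pi> in simp)
    also have "\<dots> = (\<Sum>\<sigma>\<in>?G. - uea_scale (perm_coeff ?c (inv \<tau> \<circ> inv \<sigma> \<circ> \<tau>)) (F (i \<circ> \<sigma>)))"
    proof (intro sum.cong refl)
      fix \<sigma> assume "\<sigma> \<in> ?G"
      then have \<sigma>: "\<sigma> permutes {1..k}" by simp
      have "inv \<pi> = \<pi>"
      proof -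
        have "inv \<pi> = inv (inv \<tau>) \<circ> (inv w \<circ> inv \<tau>)"
          unfolding \<pi>_def
          by (simp only: o_inv_distrib[OF bij_comp[OF permutes_bij[OF wp] permutes_bij[OF \<tau>]] permutes_bij[OF permutes_inv[OF \<tau>]]]
              o_inv_distrib[OF permutes_bij[OF \<tau>] permutes_bij[OF wp]])
        then show ?thesis unfolding ww permutes_inv_inv[OF \<tau>] \<pi>_def by (simp only: comp_assoc)
      qed
      then have "inv (\<pi> \<circ> \<sigma>) = inv \<sigma> \<circ> \<pi>"
        by (simp only: o_inv_distrib[OF permutes_bij[OF \<pi>] permutes_bij[OF \<sigma>]])
      then have "inv \<tau> \<circ> inv (\<pi> \<circ> \<sigma>) \<circ> \<tau> = (inv \<tau> \<circ> inv \<sigma> \<circ> \<tau>) \<circ> w"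
        unfolding \<pi>_def by (simp only: comp_assoc permutes_inv_o(2)[OF \<tau>] comp_id)
      moreover have "i \<circ> (\<pi> \<circ> \<sigma>) = i \<circ> \<sigma>"
      proof
        show "(i \<circ> (\<pi> \<circ> \<sigma>)) t = (i \<circ> \<sigma>) t" for t
          by (simp only: \<pi>_def o_apply iw permutes_inverses(1)[OF \<tau>])
      qed
      ultimately show "uea_scale (perm_coeff ?c (inv \<tau> \<circ> inv (\<pi> \<circ> \<sigma>) \<circ> \<tau>)) (F (i \<circ> (\<pi> \<circ> \<sigma>))) =
          - uea_scale (perm_coeff ?c (inv \<tau> \<circ> inv \<sigma> \<circ> \<tau>)) (F (i \<circ> \<sigma>))"
        by (simp only: c_w uea.scale_minus_left)
    qed
    also have "\<dots> = - ?S" by (rule sum_negf)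
    finally show ?thesis by (rule uea_self_neg)
  qed
  have "(\<Sum>\<sigma>\<in>?G. uea_scale (usual_character \<nu> \<sigma>) (F (i \<circ> \<sigma>))) =
    (\<Sum>\<sigma>\<in>?G. \<Sum>\<tau>\<in>?G. uea_scale (1 / young_scalar \<nu>) (uea_scale (perm_coeff ?c (inv \<tau> \<circ> inv \<sigma> \<circ> \<tau>)) (F (i \<circ> \<sigma>))))"
  proof (intro sum.cong refl)
    fix \<sigma> assume "\<sigma> \<in> ?G"
    then have "usual_character \<nu> \<sigma> = (1 / young_scalar \<nu>) * (\<Sum>\<tau>\<in>?G. perm_coeff ?c (inv \<tau> \<circ> inv \<sigma> \<circ> \<tau>))"
      using usual_character_eq[OF \<nu>, of \<sigma>] by (simp only: mem_Collect_eq) (simp only: divide_inverse mult_1_left mult.commute)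
    then show "uea_scale (usual_character \<nu> \<sigma>) (F (i \<circ> \<sigma>)) =
      (\<Sum>\<tau>\<in>?G. uea_scale (1 / young_scalar \<nu>) (uea_scale (perm_coeff ?c (inv \<tau> \<circ> inv \<sigma> \<circ> \<tau>)) (F (i \<circ> \<sigma>))))"
      by (simp only: uea.scale_scale[symmetric] uea.scale_sum_left uea.scale_sum_right)
  qed
  also have "\<dots> = (\<Sum>\<tau>\<in>?G. \<Sum>\<sigma>\<in>?G. uea_scale (1 / young_scalar \<nu>) (uea_scale (perm_coeff ?c (inv \<tau> \<circ> inv \<sigma> \<circ> \<tau>)) (F (i \<circ> \<sigma>))))"
    by (rule sum.swap)
  also have "\<dots> = (\<Sum>\<tau>\<in>?G. uea_scale (1 / young_scalar \<nu>) 0)"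
    by (intro sum.cong refl) (simp only: uea.scale_sum_right[symmetric] inner)
  finally show ?thesis by simp
qed

theorem theorem5p4:
  fixes \<alpha> :: "nat \<Rightarrow> ('m0::finite, 'm1::finite, 'n::finite) symbol"
    and h :: nat
  assumes "inj_on \<alpha> {1..h}" and "\<alpha> ` {1..h} \<subseteq> range Alpha"
  shows "uea.span (\<Union>k\<le>h. {Cimm \<alpha> k \<mu> i j | \<mu> i j.
           partition_of k \<mu> \<and> first_part \<mu> \<le> CARD('n)}) = (uea_filtration h :: 'n proper uea set)"
proof -
  let ?I = "\<Union>k\<le>h. {Cimm \<alpha> k \<mu> i j | \<mu> i j. partition_of k \<mu> \<and> first_part \<mu> \<le> CARD('n)}"
  have Cimm_eq: "Cimm \<alpha> k \<mu> i j =
      (\<Sum>\<sigma>\<in>sym_group k. uea_scale (usual_character (conjugate \<mu>) \<sigma>) (column_bitableau_rec k (i \<circ> \<sigma>) j))"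
    if "k \<le> h" for k \<mu> i j
  proof -
    have le: "{1..k} \<subseteq> {1..h}" using that by simp
    have "column_bitableau \<alpha> k i j = column_bitableau_rec k i j" for i j
      by (rule column_bitableau_eq[OF inj_on_subset[OF assms(1) le] order_trans[OF image_mono[OF le] assms(2)]])
    then show ?thesis unfolding Cimm_def irr_character_def by (simp only:)
  qed
  have bitableau_in_span: "column_bitableau_rec k i j \<in> uea.span ?I" if "k \<le> h" for k i j
  proof -
    obtain d where d: "\<And>\<sigma>. \<sigma> permutes {1..k} \<Longrightarrow>
        (\<Sum>\<nu> | partition_of k \<nu>. d \<nu> * usual_character \<nu> \<sigma>) = (if \<sigma> = id then 1 else 0)"
      using characters_span_identity_indicator[of k] by blast
    let ?F = "\<lambda>\<sigma>. column_bitableau_rec k (i \<circ> \<sigma>) j"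
    have "column_bitableau_rec k i j = (\<Sum>\<sigma>\<in>sym_group k. if \<sigma> = id then ?F id else 0)"
      using finite_sym_group[of k] permutes_id by simp
    also have "\<dots> = (\<Sum>\<sigma>\<in>sym_group k. uea_scale (\<Sum>\<nu> | partition_of k \<nu>. d \<nu> * usual_character \<nu> \<sigma>) (?F \<sigma>))"
      by (intro sum.cong refl) (simp add: d)
    also have "\<dots> = (\<Sum>\<nu> | partition_of k \<nu>. uea_scale (d \<nu>) (\<Sum>\<sigma>\<in>sym_group k. uea_scale (usual_character \<nu> \<sigma>) (?F \<sigma>)))"
      unfolding uea.scale_sum_left uea.scale_sum_right uea.scale_scale by (rule sum.swap)
    also have "\<dots> \<in> uea.span ?I"
    proof (rule uea.span_sum, rule uea.span_scale)
      fix \<nu> assume "\<nu> \<in> {\<nu>. partition_of k \<nu>}"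
      then have \<nu>: "partition_of k \<nu>" by simp
      show "(\<Sum>\<sigma>\<in>sym_group k. uea_scale (usual_character \<nu> \<sigma>) (?F \<sigma>)) \<in> uea.span ?I"
      \<comment> \<open>Conjugation turns the length of \<nu> into the first part of its label. A
        longer \<nu> has no admissible label, but its symmetrization is zero.\<close>
      proof (cases "length \<nu> \<le> CARD('n)")
        case True
        let ?\<mu> = "conjugate \<nu>"
        have "first_part ?\<mu> \<le> CARD('n)"
          using True length_conjugate[of ?\<mu>] by (simp add: conjugate_conjugate[OF \<nu>])
        then have "Cimm \<alpha> k ?\<mu> i j \<in> ?I" using partition_of_conjugate[OF \<nu>] that by blast
        then show ?thesis
          unfolding Cimm_eq[OF that] conjugate_conjugate[OF \<nu>] by (rule uea.span_base)
      next
        case False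
        then have "CARD('n) < length \<nu>" by simp
        from usual_character_symmetrization_eq_0[OF \<nu> this, of "\<lambda>i. column_bitableau_rec k i j"]
        show ?thesis by (simp only: uea.span_zero)
      qed
    qed
    finally show ?thesis .
  qed
  have "Cimm \<alpha> k \<mu> i j \<in> uea_filtration h" if "k \<le> h" for k \<mu> i j
    unfolding Cimm_eq[OF that] span_column_bitableaux[symmetric]
    using that by (intro uea.span_sum uea.span_scale uea.span_base) blast
  then have "?I \<subseteq> uea_filtration h" by blast
  then have "uea.span ?I \<subseteq> uea_filtration h"
    by (rule uea.span_minimal) (simp add: uea_filtration_def)
  moreover have "uea_filtration h \<subseteq> uea.span ?I"
    unfolding span_column_bitableaux[symmetric]
    by (rule uea.span_minimal) (use bitableau_in_span in auto)
  ultimately show ?thesis by (rule antisym)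
qed

end
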